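(* Let $0<q<\infty$, $m\in\mathbb{R}$, and $\mu\in\mathbb{N}$. If $s\le\tau_q$, then there exist $a\in\mathcal{S}_{1,1}^{m}$ and $f\in S'$ such that $$\sup_{0\leq k\leq\mu-1}\big\Vert 2^{k(s+m)}\Pi_kf\big\Vert_{L^{\infty}}+\sup_{R\in\mathcal{D}_{\mu}}\Big(\frac{1}{|R|}\int_R\sum_{k=\mu}^{\infty}2^{(s+m)kq}\big|\Pi_kf(x)\big|^q\,dx\Big)^{1/q}<\infty$$ and $$\sup_{P\in\mathcal{D}_{\mu}}\Big(\frac{1}{|P|}\int_P\sum_{k=\mu}^{\infty}2^{skq}\big|\Pi_kT_{[a]}f(x)\big|^q\,dx\Big)^{1/q}=\infty.$$
   Context: $S=S(\mathbb{R}^d)$ is the Schwartz space, $S'$ the tempered distributions; $\widehat f(\xi)=\int f(x)e^{-2\pi i\langle x,\xi\rangle}dx$. $\mathbb{N}=\{1,2,\dots\}$. $\mathcal{D}_k$ is the set of dyadic cubes in $\mathbb{R}^d$ of side length $2^{-k}$. $\tau_q:=\frac{d}{\min(1,q)}-d$. Symbols: $a\in\mathcal{S}^m_{1,1}$ means that $a$ is a smooth function on $\mathbb{R}^d\times\mathbb{R}^d$ such that for all multi-indices $\alpha,\beta$ there is $c_{\alpha,\beta}$ with $|\partial_\xi^\alpha\partial_x^\beta a(x,\xi)|\le c_{\alpha,\beta}(1+|\xi|)^{m-|\alpha|+|\beta|}$ for all $(x,\xi)$. Littlewood–Paley operators: fix $\phi\in S$ with $\widehat\phi$ supported in $\{2^{-1}\le|\xi|\le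 2\}$ and $\sum_{k\in\mathbb{Z}}\widehat{\phi_k}(\xi)=1$ for $\xi\ne0$, where $\phi_k:=2^{kd}\phi(2^k\cdot)$. Let $\widehat\Phi:=1-\sum_{k=1}^\infty\widehat{\phi_k}$. Put $\Pi_0f:=\Phi*f$ and $\Pi_kf:=\phi_k*f$ for $k\ge1$. The operator $T_{[a]}$: for $f\in S$, $T_{[a]}f(x)=\int a(x,\xi)\widehat f(\xi)e^{2\pi i\langle x,\xi\rangle}d\xi$. For $j,k\ge0$ let $a_{j,k}(x,\xi):=\big(\phi_j*a(\cdot,\xi)\big)(x)\,\widehat{\phi_k}(\xi)$, with $\Phi$ in place of $\phi_0$ when $j=0$ or $k=0$; since $a_{j,k}(x,\cdot)$ has compact support, $T_{[a_{j,k}]}f$ makes sense for every $f\in S'$. For $f\in S'$, $T_{[a]}f:=\lim_{N\to\infty}\sum_{k=0}^N\sum_{j=0}^N T_{[a_{j,k}]}f$ whenever the limit converges in $S'$. *)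

theory Defs
  imports "HOL-Analysis.Analysis" "HOL-Probability.Essential_Supremum"
begin

section \<open>Smooth functions and Schwartz space\<close>

text \<open>A multi-index is encoded by a list of coordinate directions, so that the order
  of the multi-index is the length of the list. For smooth functions partial
  derivatives commute, hence only the multiplicities matter and quantifying over
  such lists is quantifying over multi-indices.\<close>

primrec iter_deriv ::
    "'a::euclidean_space list \<Rightarrow> ('a \<Rightarrow> 'b::real_normed_vector) \<Rightarrow> 'a \<Rightarrow> 'b" where
  "iter_deriv [] f = f"
| "iter_deriv (v # vs) f = (\<lambda>x. frechet_derivative (iter_deriv vs f) (at x) v)"

text \<open>All iterated partial derivatives exist and are Frechet differentiable (in
  particular continuous), i.e. the function is of class C-infinity.\<close>

definition smooth :: "('a::euclidean_space \<Rightarrow> 'b::real_normed_vector) \<Rightarrow> bool" where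
  "smooth f \<longleftrightarrow> (\<forall>vs. set vs \<subseteq> Basis \<longrightarrow> (\<forall>x. iter_deriv vs f differentiable (at x)))"

definition schwartz :: "('a::euclidean_space \<Rightarrow> complex) \<Rightarrow> bool" where
  "schwartz g \<longleftrightarrow> smooth g \<and>
     (\<forall>(N::nat) vs. set vs \<subseteq> Basis \<longrightarrow>
        (\<exists>C. \<forall>x. (1 + norm x) ^ N * norm (iter_deriv vs g x) \<le> C))"

text \<open>The supremum is that of a bounded set when \<open>g\<close> is a Schwartz function.\<close>

definition schwartz_seminorm ::
    "nat \<Rightarrow> 'a::euclidean_space list \<Rightarrow> ('a \<Rightarrow> complex) \<Rightarrow> real" where
  "schwartz_seminorm N vs g = (SUP x. (1 + norm x) ^ N * norm (iter_deriv vs g x))"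

definition schwartz_tendsto ::
    "(nat \<Rightarrow> 'a::euclidean_space \<Rightarrow> complex) \<Rightarrow> ('a \<Rightarrow> complex) \<Rightarrow> bool" where
  "schwartz_tendsto G g \<longleftrightarrow>
     (\<forall>N vs. set vs \<subseteq> Basis \<longrightarrow> (\<lambda>n. schwartz_seminorm N vs (\<lambda>x. G n x - g x)) \<longlonglongrightarrow> 0)"

section \<open>Tempered distributions\<close>

text \<open>A tempered distribution is a continuous linear functional on the Schwartz
  space; continuity is sequential continuity because the Schwartz space is
  metrizable. The functional is total, but its values off the Schwartz space are
  irrelevant. The pairing is bilinear (no complex conjugation).\<close>

type_synonym 'a functional = "('a \<Rightarrow> complex) \<Rightarrow> complex"

definition tempered :: "'a::euclidean_space functional \<Rightarrow> bool" where
  "tempered u \<longleftrightarrow>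
     (\<forall>g h. schwartz g \<longrightarrow> schwartz h \<longrightarrow> u (\<lambda>x. g x + h x) = u g + u h) \<and>
     (\<forall>c g. schwartz g \<longrightarrow> u (\<lambda>x. c * g x) = c * u g) \<and>
     (\<forall>G g. (\<forall>n. schwartz (G n)) \<longrightarrow> schwartz g \<longrightarrow> schwartz_tendsto G g \<longrightarrow>
        (\<lambda>n. u (G n)) \<longlonglongrightarrow> u g)"

definition function_dist :: "('a::euclidean_space \<Rightarrow> complex) \<Rightarrow> 'a functional" where
  "function_dist F = (\<lambda>g. LINT x|lborel. F x * g x)"

definition tempered_tendsto :: "(nat \<Rightarrow> 'a::euclidean_space functional) \<Rightarrow> 'a functional \<Rightarrow> bool" where
  "tempered_tendsto U u \<longleftrightarrow> tempered u \<and> (\<forall>g. schwartz g \<longrightarrow> (\<lambda>N. U N g) \<longlonglongrightarrow> u g)"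

definition fourier :: "('a::euclidean_space \<Rightarrow> complex) \<Rightarrow> 'a \<Rightarrow> complex" where
  "fourier g \<xi> = (LINT x|lborel. g x * cis (- 2 * pi * (x \<bullet> \<xi>)))"

definition fourier_dist :: "'a::euclidean_space functional \<Rightarrow> 'a functional" where
  "fourier_dist u = (\<lambda>g. u (fourier g))"

definition conv ::
    "('a::euclidean_space \<Rightarrow> complex) \<Rightarrow> ('a \<Rightarrow> complex) \<Rightarrow> 'a \<Rightarrow> complex" where
  "conv g F x = (LINT y|lborel. g (x - y) * F y)"

text \<open>The convolution of a Schwartz function with a tempered distribution is a
  (smooth) function.\<close>

definition conv_dist ::
    "('a::euclidean_space \<Rightarrow> complex) \<Rightarrow> 'a functional \<Rightarrow> 'a \<Rightarrow> complex" where
  "conv_dist g u x = u (\<lambda>y. g (x - y))"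

section \<open>Symbols\<close>

text \<open>The first component of the argument of a symbol is the space variable, the
  second one the frequency variable.\<close>

definition symbol_S11 ::
    "real \<Rightarrow> ((real^'n) \<times> (real^'n) \<Rightarrow> complex) \<Rightarrow> bool" where
  "symbol_S11 m a \<longleftrightarrow> smooth a \<and>
     (\<forall>\<alpha> \<beta> :: 'n list. \<exists>c. \<forall>x \<xi>.
        norm (iter_deriv (map (\<lambda>i. (0, axis i 1)) \<alpha> @ map (\<lambda>i. (axis i 1, 0)) \<beta>) a (x, \<xi>))
          \<le> c * (1 + norm \<xi>) powr (m - real (length \<alpha>) + real (length \<beta>)))"

section \<open>Littlewood--Paley operators\<close>

definition dilate :: "int \<Rightarrow> (real^'n \<Rightarrow> complex) \<Rightarrow> real^'n \<Rightarrow> complex" where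
  "dilate k \<phi> x = complex_of_real (2 powr (real_of_int k * real CARD('n))) * \<phi> ((2 powr real_of_int k) *\<^sub>R x)"

definition littlewood_paley :: "(real^'n \<Rightarrow> complex) \<Rightarrow> (real^'n \<Rightarrow> complex) \<Rightarrow> bool" where
  "littlewood_paley \<phi> \<Phi> \<longleftrightarrow>
     schwartz \<phi> \<and>
     (\<forall>\<xi>. fourier \<phi> \<xi> \<noteq> 0 \<longrightarrow> 1/2 \<le> norm \<xi> \<and> norm \<xi> \<le> 2) \<and>
     (\<forall>\<xi>. \<xi> \<noteq> 0 \<longrightarrow> ((\<lambda>k::int. fourier (dilate k \<phi>) \<xi>) has_sum 1) UNIV) \<and>
     schwartz \<Phi> \<and>
     (\<forall>\<xi>. fourier \<Phi> \<xi> = 1 - (\<Sum>k. fourier (dilate (int (Suc k)) \<phi>) \<xi>))"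

definition lp_kernel ::
    "(real^'n \<Rightarrow> complex) \<Rightarrow> (real^'n \<Rightarrow> complex) \<Rightarrow> nat \<Rightarrow> real^'n \<Rightarrow> complex" where
  "lp_kernel \<phi> \<Phi> k = (if k = 0 then \<Phi> else dilate (int k) \<phi>)"

definition LP ::
    "(real^'n \<Rightarrow> complex) \<Rightarrow> (real^'n \<Rightarrow> complex) \<Rightarrow> nat \<Rightarrow> (real^'n) functional \<Rightarrow> real^'n \<Rightarrow> complex" where
  "LP \<phi> \<Phi> k f = conv_dist (lp_kernel \<phi> \<Phi> k) f"

section \<open>Pseudo-differential operators on tempered distributions\<close>

definition symbol_piece ::
    "(real^'n \<Rightarrow> complex) \<Rightarrow> (real^'n \<Rightarrow> complex) \<Rightarrow> ((real^'n) \<times> (real^'n) \<Rightarrow> complex)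
      \<Rightarrow> nat \<Rightarrow> nat \<Rightarrow> (real^'n) \<times> (real^'n) \<Rightarrow> complex" where
  "symbol_piece \<phi> \<Phi> a j k = (\<lambda>(x, \<xi>).
     conv (lp_kernel \<phi> \<Phi> j) (\<lambda>y. a (y, \<xi>)) x * fourier (lp_kernel \<phi> \<Phi> k) \<xi>)"

text \<open>If \<open>b (x, \<cdot>)\<close> is smooth with compact support, the formal integral of
  \<open>b (x, \<xi>) * f^(\<xi>) * exp (2 \<pi> i x \<xi>)\<close> over \<open>\<xi>\<close> is the pairing of the Fourier
  transform of the distribution \<open>f\<close> with the test function
  \<open>b (x, \<cdot>) * exp (2 \<pi> i x \<cdot>)\<close>.\<close>

definition psido_compact ::
    "((real^'n) \<times> (real^'n) \<Rightarrow> complex) \<Rightarrow> (real^'n) functional \<Rightarrow> real^'n \<Rightarrow> complex" where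
  "psido_compact b f x = fourier_dist f (\<lambda>\<xi>. b (x, \<xi>) * cis (2 * pi * (x \<bullet> \<xi>)))"

definition psido_partial ::
    "(real^'n \<Rightarrow> complex) \<Rightarrow> (real^'n \<Rightarrow> complex) \<Rightarrow> ((real^'n) \<times> (real^'n) \<Rightarrow> complex)
      \<Rightarrow> (real^'n) functional \<Rightarrow> nat \<Rightarrow> (real^'n) functional" where
  "psido_partial \<phi> \<Phi> a f N =
     (\<lambda>g. \<Sum>k\<le>N. \<Sum>j\<le>N. function_dist (psido_compact (symbol_piece \<phi> \<Phi> a j k) f) g)"

definition psido_converges ::
    "(real^'n \<Rightarrow> complex) \<Rightarrow> (real^'n \<Rightarrow> complex) \<Rightarrow> ((real^'n) \<times> (real^'n) \<Rightarrow> complex)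
      \<Rightarrow> (real^'n) functional \<Rightarrow> bool" where
  "psido_converges \<phi> \<Phi> a f \<longleftrightarrow> (\<exists>u. tempered_tendsto (psido_partial \<phi> \<Phi> a f) u)"

text \<open>Meaningful only when \<open>psido_converges\<close> holds; the limit in the space of tempered
  distributions is then the pointwise limit on Schwartz functions.\<close>

definition psido ::
    "(real^'n \<Rightarrow> complex) \<Rightarrow> (real^'n \<Rightarrow> complex) \<Rightarrow> ((real^'n) \<times> (real^'n) \<Rightarrow> complex)
      \<Rightarrow> (real^'n) functional \<Rightarrow> (real^'n) functional" where
  "psido \<phi> \<Phi> a f = (\<lambda>g. lim (\<lambda>N. psido_partial \<phi> \<Phi> a f N g))"

section \<open>Dyadic cubes and norms\<close>

definition dyadic_cubes :: "nat \<Rightarrow> (real^'n) set set" where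
  "dyadic_cubes k = range (\<lambda>l :: 'n \<Rightarrow> int.
     {x. \<forall>i. of_int (l i) / 2 ^ k \<le> x $ i \<and> x $ i < (of_int (l i) + 1) / 2 ^ k})"

definition Linf_norm :: "(real^'n \<Rightarrow> complex) \<Rightarrow> ennreal" where
  "Linf_norm F = esssup lborel (\<lambda>x. ennreal (norm (F x)))"

text \<open>Real powers with positive exponent on the extended nonnegative reals.\<close>

definition ennpowr :: "ennreal \<Rightarrow> real \<Rightarrow> ennreal" where
  "ennpowr x p = (if x = \<infinity> then \<infinity> else ennreal (enn2real x powr p))"

definition cube_norm ::
    "real \<Rightarrow> real \<Rightarrow> nat \<Rightarrow> (nat \<Rightarrow> real^'n \<Rightarrow> complex) \<Rightarrow> ennreal" where
  "cube_norm s q \<mu> F = (SUP R\<in>dyadic_cubes \<mu>.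
     ennpowr
       ((\<integral>\<^sup>+x\<in>R. (\<Sum>k. ennreal (2 powr (s * real (\<mu> + k) * q) * norm (F (\<mu> + k) x) powr q)) \<partial>lborel)
          / emeasure lborel R)
       (1 / q))"

definition tau :: "nat \<Rightarrow> real \<Rightarrow> real" where
  "tau d q = real d / min 1 q - real d"

end

theory Submission
  imports Defs "HOL-Probability.Probability" "HOL-Computational_Algebra.Polynomial"
begin

text \<open>
  The symbol is of Ching's type, \<open>a (x, \<xi>) = \<Sum>n. 2 ^ (m n) exp (- 2 \<pi> i 2 ^ n x \<bullet> e) \<eta> (2 ^ - n \<xi>)\<close>
  with \<open>\<eta>\<close> a bump at the unit vector \<open>e\<close>: it shifts frequencies near \<open>2 ^ n e\<close> to the
  neighbourhood of the origin. On the sphere of radius \<open>2 ^ n\<close> the partition of unity consists of a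
  single function with the value 1, because the supports of its neighbours end there; hence the
  decomposition of \<open>a\<close> in the space variable is exact. The input is a series of modulated bumps
  \<open>c n exp (2 \<pi> i 2 ^ n x \<bullet> e) 2 ^ (d r) \<psi> (2 ^ r (x - p))\<close> with \<open>r \<le> n\<close>, and the operator just
  removes the modulation and replaces \<open>c n\<close> by \<open>D n = 2 ^ (m n) c n\<close>. The bumps are placed at
  centres \<open>p\<close> tending to infinity so fast that all series define tempered distributions and bumps
  with different centres do not interact.

  For \<open>q \<le> 1\<close> each centre carries one bump with \<open>r = n\<close>. Its demodulation acts like a point mass
  on all frequencies below \<open>2 ^ n\<close>, and each of these about \<open>n\<close> frequency bands contributes at least
  as much to the norm as the single band of the input. For \<open>q > 1\<close> each centre carries many
  frequencies \<open>n\<close> with the same \<open>r\<close>; their demodulations are equal and add up coherently, while the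
  input only sees the \<open>q\<close>-summability of the coefficients.
\<close>

section \<open>The Fourier transform\<close>

text \<open>A bump of width 2^-k normalised in L^1 has L^q norm of order 2^(k d (1 - 1/q)), so with
  the weight 2^(s k) the band k of the image counts 2^(k (s - \<tau>)), where \<tau> = d/q - d. For
  s \<le> \<tau> this does not increase with k, which is the origin of the threshold when q \<le> 1.
  At s = \<tau> nothing exponential is left and divergence has to be won from a power of n:
  coefficients with q-th power n^(-1/2), placed at n = 2^l only, are summable, while n bands times
  n^(-1/2) tend to infinity. For q > 1 the same room lies between l^q and l^1: n^(-\<theta>) with
  1/q < \<theta> < 1. The coefficients may grow exponentially, so they cannot make the series
  converge by themselves. The L^q size of a bump does not depend on where it sits, while a test
  function sees a bump at p only with the factor 1 / (1 + |p|); translation thus pays for the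
  growth. Because no derivative of a test function enters, the distributions are concrete series on
  which the operator is evaluated term by term.\<close>

lemma borel_measurable_cis [measurable (raw)]:
  "f \<in> borel_measurable M \<Longrightarrow> (\<lambda>x. cis (f x)) \<in> borel_measurable M"
  by (rule measurable_compose[of f M borel cis])
     (auto intro!: borel_measurable_continuous_onI continuous_intros)

lemma integrable_lborel_measurable: "integrable lborel f \<Longrightarrow> f \<in> borel_measurable borel"
  by (drule borel_measurable_integrable) simp

lemma nn_integral_lborel_affine:
  fixes f :: "'a::euclidean_space \<Rightarrow> ennreal"
  assumes "f \<in> borel_measurable borel" "c \<noteq> 0"
  shows "(\<integral>\<^sup>+x. f x \<partial>lborel) = ennreal (\<bar>c\<bar> ^ DIM('a)) * (\<integral>\<^sup>+x. f (t + c *\<^sub>R x) \<partial>lborel)"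
proof -
  have [measurable]: "f \<in> borel_measurable borel" by fact
  show ?thesis
    by (subst lborel_affine[OF assms(2), of t], subst nn_integral_density)
      (auto simp: nn_integral_distr nn_integral_cmult)
qed

lemma integral_lborel_affine:
  fixes f :: "'a::euclidean_space \<Rightarrow> 'b::{banach,second_countable_topology}"
  assumes "f \<in> borel_measurable borel" "c \<noteq> 0"
  shows "(LINT x|lborel. f x) = \<bar>c\<bar> ^ DIM('a) *\<^sub>R (LINT x|lborel. f (t + c *\<^sub>R x))"
proof -
  have [measurable]: "f \<in> borel_measurable borel" by fact
  show ?thesis
    by (subst lborel_affine[OF assms(2), of t], subst integral_density)
      (auto simp: integral_distr)
qed

lemma integrable_lborel_affine:
  fixes f :: "'a::euclidean_space \<Rightarrow> 'b::{banach,second_countable_topology}"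
  assumes "integrable lborel f" "c \<noteq> 0"
  shows "integrable lborel (\<lambda>x. f (t + c *\<^sub>R x))"
proof -
  have m [measurable]: "f \<in> borel_measurable borel"
    by (rule integrable_lborel_measurable[OF assms(1)])
  have "ennreal (\<bar>c\<bar> ^ DIM('a)) * (\<integral>\<^sup>+x. norm (f (t + c *\<^sub>R x)) \<partial>lborel) < \<infinity>"
    using assms nn_integral_lborel_affine[of "\<lambda>x. ennreal (norm (f x))" c t]
    by (simp add: integrable_iff_bounded)
  then have "(\<integral>\<^sup>+x. norm (f (t + c *\<^sub>R x)) \<partial>lborel) < \<infinity>"
    using assms(2) by (auto simp: ennreal_mult_less_top less_top)
  then show ?thesis by (intro integrableI_bounded) auto
qed

text \<open>By \<open>lborel_eq\<close> the measure is an image of the product measure over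
  \<open>Basis\<close>, so integrals of tensor products factor.\<close>

lemma integral_lborel_prod_Basis:
  fixes f :: "'a::euclidean_space \<Rightarrow> real \<Rightarrow> complex"
  assumes "\<And>b. b \<in> Basis \<Longrightarrow> integrable lborel (f b)"
  shows "(LINT x|lborel. (\<Prod>b\<in>Basis. f b (x \<bullet> b))) = (\<Prod>b\<in>Basis. LINT t|lborel. f b t)"
proof -
  interpret product_sigma_finite "\<lambda>b::'a. lborel :: real measure" ..
  have [measurable]: "f b \<in> borel_measurable borel" if "b \<in> Basis" for b
    using borel_measurable_integrable[OF assms[OF that]] by simp
  have m: "(\<lambda>x. \<Prod>b\<in>Basis. f b (x \<bullet> b)) \<in> borel_measurable borel"
    by (intro borel_measurable_prod) measurable
  have "(LINT x|lborel. (\<Prod>b\<in>Basis. f b (x \<bullet> b))) =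
      (LINT g|(\<Pi>\<^sub>M b\<in>Basis. lborel). (\<Prod>b\<in>Basis. f b ((\<Sum>b\<in>Basis. g b *\<^sub>R b) \<bullet> b)))"
    by (subst lborel_eq, subst integral_distr) (use m in \<open>auto intro!: borel_measurable_sum\<close>)
  also have "\<dots> = (LINT g|(\<Pi>\<^sub>M b\<in>Basis. lborel). (\<Prod>b\<in>Basis. f b (g b)))"
    by (intro Bochner_Integration.integral_cong prod.cong refl) (simp add: inner_sum_left_Basis)
  also have "\<dots> = (\<Prod>b\<in>Basis. LINT t|lborel. f b t)"
    by (intro product_integral_prod) (auto simp: assms)
  finally show ?thesis .
qed

text \<open>Both facts are read off from the standard normal distribution, through its density and
  its characteristic function.\<close>

lemma gaussian_integrable: "integrable lborel (\<lambda>t::real. exp (- t\<^sup>2 / 2))"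
  and gaussian_char: "(LINT t|lborel. complex_of_real (exp (- t\<^sup>2 / 2)) * cis (z * t))
     = complex_of_real (sqrt (2 * pi) * exp (- z\<^sup>2 / 2))"
proof -
  have "integrable lborel (\<lambda>t. sqrt (2 * pi) * std_normal_density t)" by simp
  then show "integrable lborel (\<lambda>t::real. exp (- t\<^sup>2 / 2))"
    by (simp add: std_normal_density_def)
  have "char std_normal_distribution z = complex_of_real (exp (- z\<^sup>2 / 2))"
    by (simp add: char_std_normal_distribution)
  then have "(LINT t|lborel. std_normal_density t *\<^sub>R cis (z * t)) = complex_of_real (exp (- z\<^sup>2 / 2))"
    unfolding char_def by (subst (asm) integral_density) (auto simp: cis_conv_exp)
  moreover have "std_normal_density t *\<^sub>R cis (z * t)
     = complex_of_real (1 / sqrt (2 * pi)) * (complex_of_real (exp (- t\<^sup>2 / 2)) * cis (z * t))" for t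
    by (simp add: std_normal_density_def scaleR_conv_of_real)
  ultimately have "complex_of_real (1 / sqrt (2 * pi)) *
      (LINT t|lborel. complex_of_real (exp (- t\<^sup>2 / 2)) * cis (z * t)) = complex_of_real (exp (- z\<^sup>2 / 2))"
    by simp
  then show "(LINT t|lborel. complex_of_real (exp (- t\<^sup>2 / 2)) * cis (z * t))
     = complex_of_real (sqrt (2 * pi) * exp (- z\<^sup>2 / 2))"
    by (simp add: field_simps)
qed

lemma norm_sq_Basis: "(norm (x::'a::euclidean_space))\<^sup>2 = (\<Sum>b\<in>Basis. (x \<bullet> b)\<^sup>2)"
  unfolding power2_norm_eq_inner by (subst euclidean_inner) (simp add: power2_eq_square)

lemma cis_sum: "finite A \<Longrightarrow> cis (\<Sum>a\<in>A. f a) = (\<Prod>a\<in>A. cis (f a))"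
  by (induction A rule: finite_induct) (auto simp: cis_mult [symmetric])

lemma gaussian_prod:
  "complex_of_real (exp (- (norm x)\<^sup>2 / 2)) * cis (w \<bullet> x) =
     (\<Prod>b\<in>Basis. complex_of_real (exp (- (x \<bullet> b)\<^sup>2 / 2)) * cis ((w \<bullet> b) * (x \<bullet> b)))"
proof -
  have "exp (- (norm x)\<^sup>2 / 2) = (\<Prod>b\<in>Basis. exp (- (x \<bullet> b)\<^sup>2 / 2))"
    by (simp add: norm_sq_Basis sum_negf sum_divide_distrib flip: exp_sum)
  moreover have "cis (w \<bullet> x) = (\<Prod>b\<in>Basis. cis ((w \<bullet> b) * (x \<bullet> b)))"
    by (simp add: euclidean_inner[of w x] cis_sum)
  ultimately show ?thesis by (simp add: prod.distrib)
qed

lemma gaussian_fourier: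
  fixes w :: "'a::euclidean_space"
  shows "(LINT x|lborel. complex_of_real (exp (- (norm x)\<^sup>2 / 2)) * cis (w \<bullet> x))
     = complex_of_real (sqrt (2 * pi) ^ DIM('a) * exp (- (norm w)\<^sup>2 / 2))"
proof -
  have "(LINT x|lborel. complex_of_real (exp (- (norm x)\<^sup>2 / 2)) * cis (w \<bullet> x))
     = (\<Prod>b\<in>(Basis::'a set). LINT t|lborel. complex_of_real (exp (- t\<^sup>2 / 2)) * cis ((w \<bullet> b) * t))"
    unfolding gaussian_prod
    by (rule integral_lborel_prod_Basis, rule Bochner_Integration.integrable_bound[OF gaussian_integrable])
       (auto simp: norm_mult)
  also have "\<dots> = (\<Prod>b\<in>(Basis::'a set). complex_of_real (sqrt (2 * pi) * exp (- (w \<bullet> b)\<^sup>2 / 2)))"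
    by (intro prod.cong refl gaussian_char)
  also have "\<dots> = complex_of_real (sqrt (2 * pi) ^ DIM('a) * exp (- (norm w)\<^sup>2 / 2))"
    by (simp add: norm_sq_Basis sum_negf sum_divide_distrib prod.distrib flip: of_real_prod)
       (simp add: exp_sum flip: sum_negf)
  finally show ?thesis .
qed

text \<open>A function that is not integrable has Bochner integral 0 by convention, whereas the
  transform of the Gaussian at frequency 0 is positive.\<close>

lemma gaussian_integrable_euclidean: "integrable lborel (\<lambda>x::'a::euclidean_space. exp (- (norm x)\<^sup>2 / 2))"
proof (rule ccontr)
  assume "\<not> ?thesis"
  then have "(LINT x|lborel. complex_of_real (exp (- (norm (x::'a))\<^sup>2 / 2))) = 0"
    by (simp add: not_integrable_integral_eq)
  with gaussian_fourier[of "0::'a"] show False by simp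
qed

lemma fourier_integrand_integrable:
  assumes "integrable lborel f"
  shows "integrable lborel (\<lambda>x. f x * cis (t * (x \<bullet> \<xi>)))"
proof -
  have [measurable]: "f \<in> borel_measurable borel"
    by (rule integrable_lborel_measurable[OF assms])
  show ?thesis
    by (rule Bochner_Integration.integrable_bound[OF assms]) (auto simp: norm_mult)
qed

lemma norm_fourier_le: "norm (fourier f \<xi>) \<le> (LINT x|lborel. norm (f x))"
  unfolding fourier_def by (rule order_trans[OF integral_norm_bound]) (simp add: norm_mult)

lemma continuous_fourier:
  fixes f :: "'a::euclidean_space \<Rightarrow> complex"
  assumes f: "integrable lborel f"
  shows "continuous_on UNIV (fourier f)"
proof -
  have [measurable]: "f \<in> borel_measurable borel"
    by (rule integrable_lborel_measurable[OF f])
  have "(\<lambda>n. fourier f (X n)) \<longlonglongrightarrow> fourier f \<xi>" if X: "X \<longlonglongrightarrow> \<xi>" for X and \<xi> :: 'a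
    unfolding fourier_def
  proof (rule integral_dominated_convergence[where w = "\<lambda>x. norm (f x)"])
    show "AE x in lborel. (\<lambda>n. f x * cis (- 2 * pi * (x \<bullet> X n))) \<longlonglongrightarrow> f x * cis (- 2 * pi * (x \<bullet> \<xi>))"
      by (intro AE_I2 tendsto_intros X tendsto_cis)
  qed (auto simp: f norm_mult)
  then show ?thesis
    by (intro continuous_at_imp_continuous_on ballI)
       (auto simp: continuous_at_sequentially o_def)
qed

lemma borel_measurable_fourier [measurable (raw)]:
  "integrable lborel f \<Longrightarrow> g \<in> borel_measurable M \<Longrightarrow> (\<lambda>x. fourier f (g x)) \<in> borel_measurable M"
  by (rule measurable_compose[of g M borel "fourier f"])
     (auto intro!: borel_measurable_continuous_onI continuous_fourier)

lemma integrable_lborel_mult_prod: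
  fixes f g :: "'a::euclidean_space \<Rightarrow> complex"
  assumes f: "integrable lborel f" and g: "integrable lborel g"
  shows "integrable (lborel \<Otimes>\<^sub>M lborel) (\<lambda>(x, y). f x * g y)"
proof -
  have [measurable]: "f \<in> borel_measurable borel" "g \<in> borel_measurable borel"
    using f g by (simp_all add: integrable_lborel_measurable)
  show ?thesis
  proof (rule lborel_pair.Fubini_integrable)
    show "integrable lborel (\<lambda>x. LINT y|lborel. norm (case (x, y) of (x, y) \<Rightarrow> f x * g y))"
      using f by (simp add: norm_mult)
  qed (use f g in \<open>auto intro!: AE_I2\<close>)
qed

text \<open>Fubini, as the kernel is symmetric in its two variables. Besides inversion it serves to
  evaluate a series of functions at a Fourier transform, which is how \<open>psido_compact\<close>
  acts on the input.\<close>

lemma fourier_multiplication_formula: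
  fixes f g :: "'a::euclidean_space \<Rightarrow> complex"
  assumes f: "integrable lborel f" and g: "integrable lborel g"
  shows "(LINT y|lborel. f y * fourier g y) = (LINT \<xi>|lborel. fourier f \<xi> * g \<xi>)"
proof -
  have [measurable]: "f \<in> borel_measurable borel" "g \<in> borel_measurable borel"
    using f g by (simp_all add: integrable_lborel_measurable)
  have "integrable (lborel \<Otimes>\<^sub>M lborel) (\<lambda>(x, y). f x * g y * cis (- 2 * pi * (x \<bullet> y)))"
    by (rule Bochner_Integration.integrable_bound[OF integrable_lborel_mult_prod[OF f g]])
       (auto simp: norm_mult split_beta)
  note F = lborel_pair.Fubini_integral[OF this]
  have "(LINT y|lborel. f y * fourier g y)
      = (LINT x|lborel. LINT y|lborel. f x * g y * cis (- 2 * pi * (x \<bullet> y)))"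
    unfolding fourier_def
    by (subst integral_mult_right_zero[symmetric]) (simp add: mult_ac inner_commute)
  also have "\<dots> = (LINT y|lborel. LINT x|lborel. f x * g y * cis (- 2 * pi * (x \<bullet> y)))"
    by (rule F[symmetric])
  also have "\<dots> = (LINT \<xi>|lborel. fourier f \<xi> * g \<xi>)"
    unfolding fourier_def
    by (subst integral_mult_left_zero[symmetric]) (simp add: mult_ac)
  finally show ?thesis .
qed

text \<open>Gaussian summation: \<open>L \<epsilon>\<close> damps the inversion integral by a
  Gaussian, and by the multiplication formula it equals, up to a constant,
  \<open>R \<epsilon>\<close>, an average of \<open>g\<close> around \<open>x\<close> at scale
  \<epsilon>. Both sides converge as \<epsilon> tends to 0.\<close>

theorem fourier_inversion:
  fixes g :: "'a::euclidean_space \<Rightarrow> complex"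
  assumes cont: "continuous_on UNIV g" and bdd: "\<And>x. norm (g x) \<le> B"
    and int: "integrable lborel g" and int': "integrable lborel (fourier g)"
  shows "(LINT \<xi>|lborel. fourier g \<xi> * cis (2 * pi * (x \<bullet> \<xi>))) = g x"
proof -
  define d where "d = DIM('a)"
  have [measurable]: "g \<in> borel_measurable borel" "fourier g \<in> borel_measurable borel"
    using borel_measurable_integrable[OF int] borel_measurable_integrable[OF int'] by simp_all
  define \<gamma> where "\<gamma> = (\<lambda>x::'a. exp (- (norm x)\<^sup>2 / 2))"
  have \<gamma>_int: "integrable lborel \<gamma>"
    unfolding \<gamma>_def by (rule gaussian_integrable_euclidean)
  have \<gamma>_cont: "isCont \<gamma> z" for z unfolding \<gamma>_def by (intro continuous_intros) auto
  have [measurable]: "\<gamma> \<in> borel_measurable borel"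
    using borel_measurable_integrable[OF \<gamma>_int] by simp
  define L where "L = (\<lambda>\<epsilon>. LINT \<xi>|lborel. fourier g \<xi> * (cis (2 * pi * (x \<bullet> \<xi>)) * complex_of_real (\<gamma> (\<epsilon> *\<^sub>R \<xi>))))"
  define R where "R = (\<lambda>\<epsilon>. LINT z|lborel. g (x + (\<epsilon> / (2 * pi)) *\<^sub>R z) * complex_of_real (\<gamma> z))"
  have LR: "L \<epsilon> = complex_of_real ((1 / sqrt (2 * pi)) ^ d) * R \<epsilon>" if "\<epsilon> > 0" for \<epsilon>
  proof -
    define G where "G = (\<lambda>\<xi>. cis (2 * pi * (x \<bullet> \<xi>)) * complex_of_real (\<gamma> (\<epsilon> *\<^sub>R \<xi>)))"
    have "integrable lborel (\<lambda>\<xi>. \<gamma> (0 + \<epsilon> *\<^sub>R \<xi>))"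
      by (rule integrable_lborel_affine[OF \<gamma>_int]) (use that in auto)
    then have G_int: "integrable lborel G"
      unfolding G_def by (rule Bochner_Integration.integrable_bound) (auto simp: norm_mult)
    have FG: "fourier G y = complex_of_real ((sqrt (2 * pi) / \<epsilon>) ^ d * \<gamma> ((2 * pi / \<epsilon>) *\<^sub>R (x - y)))" for y
    proof -
      define w where "w = (2 * pi / \<epsilon>) *\<^sub>R (x - y)"
      have "fourier G y = (LINT \<xi>|lborel. complex_of_real (\<gamma> (\<epsilon> *\<^sub>R \<xi>)) * cis (w \<bullet> (\<epsilon> *\<^sub>R \<xi>)))"
        unfolding fourier_def G_def w_def using that
        by (intro Bochner_Integration.integral_cong)
           (auto simp: cis_mult algebra_simps inner_diff_left inner_commute)
      moreover have "(LINT \<xi>|lborel. complex_of_real (\<gamma> \<xi>) * cis (w \<bullet> \<xi>)) =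
          \<epsilon> ^ d *\<^sub>R (LINT \<xi>|lborel. complex_of_real (\<gamma> (\<epsilon> *\<^sub>R \<xi>)) * cis (w \<bullet> (\<epsilon> *\<^sub>R \<xi>)))"
        using integral_lborel_affine[of "\<lambda>\<xi>. complex_of_real (\<gamma> \<xi>) * cis (w \<bullet> \<xi>)" \<epsilon> 0] that
        by (simp add: d_def)
      moreover have "(LINT \<xi>|lborel. complex_of_real (\<gamma> \<xi>) * cis (w \<bullet> \<xi>)) =
          complex_of_real (sqrt (2 * pi) ^ d * \<gamma> w)"
        unfolding \<gamma>_def d_def by (rule gaussian_fourier)
      ultimately show ?thesis using that unfolding w_def
        by (simp add: scaleR_conv_of_real power_divide field_simps)
    qed
    have "L \<epsilon> = (LINT y|lborel. g y * fourier G y)"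
      unfolding L_def using fourier_multiplication_formula[OF int G_int] by (simp add: G_def)
    also have "\<dots> = \<bar>\<epsilon> / (2 * pi)\<bar> ^ d *\<^sub>R (LINT z|lborel. g (x + (\<epsilon> / (2 * pi)) *\<^sub>R z)
         * fourier G (x + (\<epsilon> / (2 * pi)) *\<^sub>R z))"
      unfolding d_def using that G_int
      by (intro integral_lborel_affine) auto
    also have "(\<lambda>z. fourier G (x + (\<epsilon> / (2 * pi)) *\<^sub>R z)) =
        (\<lambda>z. complex_of_real ((sqrt (2 * pi) / \<epsilon>) ^ d * \<gamma> z))"
      unfolding FG using that by (auto simp: \<gamma>_def)
    also have "(LINT z|lborel. g (x + (\<epsilon> / (2 * pi)) *\<^sub>R z) * complex_of_real ((sqrt (2 * pi) / \<epsilon>) ^ d * \<gamma> z))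
       = complex_of_real ((sqrt (2 * pi) / \<epsilon>) ^ d) * R \<epsilon>"
      unfolding R_def by (subst integral_mult_right_zero[symmetric]) (simp add: mult_ac)
    also have "\<bar>\<epsilon> / (2 * pi)\<bar> ^ d *\<^sub>R (complex_of_real ((sqrt (2 * pi) / \<epsilon>) ^ d) * R \<epsilon>)
      = complex_of_real ((\<epsilon> / (2 * pi) * (sqrt (2 * pi) / \<epsilon>)) ^ d) * R \<epsilon>"
      using that by (simp only: scaleR_conv_of_real power_mult_distrib of_real_mult mult.assoc) simp
    also have "\<epsilon> / (2 * pi) * (sqrt (2 * pi) / \<epsilon>) = 1 / sqrt (2 * pi)"
      using that by (simp add: field_simps)
    finally show ?thesis .
  qed
  define \<epsilon> where "\<epsilon> = (\<lambda>n. 1 / real (Suc n))"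
  have \<epsilon>: "\<epsilon> \<longlonglongrightarrow> 0" "\<And>n. \<epsilon> n > 0"
    unfolding \<epsilon>_def using LIMSEQ_inverse_real_of_nat by (auto simp: inverse_eq_divide)
  have "(\<lambda>n. L (\<epsilon> n)) \<longlonglongrightarrow> (LINT \<xi>|lborel. fourier g \<xi> * cis (2 * pi * (x \<bullet> \<xi>)))"
    unfolding L_def
  proof (rule integral_dominated_convergence[where w = "\<lambda>x. norm (fourier g x)"])
    show "AE \<xi> in lborel. (\<lambda>n. fourier g \<xi> * (cis (2 * pi * (x \<bullet> \<xi>)) * complex_of_real (\<gamma> (\<epsilon> n *\<^sub>R \<xi>))))
        \<longlonglongrightarrow> fourier g \<xi> * cis (2 * pi * (x \<bullet> \<xi>))"
    proof (rule AE_I2)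
      fix \<xi>
      have "(\<lambda>n. \<gamma> (\<epsilon> n *\<^sub>R \<xi>)) \<longlonglongrightarrow> \<gamma> (0 *\<^sub>R \<xi>)"
        by (intro isCont_tendsto_compose[OF \<gamma>_cont] tendsto_intros \<epsilon>)
      then have "(\<lambda>n. fourier g \<xi> * (cis (2 * pi * (x \<bullet> \<xi>)) * complex_of_real (\<gamma> (\<epsilon> n *\<^sub>R \<xi>))))
        \<longlonglongrightarrow> fourier g \<xi> * (cis (2 * pi * (x \<bullet> \<xi>)) * complex_of_real (\<gamma> (0 *\<^sub>R \<xi>)))"
        by (intro tendsto_intros)
      then show "(\<lambda>n. fourier g \<xi> * (cis (2 * pi * (x \<bullet> \<xi>)) * complex_of_real (\<gamma> (\<epsilon> n *\<^sub>R \<xi>))))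
        \<longlonglongrightarrow> fourier g \<xi> * cis (2 * pi * (x \<bullet> \<xi>))"
        by (simp add: \<gamma>_def)
    qed
  qed (auto simp: int' norm_mult \<gamma>_def mult_left_le)
  moreover have "(\<lambda>n. R (\<epsilon> n)) \<longlonglongrightarrow> (LINT z|lborel. g x * complex_of_real (\<gamma> z))"
    unfolding R_def
  proof (rule integral_dominated_convergence[where w = "\<lambda>z. B * \<gamma> z"])
    have "isCont g x" for x using cont by (simp add: continuous_on_eq_continuous_at)
    then have "(\<lambda>n. g (x + (\<epsilon> n / (2 * pi)) *\<^sub>R z)) \<longlonglongrightarrow> g (x + (0 / (2 * pi)) *\<^sub>R z)" for z
      by (intro isCont_tendsto_compose[where g = g] tendsto_intros \<epsilon>) auto
    then show "AE z in lborel. (\<lambda>n. g (x + (\<epsilon> n / (2 * pi)) *\<^sub>R z) * complex_of_real (\<gamma> z)) \<longlonglongrightarrow>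
        g x * complex_of_real (\<gamma> z)"
      by (auto intro!: AE_I2 tendsto_intros)
    show "AE z in lborel. norm (g (x + (\<epsilon> n / (2 * pi)) *\<^sub>R z) * complex_of_real (\<gamma> z)) \<le> B * \<gamma> z" for n
      by (intro AE_I2) (auto simp: norm_mult \<gamma>_def intro!: mult_right_mono bdd)
  qed (auto simp: \<gamma>_int)
  then have "(\<lambda>n. complex_of_real ((1 / sqrt (2 * pi)) ^ d) * R (\<epsilon> n)) \<longlonglongrightarrow>
      complex_of_real ((1 / sqrt (2 * pi)) ^ d) * (g x * (LINT z|lborel. complex_of_real (\<gamma> z)))"
    by (intro tendsto_intros) simp
  moreover have "(LINT z|lborel. complex_of_real (\<gamma> z)) = complex_of_real (sqrt (2 * pi) ^ d)"
    using gaussian_fourier[of "0::'a"] by (simp add: \<gamma>_def d_def)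
  ultimately show ?thesis
    using LIMSEQ_unique[of "\<lambda>n. L (\<epsilon> n)"]
    by (simp add: LR \<epsilon>(2) power_divide)
qed

section \<open>Rapidly decreasing functions\<close>

text \<open>All that the proof takes from a Schwartz function: continuity and decay of every order,
  but no bound on a derivative.\<close>

definition rapid :: "('a::euclidean_space \<Rightarrow> complex) \<Rightarrow> bool" where
  "rapid g \<longleftrightarrow> continuous_on UNIV g \<and> (\<forall>N::nat. \<exists>C. \<forall>x. (1 + norm x) ^ N * norm (g x) \<le> C)"

text \<open>Normalised in L^1, so that the Fourier transform is only rescaled
  (\<open>fourier_dil\<close>). The real factor covers the dyadic kernels as well as the fixed
  shrinking of the spectrum in \<open>\<psi>\<close>.\<close>

definition dil :: "real \<Rightarrow> ('a::euclidean_space \<Rightarrow> complex) \<Rightarrow> 'a \<Rightarrow> complex" where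
  "dil t g x = complex_of_real (t ^ DIM('a)) * g (t *\<^sub>R x)"

text \<open>Majorant by dyadic balls: the least \<open>j\<close> with
  \<open>norm x \<le> 2 ^ j\<close> satisfies \<open>2 ^ j \<le> 2 * (1 + norm x)\<close>. The ball
  of radius \<open>2 ^ j\<close> has volume of order \<open>2 ^ (j * d)\<close> against a weight of
  order \<open>2 ^ (- j * (d + 1))\<close>, which leaves a geometric series of ratio 1/2.\<close>

lemma integrable_inverse_power:
  "integrable lborel (\<lambda>x::'a::euclidean_space. 1 / (1 + norm x) ^ (DIM('a) + 1))"
proof -
  define d where "d = DIM('a)"
  have le: "ennreal (1 / (1 + norm x) ^ (d + 1)) \<le>
      (\<Sum>j. ennreal (2 ^ (d + 1) * (1 / 2 ^ (d + 1)) ^ j) * indicator (cball 0 (2 ^ j)) x)" for x :: 'a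
  proof -
    have "\<exists>n. norm x \<le> 2 ^ n"
      using real_arch_pow[of 2 "norm x"] by (auto intro: less_imp_le)
    define j where "j = (LEAST n. norm x \<le> 2 ^ n)"
    have j: "norm x \<le> 2 ^ j" unfolding j_def by (rule LeastI_ex) fact
    have "2 ^ j \<le> 2 * (1 + norm x)"
    proof (cases j)
      case (Suc i)
      then have "\<not> norm x \<le> 2 ^ i" unfolding j_def using not_less_Least[of i "\<lambda>n. norm x \<le> 2 ^ n"] by auto
      with Suc show ?thesis by auto
    qed (use norm_ge_zero[of x] in simp)
    then have "(2 ^ j) ^ (d + 1) \<le> (2 * (1 + norm x)) ^ (d + 1)"
      by (intro power_mono) auto
    then have le: "(2 ^ j) ^ (d + 1) \<le> 2 ^ (d + 1) * (1 + norm x) ^ (d + 1)"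
      by (simp only: power_mult_distrib)
    have pos: "(1 + norm x) ^ (d + 1) > 0" by (intro zero_less_power add_pos_nonneg) auto
    have eq: "(1 / 2 ^ (d + 1)) ^ j = 1 / ((2::real) ^ j) ^ (d + 1)"
      by (simp only: power_divide power_one power_mult[symmetric] mult.commute)
    have "1 / (1 + norm x) ^ (d + 1) \<le> 2 ^ (d + 1) * (1 / 2 ^ (d + 1)) ^ j"
      unfolding eq using le pos by (simp del: power_Suc power_add add: divide_simps mult.commute)
    then have "ennreal (1 / (1 + norm x) ^ (d + 1)) \<le>
        (\<Sum>i\<in>{j}. ennreal (2 ^ (d + 1) * (1 / 2 ^ (d + 1)) ^ i) * indicator (cball 0 (2 ^ i)) x)"
      using j by (simp add: ennreal_leI)
    also have "\<dots> \<le> (\<Sum>j. ennreal (2 ^ (d + 1) * (1 / 2 ^ (d + 1)) ^ j) * indicator (cball 0 (2 ^ j)) x)"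
      by (rule sum_le_suminf) auto
    finally show ?thesis .
  qed
  have "(\<integral>\<^sup>+x. ennreal (1 / (1 + norm (x::'a)) ^ (d + 1)) \<partial>lborel) \<le>
      (\<integral>\<^sup>+x. (\<Sum>j. ennreal (2 ^ (d + 1) * (1 / 2 ^ (d + 1)) ^ j) * indicator (cball 0 (2 ^ j)) (x::'a)) \<partial>lborel)"
    by (rule nn_integral_mono) (rule le)
  also have "\<dots> = (\<Sum>j. ennreal (2 ^ (d + 1) * (1 / 2 ^ (d + 1)) ^ j) * emeasure lborel (cball (0::'a) (2 ^ j)))"
    by (subst nn_integral_suminf) (auto simp: nn_integral_cmult_indicator intro!: borel_measurable_times_ennreal borel_measurable_indicator borel_closed)
  also have "\<dots> = (\<Sum>j. ennreal (2 ^ (d + 1) * unit_ball_vol (real d) * (1 / 2) ^ j))"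
  proof (rule suminf_cong)
    fix j :: nat
    have "2 ^ (d + 1) * (1 / 2 ^ (d + 1)) ^ j * (unit_ball_vol (real d) * (2 ^ j) ^ d)
        = (2 ^ (d + 1) * unit_ball_vol (real d) * (1 / 2) ^ j :: real)"
      by (simp add: power_divide power_mult[symmetric] field_simps power_add)
    then show "ennreal (2 ^ (d + 1) * (1 / 2 ^ (d + 1)) ^ j) * emeasure lborel (cball (0::'a) (2 ^ j))
        = ennreal (2 ^ (d + 1) * unit_ball_vol (real d) * (1 / 2) ^ j)"
      by (simp add: emeasure_cball d_def flip: ennreal_mult')
  qed
  also have "\<dots> = ennreal (\<Sum>j. 2 ^ (d + 1) * unit_ball_vol (real d) * (1 / 2) ^ j)"
    by (rule suminf_ennreal2) (auto intro!: summable_mult summable_geometric mult_nonneg_nonneg unit_ball_vol_nonneg)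
  also have "\<dots> < \<infinity>" by simp
  finally show ?thesis
    unfolding d_def[symmetric] by (intro integrableI_bounded) (auto simp: d_def)
qed

lemma rapidE:
  assumes "rapid g"
  obtains C where "C > 0" "\<And>x. (1 + norm x) ^ N * norm (g x) \<le> C"
proof -
  obtain C where C: "\<And>x. (1 + norm x) ^ N * norm (g x) \<le> C"
    using assms unfolding rapid_def by blast
  have "(1 + norm x) ^ N * norm (g x) \<le> max C 1" for x using C[of x] by linarith
  then show ?thesis using that[of "max C 1"] by simp
qed

lemma rapid_bounded:
  assumes "rapid g" obtains C where "\<And>x. norm (g x) \<le> C"
  using rapidE[OF assms, of 0] by auto

lemma borel_measurable_rapid: "rapid g \<Longrightarrow> g \<in> borel_measurable borel"
  unfolding rapid_def by (blast intro: borel_measurable_continuous_onI)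

lemma rapid_weight_integrable:
  fixes g :: "'a::euclidean_space \<Rightarrow> complex"
  assumes "rapid g"
  shows "integrable lborel (\<lambda>x. (1 + norm x) ^ N * norm (g x))"
proof -
  have [measurable]: "g \<in> borel_measurable borel" using assms by (rule borel_measurable_rapid)
  obtain C where C: "C > 0" "\<And>x. (1 + norm x) ^ (N + (DIM('a) + 1)) * norm (g x) \<le> C"
    using rapidE[OF assms] by blast
  have "integrable lborel (\<lambda>x::'a. C * (1 / (1 + norm x) ^ (DIM('a) + 1)))"
    by (intro integrable_mult_right integrable_inverse_power)
  then show ?thesis
  proof (rule Bochner_Integration.integrable_bound)
    have "(1 + norm x) ^ N * norm (g x) \<le> C * (1 / (1 + norm x) ^ (DIM('a) + 1))" for x
      using C(2)[of x] zero_less_power[of "1 + norm x" "DIM('a)+1"] norm_ge_zero[of x]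
      by (simp only: power_add) (simp add: field_simps)
    moreover have "norm ((1 + norm x) ^ N * norm (g x)) = (1 + norm x) ^ N * norm (g x)" for x by simp
    moreover have "norm (C * (1 / (1 + norm x) ^ (DIM('a) + 1))) = C * (1 / (1 + norm x) ^ (DIM('a) + 1))" for x :: 'a
      using C(1) by simp
    ultimately show "AE x in lborel. norm ((1 + norm x) ^ N * norm (g x)) \<le> norm (C * (1 / (1 + norm x) ^ (DIM('a) + 1)))"
      by (intro AE_I2) presburger
  qed simp
qed

lemma rapid_integrable: "rapid g \<Longrightarrow> integrable lborel g"
  using rapid_weight_integrable[of g 0]
  by (simp add: integrable_norm_iff borel_measurable_rapid)

lemma schwartz_rapid:
  assumes "schwartz g" shows "rapid g"
proof -
  have "smooth g" using assms by (simp add: schwartz_def)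
  then have "\<forall>x. iter_deriv [] g differentiable (at x)"
    unfolding smooth_def by (metis empty_set empty_subsetI)
  then have "continuous_on UNIV g"
    by (auto intro!: continuous_at_imp_continuous_on differentiable_imp_continuous_within)
  moreover have "\<exists>C. \<forall>x. (1 + norm x) ^ N * norm (iter_deriv [] g x) \<le> C" for N
    using assms unfolding schwartz_def by (metis empty_set empty_subsetI)
  ultimately show ?thesis by (simp add: rapid_def)
qed

text \<open>Peetre's inequality for two scales. Since \<open>t \<le> 2 * t'\<close>, the quantity
  \<open>t' * norm (x - y)\<close> controls \<open>t * norm (x - y)\<close> up to the factor 2,
  whence \<open>2 ^ M\<close>.\<close>

lemma power_one_plus_dil_le:
  fixes x y p :: "'a::real_normed_vector"
  assumes "0 < t" "t \<le> 2 * t'"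
  shows "(1 + t * norm (x - p)) ^ M \<le> 2 ^ M * (1 + norm (t' *\<^sub>R (x - y))) ^ M * (1 + norm (t *\<^sub>R (y - p))) ^ M"
proof -
  have "norm (x - p) \<le> norm (x - y) + norm (y - p)"
    using norm_triangle_ineq[of "x - y" "y - p"] by simp
  then have "1 + t * norm (x - p) \<le> 1 + t * norm (x - y) + t * norm (y - p)"
    using assms by (metis add.assoc add_left_mono distrib_left mult_left_mono less_imp_le)
  also have "\<dots> \<le> (1 + t * norm (x - y)) * (1 + t * norm (y - p))"
    using assms by (simp add: algebra_simps)
  also have "\<dots> \<le> (2 * (1 + t' * norm (x - y))) * (1 + t * norm (y - p))"
    using assms mult_right_mono[OF assms(2), of "norm (x - y)"]
    by (intro mult_right_mono) (auto simp: algebra_simps)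
  finally have "(1 + t * norm (x - p)) ^ M \<le> ((2 * (1 + t' * norm (x - y))) * (1 + t * norm (y - p))) ^ M"
    using assms by (intro power_mono) auto
  moreover have "t' > 0" using assms by linarith
  ultimately show ?thesis using assms by (simp only: power_mult_distrib norm_scaleR abs_of_pos)
qed

text \<open>The convolution of two bumps decays at the coarser scale \<open>t\<close>: the decay of
  \<open>h\<close> is transported from \<open>y\<close> to \<open>x\<close>, and a moment of
  \<open>g\<close> absorbs the cost. The slack in \<open>t \<le> 2 * t'\<close> admits a band one
  step below the bump, and \<open>u\<close> will be the modulation of an atom; the constant depends
  on none of them.\<close>

lemma conv_dil_bound:
  fixes g h :: "'a::euclidean_space \<Rightarrow> complex"
  assumes g: "rapid g" and h: "rapid h"
  obtains C where "C > 0"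
    "\<And>t t' x p u. \<lbrakk>0 < t; t \<le> 2 * t'; \<And>y. norm (u y) \<le> 1\<rbrakk> \<Longrightarrow>
       norm (LINT y|lborel. u y * dil t h (y - p) * dil t' g (x - y))
         \<le> C * t ^ DIM('a) / (1 + t * norm (x - p)) ^ M"
proof -
  obtain Ch where Ch: "Ch > 0" "\<And>x. (1 + norm x) ^ M * norm (h x) \<le> Ch"
    using rapidE[OF h] by blast
  have [measurable]: "g \<in> borel_measurable borel" using g by (rule borel_measurable_rapid)
  define w where "w = (\<lambda>z::'a. (1 + norm z) ^ M * norm (g z))"
  have [measurable]: "w \<in> borel_measurable borel" by (simp add: w_def)
  have w: "integrable lborel w" unfolding w_def by (rule rapid_weight_integrable) fact
  have w0: "w z \<ge> 0" for z by (simp add: w_def)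
  define I where "I = (LINT z|lborel. w z)"
  have I0: "I \<ge> 0" unfolding I_def using w0 by (simp add: integral_nonneg_AE)
  have "norm (LINT y|lborel. u y * dil t h (y - p) * dil t' g (x - y))
         \<le> (Ch * 2 ^ M * (I + 1)) * t ^ DIM('a) / (1 + t * norm (x - p)) ^ M"
    if t: "0 < t" "t \<le> 2 * t'" and u: "\<And>y. norm (u y) \<le> 1" for t t' x p u
  proof -
    have t': "t' > 0" using t by linarith
    define K where "K = Ch * 2 ^ M * t ^ DIM('a) / (1 + t * norm (x - p)) ^ M"
    have K0: "K \<ge> 0" unfolding K_def using t Ch(1) by (intro divide_nonneg_nonneg mult_nonneg_nonneg zero_le_power) auto
    have le: "norm (u y * dil t h (y - p) * dil t' g (x - y)) \<le> K * t' ^ DIM('a) * w (t' *\<^sub>R (x - y))" for y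
    proof -
      let ?a = "(1 + t * norm (x - p)) ^ M" and ?b = "(1 + norm (t' *\<^sub>R (x - y))) ^ M"
        and ?c = "(1 + norm (t *\<^sub>R (y - p))) ^ M"
      have pos: "?a > 0" "?b > 0" "?c > 0"
        using t by (auto intro!: zero_less_power add_pos_nonneg mult_nonneg_nonneg)
      have "norm (h (t *\<^sub>R (y - p))) * ?a \<le> norm (h (t *\<^sub>R (y - p))) * (2 ^ M * ?b * ?c)"
        using power_one_plus_dil_le[OF t] by (intro mult_left_mono) auto
      also have "\<dots> = 2 ^ M * ?b * (?c * norm (h (t *\<^sub>R (y - p))))" by simp
      also have "\<dots> \<le> 2 ^ M * ?b * Ch"
        using pos by (intro mult_left_mono Ch) auto
      finally have h: "norm (h (t *\<^sub>R (y - p))) \<le> 2 ^ M * ?b * Ch / ?a"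
        using pos by (simp add: field_simps)
      have "norm (u y * dil t h (y - p) * dil t' g (x - y)) \<le>
          1 * (t ^ DIM('a) * norm (h (t *\<^sub>R (y - p)))) * (t' ^ DIM('a) * norm (g (t' *\<^sub>R (x - y))))"
        unfolding norm_mult dil_def using t t' u by (intro mult_mono) (auto intro!: u simp: norm_power)
      also have "\<dots> \<le> 1 * (t ^ DIM('a) * (2 ^ M * ?b * Ch / ?a)) * (t' ^ DIM('a) * norm (g (t' *\<^sub>R (x - y))))"
        using t t' by (intro mult_right_mono mult_left_mono h) auto
      also have "\<dots> = K * t' ^ DIM('a) * w (t' *\<^sub>R (x - y))"
        unfolding K_def w_def by simp
      finally show ?thesis .
    qed
    have int: "integrable lborel (\<lambda>y. w (t' *\<^sub>R (x - y)))"
      using integrable_lborel_affine[OF w, of "-t'" "t' *\<^sub>R x"] t' by (simp add: algebra_simps)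
    have "norm (LINT y|lborel. u y * dil t h (y - p) * dil t' g (x - y)) \<le>
        (LINT y|lborel. norm (u y * dil t h (y - p) * dil t' g (x - y)))"
      by (rule integral_norm_bound)
    also have "\<dots> \<le> (LINT y|lborel. K * t' ^ DIM('a) * w (t' *\<^sub>R (x - y)))"
      by (intro integral_mono' le integrable_mult_right int order_trans[OF norm_ge_zero le])
    also have "\<dots> = K * I"
      unfolding I_def using integral_lborel_affine[of w "-t'" "t' *\<^sub>R x"] t' by (simp add: algebra_simps)
    also have "\<dots> \<le> K * (I + 1)" using K0 by (intro mult_left_mono) auto
    also have "\<dots> = (Ch * 2 ^ M * (I + 1)) * t ^ DIM('a) / (1 + t * norm (x - p)) ^ M"
      by (simp add: K_def)
    finally show ?thesis .
  qed
  moreover have "Ch * 2 ^ M * (I + 1) > 0" using Ch I0 by simp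
  ultimately show ?thesis using that by blast
qed

text \<open>A point is either far from the origin, where \<open>g\<close> is small, or far from
  \<open>p\<close>, where the bump is small: \<open>1 + norm p\<close> is at most the product of the
  two weights, and \<open>t \<ge> 1\<close> allows the distance to \<open>p\<close> to be measured
  at scale \<open>t\<close>. This gain lets exponentially large coefficients define tempered
  distributions.\<close>

lemma weighted_pairing_bound:
  fixes w :: "'a::euclidean_space \<Rightarrow> real" and g h :: "'a \<Rightarrow> complex"
  assumes w: "integrable lborel (\<lambda>z. (1 + norm z) * w z)" "\<And>z. w z \<ge> 0" "w \<in> borel_measurable borel"
    and t: "1 \<le> t" and h: "\<And>x. norm (h x) \<le> t ^ DIM('a) * w (t *\<^sub>R (x - p))"
    and g: "\<And>x. (1 + norm x) * norm (g x) \<le> S"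
  shows "norm (LINT x|lborel. h x * g x) \<le> (LINT z|lborel. (1 + norm z) * w z) * S / (1 + norm p)"
proof -
  have [measurable]: "w \<in> borel_measurable borel" by fact
  have S: "S \<ge> 0" using g[of 0] norm_ge_zero[of "g 0"] by (simp del: norm_ge_zero)
  let ?v = "\<lambda>z::'a. (1 + norm z) * w z"
  have le: "norm (h x * g x) \<le> S / (1 + norm p) * (t ^ DIM('a) * ?v (t *\<^sub>R (x - p)))" for x
  proof -
    have "norm p \<le> norm x + norm (x - p)" using norm_triangle_sub[of p x] by (simp add: norm_minus_commute)
    then have "1 + norm p \<le> (1 + norm x) * (1 + norm (x - p))"
      using mult_nonneg_nonneg[OF norm_ge_zero[of x] norm_ge_zero[of "x - p"]]
      by (simp only: ring_distribs mult_1 mult_1_right)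
    also have "\<dots> \<le> (1 + norm x) * (1 + norm (t *\<^sub>R (x - p)))"
      using t mult_right_mono[of 1 t "norm (x - p)"] by (intro mult_left_mono) auto
    finally have "norm (g x) * (1 + norm p) \<le> norm (g x) * ((1 + norm x) * (1 + norm (t *\<^sub>R (x - p))))"
      by (intro mult_left_mono) auto
    also have "\<dots> = (1 + norm x) * norm (g x) * (1 + norm (t *\<^sub>R (x - p)))" by simp
    also have "\<dots> \<le> S * (1 + norm (t *\<^sub>R (x - p)))" by (intro mult_right_mono g) auto
    finally have "norm (g x) \<le> S * (1 + norm (t *\<^sub>R (x - p))) / (1 + norm p)"
      by (simp add: field_simps add_pos_nonneg)
    then have "norm (h x) * norm (g x) \<le> (t ^ DIM('a) * w (t *\<^sub>R (x - p))) * (S * (1 + norm (t *\<^sub>R (x - p))) / (1 + norm p))"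
      using t w by (intro mult_mono h) auto
    then show ?thesis by (simp add: norm_mult mult_ac)
  qed
  have int: "integrable lborel (\<lambda>x. ?v (t *\<^sub>R (x - p)))"
    using integrable_lborel_affine[OF w(1), of t "- t *\<^sub>R p"] t by (simp add: algebra_simps)
  have "norm (LINT x|lborel. h x * g x) \<le> (LINT x|lborel. norm (h x * g x))"
    by (rule integral_norm_bound)
  also have "\<dots> \<le> (LINT x|lborel. S / (1 + norm p) * (t ^ DIM('a) * ?v (t *\<^sub>R (x - p))))"
    by (intro integral_mono' le integrable_mult_right int order_trans[OF norm_ge_zero le])
  also have "\<dots> = S / (1 + norm p) * (t ^ DIM('a) * (LINT x|lborel. ?v (t *\<^sub>R (x - p))))"
    by simp
  also have "t ^ DIM('a) * (LINT x|lborel. ?v (t *\<^sub>R (x - p))) = (LINT z|lborel. ?v z)"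
    using integral_lborel_affine[of ?v "t" "- t *\<^sub>R p"] t by (simp add: algebra_simps)
  finally show ?thesis by (simp add: mult_ac)
qed

lemma inverse_power_powr_finite:
  assumes "real M * q \<ge> real (DIM('a) + 1)" "q > 0"
  shows "(\<integral>\<^sup>+x. ennreal ((1 / (1 + norm (x::'a::euclidean_space)) ^ M) powr q) \<partial>lborel) < \<infinity>"
proof -
  have "(1 / (1 + norm x) ^ M) powr q \<le> 1 / (1 + norm x) ^ (DIM('a) + 1)" for x :: 'a
  proof -
    have p: "1 + norm x > 0" by (simp add: add_pos_nonneg)
    have "(1 / (1 + norm x) ^ M) powr q = (1 + norm x) powr (- (real M * q))"
    proof -
      have "1 / (1 + norm x) ^ M = (1 + norm x) powr (- real M)"
        using p by (simp add: powr_minus powr_realpow divide_inverse)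
      then show ?thesis by (simp add: powr_powr)
    qed
    also have "\<dots> \<le> (1 + norm x) powr (- real (DIM('a) + 1))"
      using assms by (intro powr_mono) auto
    also have "\<dots> = 1 / (1 + norm x) ^ (DIM('a) + 1)"
      by (subst powr_minus, subst powr_realpow) (use p in \<open>auto simp: divide_inverse\<close>)
    finally show ?thesis .
  qed
  then have "(\<integral>\<^sup>+x. ennreal ((1 / (1 + norm (x::'a)) ^ M) powr q) \<partial>lborel) \<le>
      (\<integral>\<^sup>+x. ennreal (1 / (1 + norm (x::'a)) ^ (DIM('a) + 1)) \<partial>lborel)"
    by (intro nn_integral_mono ennreal_leI)
  also have "\<dots> < \<infinity>"
    using integrable_inverse_power[where 'a='a] by (simp add: integrable_iff_bounded)
  finally show ?thesis .
qed

text \<open>Scaling gives the exponent: height \<open>t ^ d\<close> on a set of measure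
  \<open>t powr (- d)\<close> contributes \<open>t powr (d * (q - 1))\<close>. Its
  \<open>q\<close>-th root is the weight in the summability condition for the input.\<close>

lemma nn_integral_dil_decay_powr:
  fixes p :: "'a::euclidean_space"
  assumes "t > 0" "C \<ge> 0"
  shows "(\<integral>\<^sup>+x. ennreal ((C * t ^ DIM('a) / (1 + t * norm (x - p)) ^ M) powr q) \<partial>lborel) =
     ennreal (C powr q * t powr (real DIM('a) * (q - 1))) *
       (\<integral>\<^sup>+x. ennreal ((1 / (1 + norm (x::'a)) ^ M) powr q) \<partial>lborel)" (is "_ = _ * ?I")
proof -
  let ?w = "\<lambda>x::'a. ennreal ((1 / (1 + norm x) ^ M) powr q)"
  have td: "(t ^ DIM('a)) powr q = t powr (real DIM('a) * q)"
    using assms by (simp add: powr_realpow[symmetric] powr_powr)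
  have "(C * t ^ DIM('a) / (1 + t * norm (x - p)) ^ M) powr q =
      (C powr q * t powr (real DIM('a) * q)) * ((1 / (1 + norm (t *\<^sub>R (x - p))) ^ M) powr q)" for x
    using assms by (simp add: powr_divide powr_mult td)
  then have "(\<integral>\<^sup>+x. ennreal ((C * t ^ DIM('a) / (1 + t * norm (x - p)) ^ M) powr q) \<partial>lborel) =
     ennreal (C powr q * t powr (real DIM('a) * q)) * (\<integral>\<^sup>+x. ?w (t *\<^sub>R (x - p)) \<partial>lborel)"
    by (simp add: ennreal_mult' nn_integral_cmult)
  also have "t powr (real DIM('a) * q) = t powr (real DIM('a) * (q - 1)) * t ^ DIM('a)"
    using assms by (simp add: powr_realpow[symmetric] flip: powr_add) (simp add: algebra_simps)
  also have "ennreal (C powr q * (t powr (real DIM('a) * (q - 1)) * t ^ DIM('a)))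
     = ennreal (C powr q * t powr (real DIM('a) * (q - 1))) * ennreal (t ^ DIM('a))"
    using assms by (simp add: ennreal_mult' mult.assoc)
  also have "\<dots> * (\<integral>\<^sup>+x. ?w (t *\<^sub>R (x - p)) \<partial>lborel) = ennreal (C powr q * t powr (real DIM('a) * (q - 1))) * ?I"
    using nn_integral_lborel_affine[of ?w t "- t *\<^sub>R p"] assms by (simp add: algebra_simps)
  finally show ?thesis .
qed

lemma fourier_dil:
  fixes g :: "'a::euclidean_space \<Rightarrow> complex"
  assumes "t > 0" "integrable lborel g"
  shows "fourier (dil t g) \<xi> = fourier g (\<xi> /\<^sub>R t)"
proof -
  have [measurable]: "g \<in> borel_measurable borel"
    by (rule integrable_lborel_measurable[OF assms(2)])
  have cancel: "inverse t * (t * z) = z" for z using assms(1) by simp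
  show ?thesis
    unfolding fourier_def dil_def
    using integral_lborel_affine[of "\<lambda>x. g x * cis (- 2 * pi * (x \<bullet> (\<xi> /\<^sub>R t)))" t 0] assms(1)
    by (simp add: scaleR_conv_of_real mult.assoc cancel)
qed

lemma integrable_dil:
  fixes g :: "'a::euclidean_space \<Rightarrow> complex"
  assumes "t > 0" "integrable lborel g"
  shows "integrable lborel (dil t g)"
  unfolding dil_def using integrable_lborel_affine[OF assms(2), of t 0] assms(1) by simp

text \<open>Inversion exhibits the reflected translate \<open>\<lambda>y. g (x - y)\<close> as a
  Fourier transform, to which the multiplication formula applies.\<close>

lemma conv_fourier_formula:
  fixes g h :: "'a::euclidean_space \<Rightarrow> complex"
  assumes h: "integrable lborel h" and g: "continuous_on UNIV g" "\<And>x. norm (g x) \<le> B"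
    "integrable lborel g" "integrable lborel (fourier g)"
  shows "(LINT y|lborel. h y * g (x - y)) =
     (LINT \<xi>|lborel. fourier h \<xi> * (fourier g \<xi> * cis (2 * pi * (x \<bullet> \<xi>))))"
proof -
  have "g (x - y) = fourier (\<lambda>\<xi>. fourier g \<xi> * cis (2 * pi * (x \<bullet> \<xi>))) y" for y
  proof -
    have "g (x - y) = (LINT \<xi>|lborel. fourier g \<xi> * cis (2 * pi * ((x - y) \<bullet> \<xi>)))"
      using fourier_inversion[OF g] by simp
    then show ?thesis unfolding fourier_def[of "\<lambda>\<xi>. fourier g \<xi> * cis (2 * pi * (x \<bullet> \<xi>))"]
      by (simp add: mult.assoc cis_mult inner_diff_left algebra_simps inner_commute)
  qed
  then show ?thesis
    using fourier_multiplication_formula[OF h fourier_integrand_integrable[OF g(4), of "2 * pi" x]]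
    by (simp add: inner_commute)
qed

section \<open>Smooth functions\<close>

lemma iter_deriv_cong_open:
  assumes "open U" "\<And>x. x \<in> U \<Longrightarrow> f x = g x" "x \<in> U"
  shows "iter_deriv vs f x = iter_deriv vs g x"
  using assms(3)
proof (induction vs arbitrary: x)
  case (Cons v vs)
  have "(iter_deriv vs f has_derivative D) (at x) \<longleftrightarrow> (iter_deriv vs g has_derivative D) (at x)" for D
    using has_derivative_transform_within_open[of "iter_deriv vs f" D x UNIV U "iter_deriv vs g"]
      has_derivative_transform_within_open[of "iter_deriv vs g" D x UNIV U "iter_deriv vs f"]
      Cons assms(1) by metis
  then show ?case by (simp add: frechet_derivative_def)
qed (simp add: assms(2))

text \<open>Lets a locally finite sum be treated through the single term that is active near each
  point.\<close>

lemma smooth_local: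
  assumes "\<And>x. \<exists>U g. open U \<and> x \<in> U \<and> smooth g \<and> (\<forall>y\<in>U. f y = g y)"
  shows "smooth f"
  unfolding smooth_def
proof (intro allI impI)
  fix vs :: "'a list" and x assume vs: "set vs \<subseteq> Basis"
  obtain U g where U: "open U" "x \<in> U" "smooth g" "\<And>y. y \<in> U \<Longrightarrow> f y = g y"
    using assms[of x] by blast
  then obtain D where "(iter_deriv vs g has_derivative D) (at x)"
    using vs unfolding smooth_def differentiable_def by blast
  then have "(iter_deriv vs f has_derivative D) (at x)"
    by (rule has_derivative_transform_within_open[OF _ U(1,2)])
       (rule iter_deriv_cong_open[OF U(1) U(4)[symmetric]])
  then show "iter_deriv vs f differentiable (at x)" unfolding differentiable_def by blast
qed

text \<open>Coinduction: a class of differentiable functions closed under partial derivatives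
  contains all iterated derivatives of its members, so none of them has to be computed.\<close>

lemma smooth_coinduct:
  assumes "f \<in> S"
    and "\<And>g. g \<in> S \<Longrightarrow> \<exists>g'. (\<forall>x. (g has_derivative g' x) (at x)) \<and> (\<forall>v\<in>Basis. (\<lambda>x. g' x v) \<in> S)"
  shows "smooth f"
proof -
  have *: "g differentiable (at x)" "v \<in> Basis \<Longrightarrow> (\<lambda>x. frechet_derivative g (at x) v) \<in> S"
    if g: "g \<in> S" for g x v
  proof -
    obtain g' where g': "\<And>x. (g has_derivative g' x) (at x)" "\<And>v. v \<in> Basis \<Longrightarrow> (\<lambda>x. g' x v) \<in> S"
      using assms(2)[OF g] by blast
    then have "frechet_derivative g (at x) = g' x" for x by (metis frechet_derivative_at)
    then show "g differentiable (at x)" "v \<in> Basis \<Longrightarrow> (\<lambda>x. frechet_derivative g (at x) v) \<in> S"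
      using g' by (auto simp: differentiable_def)
  qed
  have "set vs \<subseteq> Basis \<Longrightarrow> iter_deriv vs f \<in> S" for vs
    by (induction vs) (auto simp: assms(1) *(2))
  then show ?thesis unfolding smooth_def using *(1) by blast
qed

text \<open>For \<open>p = 1\<close> this is the standard smooth function vanishing to infinite
  order at 0. Polynomials in \<open>1 / t\<close> are carried along because differentiation produces
  them.\<close>

definition flat :: "real poly \<Rightarrow> real \<Rightarrow> real" where
  "flat p t = (if t \<le> 0 then 0 else poly p (1 / t) * exp (- 1 / t))"

lemma poly_exp_tendsto_0: "((\<lambda>s::real. poly p s * exp (- s)) \<longlongrightarrow> 0) at_top"
proof -
  have "((\<lambda>s. \<Sum>i\<le>degree p. coeff p i * (s ^ i / exp s)) \<longlongrightarrow> (\<Sum>i\<le>degree p. coeff p i * 0)) at_top"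
    by (intro tendsto_intros tendsto_power_div_exp_0)
  then show ?thesis
    by (simp add: poly_altdef exp_minus divide_inverse sum_distrib_right mult.assoc)
qed

text \<open>With \<open>u = 1 / t\<close> the derivative of \<open>p(u) exp (- u)\<close> in
  \<open>t\<close> is \<open>u^2 (p - p')(u) exp (- u)\<close>; the two \<open>pCons 0\<close> are
  the factor \<open>u^2\<close>.\<close>

lemma flat_has_derivative:
  "(flat p has_real_derivative flat (pCons 0 (pCons 0 (p - pderiv p))) t) (at t)"
proof -
  consider "t < 0" | "t > 0" | "t = 0" by linarith
  then show ?thesis
  proof cases
    case 1
    have "((\<lambda>_. 0) has_real_derivative flat (pCons 0 (pCons 0 (p - pderiv p))) t) (at t)"
      using 1 by (simp add: flat_def)
    then show ?thesis
      by (rule DERIV_cong_ev[THEN iffD1, rotated -1])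
         (use 1 in \<open>auto simp: flat_def eventually_nhds intro!: exI[of _ "{..<0}"]\<close>)
  next
    case 2
    have "((\<lambda>t. poly p (1 / t) * exp (- 1 / t)) has_real_derivative flat (pCons 0 (pCons 0 (p - pderiv p))) t) (at t)"
      using 2 unfolding flat_def
      by (auto intro!: derivative_eq_intros DERIV_chain2[OF poly_DERIV] simp: field_simps power2_eq_square)
    then show ?thesis
      by (rule DERIV_cong_ev[THEN iffD1, rotated -1])
         (use 2 in \<open>auto simp: flat_def eventually_nhds intro!: exI[of _ "{0<..}"]\<close>)
  next
    case 3
    have "((\<lambda>h. flat p h / h) \<longlongrightarrow> 0) (at_left 0)"
      by (rule tendsto_eventually) (auto simp: flat_def eventually_at_filter)
    moreover have "((\<lambda>h. flat p h / h) \<longlongrightarrow> 0) (at_right 0)"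
    proof -
      \<comment> \<open>The division by \<open>h\<close> in the difference quotient is one more
        factor \<open>1 / h\<close>, hence \<open>pCons 0 p\<close>.\<close>
      have "((\<lambda>h. poly (pCons 0 p) (inverse h) * exp (- inverse h)) \<longlongrightarrow> 0) (at_right (0::real))"
        by (rule filterlim_compose[OF poly_exp_tendsto_0 filterlim_inverse_at_top_right])
      then show ?thesis
        by (rule Lim_transform_eventually)
           (auto simp: flat_def eventually_at_filter divide_inverse)
    qed
    ultimately have "((\<lambda>h. flat p h / h) \<longlongrightarrow> 0) (at 0)" by (simp add: filterlim_split_at)
    then show ?thesis using 3 by (simp add: has_field_derivative_iff flat_def)
  qed
qed

text \<open>A syntactic class closed under directional derivatives and large enough for the cutoff
  and for the real and imaginary parts of the exponential; smoothness then follows from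
  \<open>smooth_coinduct\<close>.\<close>

inductive_set elementary :: "('a::euclidean_space \<Rightarrow> real) set" where
  const: "(\<lambda>x. c) \<in> elementary"
| lin: "(\<lambda>x. x \<bullet> w) \<in> elementary"
| add: "f \<in> elementary \<Longrightarrow> g \<in> elementary \<Longrightarrow> (\<lambda>x. f x + g x) \<in> elementary"
| mult: "f \<in> elementary \<Longrightarrow> g \<in> elementary \<Longrightarrow> (\<lambda>x. f x * g x) \<in> elementary"
| sin: "f \<in> elementary \<Longrightarrow> (\<lambda>x. sin (f x)) \<in> elementary"
| cos: "f \<in> elementary \<Longrightarrow> (\<lambda>x. cos (f x)) \<in> elementary"
| inverse: "f \<in> elementary \<Longrightarrow> (\<And>x. f x \<noteq> 0) \<Longrightarrow> (\<lambda>x. inverse (f x)) \<in> elementary"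
| flat: "f \<in> elementary \<Longrightarrow> (\<lambda>x. flat p (f x)) \<in> elementary"

lemma elementary_sum: "finite A \<Longrightarrow> (\<And>i. i \<in> A \<Longrightarrow> f i \<in> elementary) \<Longrightarrow> (\<lambda>x. \<Sum>i\<in>A. f i x) \<in> elementary"
  by (induction A rule: finite_induct) (auto intro: elementary.intros)

lemma elementary_has_derivative:
  assumes "f \<in> elementary"
  shows "\<exists>f'. (\<forall>x. (f has_derivative f' x) (at x)) \<and> (\<forall>v. (\<lambda>x. f' x v) \<in> elementary)"
  using assms
proof induction
  case (const c)
  show ?case by (intro exI[of _ "\<lambda>x v. 0"]) (auto intro: elementary.const)
next
  case (lin w)
  show ?case by (intro exI[of _ "\<lambda>x v. v \<bullet> w"]) (auto intro: elementary.const intro!: derivative_eq_intros)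
next
  case (add f g)
  then obtain f' g' where
    "\<And>x. (f has_derivative f' x) (at x)" "\<And>x. (g has_derivative g' x) (at x)"
    "\<And>v. (\<lambda>x. f' x v) \<in> elementary" "\<And>v. (\<lambda>x. g' x v) \<in> elementary" by blast
  with add show ?case
    by (intro exI[of _ "\<lambda>x v. f' x v + g' x v"]) (auto intro: elementary.intros intro!: derivative_eq_intros)
next
  case (mult f g)
  then obtain f' g' where
    "\<And>x. (f has_derivative f' x) (at x)" "\<And>x. (g has_derivative g' x) (at x)"
    "\<And>v. (\<lambda>x. f' x v) \<in> elementary" "\<And>v. (\<lambda>x. g' x v) \<in> elementary" by blast
  with mult show ?case
    by (intro exI[of _ "\<lambda>x v. f x * g' x v + f' x v * g x"])
       (auto intro!: elementary.intros has_derivative_mult)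
next
  case (sin f)
  then obtain f' where "\<And>x. (f has_derivative f' x) (at x)" "\<And>v. (\<lambda>x. f' x v) \<in> elementary" by blast
  with sin show ?case
    by (intro exI[of _ "\<lambda>x v. f' x v * cos (f x)"]) (auto intro!: elementary.intros derivative_eq_intros)
next
  case (cos f)
  then obtain f' where "\<And>x. (f has_derivative f' x) (at x)" "\<And>v. (\<lambda>x. f' x v) \<in> elementary" by blast
  \<comment> \<open>The class has no rule for negation, so the sign is written as the constant
    factor \<open>- 1\<close>.\<close>
  moreover from this have "((\<lambda>x. cos (f x)) has_derivative (\<lambda>v. f' x v * (- 1 * sin (f x)))) (at x)" for x
    by (auto intro!: derivative_eq_intros)
  moreover have "(\<lambda>x. f' x v * (- 1 * sin (f x))) \<in> elementary" for v
    by (intro elementary.intros calculation(2) cos)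
  ultimately show ?case
    by (intro exI[of _ "\<lambda>x v. f' x v * (- 1 * sin (f x))"]) blast
next
  case (inverse f)
  then obtain f' where f': "\<And>x. (f has_derivative f' x) (at x)" "\<And>v. (\<lambda>x. f' x v) \<in> elementary" by blast
  have "((\<lambda>x. inverse (f x)) has_derivative (\<lambda>v. - 1 * (inverse (f x) * (f' x v * inverse (f x))))) (at x)" for x
    using Deriv.has_derivative_inverse[OF inverse(2) f'(1)] by (simp add: mult.assoc)
  moreover have "(\<lambda>x. - 1 * (inverse (f x) * (f' x v * inverse (f x)))) \<in> elementary" for v
    by (intro elementary.intros f' inverse)
  ultimately show ?case
    by (intro exI[of _ "\<lambda>x v. - 1 * (inverse (f x) * (f' x v * inverse (f x)))"]) blast
next
  case (flat f p)
  then obtain f' where f': "\<And>x. (f has_derivative f' x) (at x)" "\<And>v. (\<lambda>x. f' x v) \<in> elementary" by blast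
  let ?p = "pCons 0 (pCons 0 (p - pderiv p))"
  have "((\<lambda>x. flat p (f x)) has_derivative (\<lambda>v. flat ?p (f x) * f' x v)) (at x)" for x
    using has_derivative_compose[OF f'(1) flat_has_derivative[unfolded has_field_derivative_def]] by simp
  moreover have "(\<lambda>x. flat ?p (f x) * f' x v) \<in> elementary" for v
    by (intro elementary.intros f' flat)
  ultimately show ?case
    by (intro exI[of _ "\<lambda>x v. flat ?p (f x) * f' x v"]) blast
qed

lemma smooth_elementary_complex:
  assumes "f \<in> elementary" "g \<in> elementary"
  shows "smooth (\<lambda>x. Complex (f x) (g x))"
proof (rule smooth_coinduct[where S = "{\<lambda>x. Complex (f x) (g x) | f g. f \<in> elementary \<and> g \<in> elementary}"])
  fix h :: "'a \<Rightarrow> complex" assume "h \<in> {\<lambda>x. Complex (f x) (g x) | f g. f \<in> elementary \<and> g \<in> elementary}"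
  then obtain f g where h: "h = (\<lambda>x. Complex (f x) (g x))" "f \<in> elementary" "g \<in> elementary" by blast
  obtain f' where f': "\<And>x. (f has_derivative f' x) (at x)" "\<And>v. (\<lambda>x. f' x v) \<in> elementary"
    using elementary_has_derivative[OF h(2)] by blast
  obtain g' where g': "\<And>x. (g has_derivative g' x) (at x)" "\<And>v. (\<lambda>x. g' x v) \<in> elementary"
    using elementary_has_derivative[OF h(3)] by blast
  have "((\<lambda>x. complex_of_real (f x) + \<i> * complex_of_real (g x)) has_derivative
      (\<lambda>v. complex_of_real (f' x v) + \<i> * complex_of_real (g' x v))) (at x)" for x
    by (intro has_derivative_add has_derivative_of_real has_derivative_mult_right f' g')
  then have "(h has_derivative (\<lambda>v. Complex (f' x v) (g' x v))) (at x)" for x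
    by (simp add: h Complex_eq)
  moreover have "(\<lambda>x. Complex (f' x v) (g' x v)) \<in> {\<lambda>x. Complex (f x) (g x) | f g. f \<in> elementary \<and> g \<in> elementary}" for v
    using f'(2)[of v] g'(2)[of v] by (intro CollectI exI[of _ "\<lambda>x. f' x v"] exI[of _ "\<lambda>x. g' x v"]) simp
  ultimately show "\<exists>h'. (\<forall>x. (h has_derivative h' x) (at x)) \<and>
     (\<forall>v\<in>Basis. (\<lambda>x. h' x v) \<in> {\<lambda>x. Complex (f x) (g x) | f g. f \<in> elementary \<and> g \<in> elementary})"
    by (intro exI[of _ "\<lambda>x v. Complex (f' x v) (g' x v)"]) blast
qed (use assms in blast)

text \<open>Chain rule for an inner map that is diagonal in the directions used: a derivative along
  \<open>v\<close> contributes only the eigenvalue \<open>r v\<close>. It covers the dilations of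
  symbols as well as translations, where all eigenvalues are 1.\<close>

lemma iter_deriv_affine:
  assumes g: "smooth g" and L: "bounded_linear L"
    and vs: "set vs \<subseteq> Basis" "\<And>v. v \<in> set vs \<Longrightarrow> L v = r v *\<^sub>R v"
  shows "iter_deriv vs (\<lambda>z. c * g (L z + h)) =
    (\<lambda>z. c * complex_of_real (prod_list (map r vs)) * iter_deriv vs g (L z + h))"
  using vs
proof (induction vs)
  case (Cons v vs)
  let ?c = "c * complex_of_real (prod_list (map r vs))"
  let ?D = "\<lambda>z. frechet_derivative (iter_deriv vs g) (at (L z + h))"
  have IH: "iter_deriv vs (\<lambda>z. c * g (L z + h)) = (\<lambda>z. ?c * iter_deriv vs g (L z + h))"
    using Cons by simp
  have "iter_deriv vs g differentiable (at z)" for z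
    using g Cons.prems unfolding smooth_def by simp
  then have D: "(iter_deriv vs g has_derivative ?D z) (at (L z + h))" for z
    by (simp add: frechet_derivative_works)
  have "((\<lambda>z. L z + h) has_derivative L) (at z)" for z
    using bounded_linear_imp_has_derivative[OF L] has_derivative_add_const by blast
  from has_derivative_mult_right[OF has_derivative_compose[OF this D]]
  have "((\<lambda>z. ?c * iter_deriv vs g (L z + h)) has_derivative (\<lambda>w. ?c * ?D z (L w))) (at z)" for z .
  then have "frechet_derivative (\<lambda>z. ?c * iter_deriv vs g (L z + h)) (at z) = (\<lambda>w. ?c * ?D z (L w))" for z
    by (metis frechet_derivative_at)
  moreover have "?D z (L v) = complex_of_real (r v) * ?D z v" for z
    using Cons.prems has_derivative_linear[OF D, of z]
    by (simp add: linear_cmul scaleR_conv_of_real)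
  ultimately show ?case by (simp add: IH mult_ac)
qed simp

lemma flat_1_simps: "t \<le> 0 \<Longrightarrow> flat 1 t = 0" "t > 0 \<Longrightarrow> flat 1 t > 0" "flat 1 t \<ge> 0"
  by (auto simp: flat_def)

section \<open>The symbol\<close>

text \<open>The usual quotient cutoff, taken in the squared distance so that it is smooth at the
  centre too. The numbers \<open>1/16\<close> and \<open>1/256\<close> are the squares of the outer
  radius \<open>1/4\<close> and of the plateau radius \<open>1/16\<close>.\<close>

definition bump :: "'a::euclidean_space \<Rightarrow> 'a \<Rightarrow> real" where
  "bump e \<xi> = flat 1 (1/16 - (norm (\<xi> - e))\<^sup>2) /
     (flat 1 (1/16 - (norm (\<xi> - e))\<^sup>2) + flat 1 ((norm (\<xi> - e))\<^sup>2 - 1/256))"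

lemma bump_denominator: "flat 1 (1/16 - (norm (\<xi> - e))\<^sup>2) + flat 1 ((norm (\<xi> - e))\<^sup>2 - 1/256) \<noteq> 0"
proof -
  have "1/16 - (norm (\<xi> - e))\<^sup>2 > 0 \<or> (norm (\<xi> - e))\<^sup>2 - 1/256 > 0" by linarith
  then show ?thesis using flat_1_simps(2,3) by (metis add_pos_nonneg add_nonneg_pos less_irrefl)
qed

lemma bump_eq_1:
  assumes "norm (\<xi> - e) \<le> 1/16" shows "bump e \<xi> = 1"
proof -
  have "(norm (\<xi> - e))\<^sup>2 \<le> (1/16)\<^sup>2" using assms by (intro power_mono) auto
  then have "flat 1 ((norm (\<xi> - e))\<^sup>2 - 1/256) = 0" by (intro flat_1_simps) (simp add: power2_eq_square)
  then show ?thesis using bump_denominator[of \<xi> e] by (simp add: bump_def)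
qed

lemma bump_eq_0:
  assumes "norm (\<xi> - e) \<ge> 1/4" shows "bump e \<xi> = 0"
proof -
  have "(norm (\<xi> - e))\<^sup>2 \<ge> (1/4)\<^sup>2" using assms by (intro power_mono) auto
  then have "flat 1 (1/16 - (norm (\<xi> - e))\<^sup>2) = 0" by (intro flat_1_simps) (simp add: power2_eq_square)
  then show ?thesis by (simp add: bump_def)
qed

lemma bump_bounds: "0 \<le> bump e \<xi>" "bump e \<xi> \<le> 1"
  using flat_1_simps(3)[of "1/16 - (norm (\<xi> - e))\<^sup>2"] flat_1_simps(3)[of "(norm (\<xi> - e))\<^sup>2 - 1/256"]
    bump_denominator[of \<xi> e]
  unfolding bump_def by (auto simp: divide_simps)

lemma elementary_bump: "(\<lambda>z::'a::euclidean_space \<times> 'b::euclidean_space. bump e (snd z)) \<in> elementary"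
proof -
  have eq: "(norm (snd z - e))\<^sup>2 = (\<Sum>b\<in>Basis. (z \<bullet> (0, b) + - (e \<bullet> b)) * (z \<bullet> (0, b) + - (e \<bullet> b)))"
    for z :: "'a \<times> 'b"
    unfolding norm_sq_Basis by (cases z) (simp add: power2_eq_square inner_diff_left)
  have t: "(\<lambda>z::'a \<times> 'b. (norm (snd z - e))\<^sup>2) \<in> elementary"
    unfolding eq
    by (intro elementary_sum finite_Basis elementary.mult elementary.add elementary.const elementary.lin)
  define u where "u = (\<lambda>z::'a \<times> 'b. flat 1 (1/16 + - 1 * (norm (snd z - e))\<^sup>2))"
  define v where "v = (\<lambda>z::'a \<times> 'b. flat 1 ((norm (snd z - e))\<^sup>2 + - (1/256)))"
  have u: "u \<in> elementary"
    unfolding u_def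
    by (rule elementary.flat[OF elementary.add[OF elementary.const elementary.mult[OF elementary.const t]]])
  have v: "v \<in> elementary"
    unfolding v_def by (rule elementary.flat[OF elementary.add[OF t elementary.const]])
  have "u z + v z \<noteq> 0" for z
    using bump_denominator[of "snd z" e] by (simp add: u_def v_def)
  with elementary.add[OF u v] have "(\<lambda>z. inverse (u z + v z)) \<in> elementary"
    by (intro elementary.inverse[of "\<lambda>z. u z + v z"])
  with u have "(\<lambda>z. u z * inverse (u z + v z)) \<in> elementary"
    by (rule elementary.mult)
  moreover have "bump e (snd z) = u z * inverse (u z + v z)" for z
    unfolding divide_inverse[symmetric] by (simp add: bump_def u_def v_def)
  ultimately show ?thesis by (simp only:)
qed

text \<open>Up to the factor \<open>2 powr (m * n)\<close>, every term of the symbol arises from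
  this one function by dilating \<open>x\<close> by \<open>2 ^ n\<close> and \<xi> by the inverse;
  the symbol estimates thus reduce to boundedness of its derivatives.\<close>

definition base_symbol :: "'a::euclidean_space \<Rightarrow> 'a \<times> 'a \<Rightarrow> complex" where
  "base_symbol e z = complex_of_real (bump e (snd z)) * cis (- (2 * pi) * (fst z \<bullet> e))"

lemma smooth_base_symbol: "smooth (base_symbol e)"
proof -
  have 1: "(\<lambda>z::'a \<times> 'a. - (2 * pi) * (z \<bullet> (e, 0))) \<in> elementary"
    by (rule elementary.mult[OF elementary.const elementary.lin])
  have eq: "base_symbol e z = Complex (bump e (snd z) * cos (- (2 * pi) * (z \<bullet> (e, 0))))
     (bump e (snd z) * sin (- (2 * pi) * (z \<bullet> (e, 0))))" for z
    by (cases z) (simp add: base_symbol_def complex_eq_iff)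
  have "base_symbol e = (\<lambda>z. Complex (bump e (snd z) * cos (- (2 * pi) * (z \<bullet> (e, 0))))
     (bump e (snd z) * sin (- (2 * pi) * (z \<bullet> (e, 0)))))" by (intro ext eq)
  moreover have "smooth (\<lambda>z::'a \<times> 'a. Complex (bump e (snd z) * cos (- (2 * pi) * (z \<bullet> (e, 0))))
     (bump e (snd z) * sin (- (2 * pi) * (z \<bullet> (e, 0)))))"
    by (rule smooth_elementary_complex[OF elementary.mult[OF elementary_bump elementary.cos[OF 1]]
          elementary.mult[OF elementary_bump elementary.sin[OF 1]]])
  ultimately show ?thesis by simp
qed

definition symbol_term :: "'a::euclidean_space \<Rightarrow> real \<Rightarrow> nat \<Rightarrow> 'a \<times> 'a \<Rightarrow> complex" where
  "symbol_term e m n z = complex_of_real (2 powr (m * real n)) * base_symbol e (2 ^ n *\<^sub>R fst z, snd z /\<^sub>R 2 ^ n)"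

definition ching_symbol :: "'a::euclidean_space \<Rightarrow> real \<Rightarrow> 'a \<times> 'a \<Rightarrow> complex" where
  "ching_symbol e m z = (\<Sum>n. symbol_term e m (Suc n) z)"

lemma bump_scaled_nonzero:
  assumes "norm e = 1" "bump e (\<xi> /\<^sub>R 2 ^ n) \<noteq> 0"
  shows "3/4 * 2 ^ n < norm \<xi>" "norm \<xi> < 5/4 * 2 ^ n"
proof -
  have *: "norm (\<xi> /\<^sub>R 2 ^ n - e) < 1/4" using bump_eq_0[of "\<xi> /\<^sub>R 2 ^ n" e] assms(2) by force
  have "norm (\<xi> /\<^sub>R 2 ^ n) < 5/4" using norm_triangle_sub[of "\<xi> /\<^sub>R 2 ^ n" e] * assms(1) by linarith
  moreover have "norm (\<xi> /\<^sub>R 2 ^ n) > 3/4"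
    using norm_triangle_sub[of e "\<xi> /\<^sub>R 2 ^ n"] * assms(1) by (simp add: norm_minus_commute)
  ultimately show "3/4 * 2 ^ n < norm \<xi>" "norm \<xi> < 5/4 * 2 ^ n" by (auto simp: field_simps)
qed

text \<open>The annuli \<open>5/8 * 2 ^ j < r < 11/8 * 2 ^ j\<close> overlap, yet each of them meets the support of
  only one of the terms.\<close>

lemma ching_symbol_local:
  assumes e: "norm e = 1"
  obtains j U where "1 \<le> j" "open U" "z \<in> U" "\<And>w. w \<in> U \<Longrightarrow> ching_symbol e m w = symbol_term e m j w"
    "\<And>x. (x, snd z) \<in> U" "\<And>i. 1 \<le> i \<Longrightarrow> i \<noteq> j \<Longrightarrow> bump e (snd z /\<^sub>R 2 ^ i) = 0"
proof -
  define r where "r = norm (snd z)"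
  obtain n where "r < 2 ^ n" using real_arch_pow[of 2 r] by auto
  moreover have "(2::real) ^ n > 0" by simp
  ultimately have "r < 11/8 * 2 ^ n" by linarith
  then have "\<exists>n. r < 11/8 * 2 ^ n" by blast
  define k where "k = (LEAST n. r < 11/8 * 2 ^ n)"
  have k: "r < 11/8 * 2 ^ k" unfolding k_def by (rule LeastI_ex) fact
  \<comment> \<open>The series starts at index 1, so all low frequencies are assigned to
    \<open>j = 1\<close>, where \<open>U\<close> has no inner radius.\<close>
  define j where "j = max 1 k"
  define U where "U = {w :: 'a \<times> 'a. (j = 1 \<or> 5/8 * 2 ^ j < norm (snd w)) \<and> norm (snd w) < 11/8 * 2 ^ j}"
  have "r < 11/8 * 2 ^ j"
    using k power_increasing[of k j "2::real"] unfolding j_def by linarith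
  moreover have "5/8 * 2 ^ j < r" if j1: "j \<noteq> 1"
  proof -
    obtain i where i: "k = Suc i" "j = Suc i" using j1 unfolding j_def by (cases k) (auto simp: max_def split: if_splits)
    \<comment> \<open>Minimality of \<open>k\<close> gives
      \<open>r \<ge> 11/8 * 2 ^ i = 11/16 * 2 ^ j\<close>, which exceeds the inner radius
      \<open>5/8 * 2 ^ j\<close>.\<close>
    then have "\<not> r < 11/8 * 2 ^ i" unfolding k_def using not_less_Least[of i "\<lambda>n. r < 11/8 * 2 ^ n"] by auto
    then show ?thesis using i by simp (smt (verit) zero_less_power)
  qed
  ultimately have zU: "z \<in> U" by (auto simp: U_def r_def)
  have other: "bump e (snd w /\<^sub>R 2 ^ i) = 0" if w: "w \<in> U" and i: "1 \<le> i" "i \<noteq> j" for w i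
  proof (rule ccontr)
    assume "bump e (snd w /\<^sub>R 2 ^ i) \<noteq> 0"
    note b = bump_scaled_nonzero[OF e this]
    show False
    proof (cases "i < j")
      case True
      then have "2 * 2 ^ i \<le> (2 ^ j :: real)" using power_increasing[of "Suc i" j "2::real"] by simp
      moreover have "5/8 * 2 ^ j < norm (snd w)" using w True i by (auto simp: U_def)
      ultimately show False using b by linarith
    next
      case False
      then have "2 * 2 ^ j \<le> (2 ^ i :: real)" using i power_increasing[of "Suc j" i "2::real"] by simp
      moreover have "norm (snd w) < 11/8 * 2 ^ j" using w by (auto simp: U_def)
      moreover have "(2::real) ^ j > 0" by simp
      ultimately show False using b by linarith
    qed
  qed
  have "ching_symbol e m w = symbol_term e m j w" if w: "w \<in> U" for w
  proof -
    have "symbol_term e m (Suc n) w = 0" if "n \<noteq> j - 1" for n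
      using other[OF w, of "Suc n"] that by (auto simp: symbol_term_def base_symbol_def simp del: power_Suc)
    then have "ching_symbol e m w = (\<Sum>n\<in>{j - 1}. symbol_term e m (Suc n) w)"
      unfolding ching_symbol_def
      by (intro suminf_finite) auto
    then show ?thesis by (simp add: j_def)
  qed
  moreover have "open U"
    unfolding U_def by (cases "j = 1") (auto intro!: open_Collect_conj open_Collect_less continuous_intros)
  ultimately show ?thesis
    using that[of j U] zU other[OF zU] by (auto simp: j_def U_def)
qed

lemma bounded_linear_dilation: "bounded_linear (\<lambda>z::'a::euclidean_space \<times> 'b::euclidean_space. (s *\<^sub>R fst z, t *\<^sub>R snd z))"
  by (intro bounded_linear_intros bounded_linear_Pair)

lemma smooth_affine:
  fixes g :: "'a::euclidean_space \<Rightarrow> complex"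
  assumes g: "smooth g" and L: "bounded_linear L" and r: "\<And>v. v \<in> Basis \<Longrightarrow> L v = r v *\<^sub>R v"
  shows "smooth (\<lambda>z. c * g (L z + h))"
  unfolding smooth_def
proof (intro allI impI)
  fix vs :: "'a list" and z assume vs: "set vs \<subseteq> Basis"
  obtain D where D: "(iter_deriv vs g has_derivative D) (at (L z + h))"
    using g vs unfolding smooth_def differentiable_def by blast
  have "((\<lambda>z. L z + h) has_derivative L) (at z)"
    using bounded_linear_imp_has_derivative[OF L] has_derivative_add_const by blast
  note has_derivative_mult_right[OF has_derivative_compose[OF this D]]
  moreover have "iter_deriv vs (\<lambda>z. c * g (L z + h)) =
      (\<lambda>z. c * complex_of_real (prod_list (map r vs)) * iter_deriv vs g (L z + h))"
    using vs r by (intro iter_deriv_affine g L) auto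
  ultimately show "iter_deriv vs (\<lambda>z. c * g (L z + h)) differentiable (at z)"
    unfolding differentiable_def by metis
qed

lemma dilation_Basis:
  "v \<in> Basis \<Longrightarrow> (s *\<^sub>R fst v, t *\<^sub>R snd v) = (if fst v = 0 then t else s) *\<^sub>R v"
  by (cases v) (auto simp: Basis_prod_def)

lemma smooth_symbol_term: "smooth (symbol_term e m n)"
proof -
  have "smooth (\<lambda>z. complex_of_real (2 powr (m * real n)) *
      base_symbol e ((2 ^ n *\<^sub>R fst z, (1 / 2 ^ n) *\<^sub>R snd z) + 0))"
    by (rule smooth_affine[OF smooth_base_symbol bounded_linear_dilation dilation_Basis])
  then show ?thesis by (simp add: symbol_term_def[abs_def] divide_inverse)
qed

lemma smooth_ching_symbol:
  assumes "norm e = 1" shows "smooth (ching_symbol e m)"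
proof (rule smooth_local)
  fix z
  obtain j U where "1 \<le> j" "open U" "z \<in> U" "\<And>w. w \<in> U \<Longrightarrow> ching_symbol e m w = symbol_term e m j w"
    using ching_symbol_local[OF assms, of z m] by metis
  then show "\<exists>U g. open U \<and> z \<in> U \<and> smooth g \<and> (\<forall>y\<in>U. ching_symbol e m y = g y)"
    using smooth_symbol_term[of e m j] by (intro exI[of _ U] exI[of _ "symbol_term e m j"]) simp
qed

lemma prod_list_map_const: "(\<And>v. v \<in> set vs \<Longrightarrow> r v = c) \<Longrightarrow> prod_list (map r vs) = (c::real) ^ length vs"
  by (induction vs) auto

text \<open>Translation in \<open>x\<close> multiplies the base symbol by a unimodular constant,
  hence also its derivatives; this makes bounds uniform in the unbounded variable.\<close>

lemma iter_deriv_base_symbol_translate: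
  assumes "set vs \<subseteq> Basis"
  shows "iter_deriv vs (base_symbol e) (x, \<xi>) = cis (- (2 * pi) * (x \<bullet> e)) * iter_deriv vs (base_symbol e) (0, \<xi>)"
proof -
  have eq: "(\<lambda>z. 1 * base_symbol e (z + (x, 0))) = (\<lambda>z. cis (- (2 * pi) * (x \<bullet> e)) * base_symbol e (z + 0))"
    by (auto simp: base_symbol_def cis_mult algebra_simps inner_add_left intro!: ext)
  have *: "iter_deriv vs (\<lambda>z. c * base_symbol e (z + h)) =
    (\<lambda>z. c * complex_of_real (prod_list (map (\<lambda>_. 1) vs)) * iter_deriv vs (base_symbol e) (z + h))" for c h
    using assms by (intro iter_deriv_affine smooth_base_symbol bounded_linear_ident) auto
  have "prod_list (map (\<lambda>_. 1::real) vs) = 1" by (simp add: prod_list_map_const[where c = 1])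
  then have "iter_deriv vs (base_symbol e) (z + (x, 0)) =
      cis (- (2 * pi) * (x \<bullet> e)) * iter_deriv vs (base_symbol e) (z + 0)" for z
    using fun_cong[OF arg_cong[OF eq, of "iter_deriv vs"], of z] unfolding * by simp
  from this[of "(0, \<xi>)"] show ?thesis by simp
qed

lemma iter_deriv_base_symbol_eq_0:
  assumes "norm (snd z - e) > 1/4"
  shows "iter_deriv vs (base_symbol e) z = 0"
proof -
  have zero: "iter_deriv vs (\<lambda>_. 0 :: complex) = (\<lambda>_. 0)" for vs :: "('a \<times> 'a) list"
    by (induction vs) auto
  have "iter_deriv vs (base_symbol e) z = iter_deriv vs (\<lambda>_. 0) z"
  proof (rule iter_deriv_cong_open)
    show "open {z :: 'a \<times> 'a. norm (snd z - e) > 1/4}"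
      by (intro open_Collect_less continuous_intros)
  qed (use assms in \<open>auto simp: base_symbol_def bump_eq_0\<close>)
  then show ?thesis by (simp add: zero)
qed

text \<open>By translation only \<open>x = 0\<close> matters, and off the support the derivatives
  vanish, so continuity on the compact ball of radius \<open>1/4\<close> is enough.\<close>

lemma iter_deriv_base_symbol_bounded:
  assumes "set vs \<subseteq> Basis"
  obtains B where "B > 0" "\<And>z. norm (iter_deriv vs (base_symbol e) z) \<le> B"
proof -
  have "continuous_on (cball e (1/4)) (\<lambda>\<xi>. iter_deriv vs (base_symbol e) (0, \<xi>))"
  proof (rule continuous_on_compose2[where g = "iter_deriv vs (base_symbol e)" and t = UNIV])
    show "continuous_on UNIV (iter_deriv vs (base_symbol e))"
      using smooth_base_symbol assms unfolding smooth_def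
      by (auto intro!: continuous_at_imp_continuous_on differentiable_imp_continuous_within)
  qed (auto intro!: continuous_intros)
  then have "bounded ((\<lambda>\<xi>. iter_deriv vs (base_symbol e) (0, \<xi>)) ` cball e (1/4))"
    by (intro compact_imp_bounded compact_continuous_image) auto
  then obtain B where B: "B > 0" "\<And>\<xi>. \<xi> \<in> cball e (1/4) \<Longrightarrow> norm (iter_deriv vs (base_symbol e) (0, \<xi>)) \<le> B"
    unfolding bounded_pos by auto
  have "norm (iter_deriv vs (base_symbol e) z) \<le> B" for z
  proof (cases "norm (snd z - e) > 1/4")
    case True
    then show ?thesis using B(1) iter_deriv_base_symbol_eq_0 by (metis less_imp_le norm_zero)
  next
    case False
    then have "norm (iter_deriv vs (base_symbol e) (0, snd z)) \<le> B"
      by (intro B) (simp add: dist_norm norm_minus_commute)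
    then show ?thesis
      using iter_deriv_base_symbol_translate[OF assms, of e "fst z" "snd z"] by (simp add: norm_mult)
  qed
  with B(1) show ?thesis using that by blast
qed

text \<open>Near a given point one term is active. By scaling, each derivative in \<xi> gains a
  factor \<open>2 ^ j\<close> and each one in \<open>x\<close> costs it, in total
  \<open>2 powr (M * j)\<close>; on the support of the term \<open>2 ^ j\<close> and
  \<open>1 + norm \<xi>\<close> agree up to the factor 2, which suffices for either sign of
  \<open>M\<close>.\<close>

theorem ching_symbol_S11:
  fixes e :: "real^'n"
  assumes e: "norm e = 1"
  shows "symbol_S11 m (ching_symbol e m)"
  unfolding symbol_S11_def
proof (intro conjI allI)
  show "smooth (ching_symbol e m)" by (rule smooth_ching_symbol) fact
  fix \<alpha> \<beta> :: "'n list"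
  define us :: "((real^'n) \<times> (real^'n)) list" where "us = map (\<lambda>i. (0, axis i 1)) \<alpha>"
  define ws :: "((real^'n) \<times> (real^'n)) list" where "ws = map (\<lambda>i. (axis i 1, 0)) \<beta>"
  have vs: "set (us @ ws) \<subseteq> Basis" by (auto simp: us_def ws_def Basis_prod_def axis_in_Basis_iff)
  define M where "M = m - real (length \<alpha>) + real (length \<beta>)"
  obtain B where B: "B > 0" "\<And>z. norm (iter_deriv (us @ ws) (base_symbol e) z) \<le> B"
    using iter_deriv_base_symbol_bounded[OF vs] by blast
  have "norm (iter_deriv (us @ ws) (ching_symbol e m) (x, \<xi>)) \<le> (2 powr \<bar>M\<bar> * B) * (1 + norm \<xi>) powr M" for x \<xi>
  proof -
    obtain j U where j: "1 \<le> j" "open U" "(x, \<xi>) \<in> U"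
        "\<And>w. w \<in> U \<Longrightarrow> ching_symbol e m w = symbol_term e m j w"
      using ching_symbol_local[OF e, of "(x, \<xi>)" m] by metis
    let ?z = "(2 ^ j *\<^sub>R x, \<xi> /\<^sub>R 2 ^ j)"
    have "prod_list (map (\<lambda>v. if fst v = 0 then c else d) us) = c ^ length \<alpha>" for c d :: real
      unfolding us_def by (induction \<alpha>) auto
    moreover have "prod_list (map (\<lambda>v. if fst v = 0 then c else d) ws) = d ^ length \<beta>" for c d :: real
      unfolding ws_def by (induction \<beta>) (auto simp: axis_eq_0_iff)
    ultimately have *: "prod_list (map (\<lambda>v. if fst v = 0 then 1 / 2 ^ j else 2 ^ j) (us @ ws)) =
        (1 / 2 ^ j) ^ length \<alpha> * (2 ^ j :: real) ^ length \<beta>"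
      by simp
    have "iter_deriv (us @ ws) (\<lambda>z. complex_of_real (2 powr (m * real j)) *
        base_symbol e ((2 ^ j *\<^sub>R fst z, (1 / 2 ^ j) *\<^sub>R snd z) + 0)) =
       (\<lambda>z. complex_of_real (2 powr (m * real j)) *
         complex_of_real (prod_list (map (\<lambda>v. if fst v = 0 then 1 / 2 ^ j else 2 ^ j) (us @ ws))) *
         iter_deriv (us @ ws) (base_symbol e) ((2 ^ j *\<^sub>R fst z, (1 / 2 ^ j) *\<^sub>R snd z) + 0))"
      using vs by (intro iter_deriv_affine smooth_base_symbol bounded_linear_dilation dilation_Basis) auto
    moreover have "iter_deriv (us @ ws) (ching_symbol e m) (x, \<xi>) = iter_deriv (us @ ws) (symbol_term e m j) (x, \<xi>)"
      by (rule iter_deriv_cong_open[OF j(2,4,3)])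
    ultimately have "iter_deriv (us @ ws) (ching_symbol e m) (x, \<xi>) =
        complex_of_real (2 powr (m * real j) * ((1 / 2 ^ j) ^ length \<alpha> * (2 ^ j) ^ length \<beta>)) *
          iter_deriv (us @ ws) (base_symbol e) ?z"
      unfolding * by (simp add: symbol_term_def[abs_def] divide_inverse)
    also have "2 powr (m * real j) * ((1 / 2 ^ j) ^ length \<alpha> * (2 ^ j) ^ length \<beta>) = 2 powr (M * real j)"
      unfolding M_def
      by (simp add: powr_realpow[symmetric] powr_powr powr_divide powr_minus_divide[symmetric] powr_add[symmetric] algebra_simps
          flip: powr_diff)
    finally have eq: "norm (iter_deriv (us @ ws) (ching_symbol e m) (x, \<xi>)) =
        2 powr (M * real j) * norm (iter_deriv (us @ ws) (base_symbol e) ?z)"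
      by (simp add: norm_mult)
    show ?thesis
    proof (cases "norm (\<xi> /\<^sub>R 2 ^ j - e) > 1/4")
      case True
      then show ?thesis using eq B(1) iter_deriv_base_symbol_eq_0[of ?z e] by simp
    next
      case False
      have "norm (\<xi> /\<^sub>R 2 ^ j) \<le> 5/4" "norm (\<xi> /\<^sub>R 2 ^ j) \<ge> 3/4"
        using norm_triangle_sub[of "\<xi> /\<^sub>R 2 ^ j" e] norm_triangle_sub[of e "\<xi> /\<^sub>R 2 ^ j"] False e
        by (simp_all add: norm_minus_commute)
      then have "norm \<xi> \<le> 5/4 * 2 ^ j" "norm \<xi> \<ge> 3/4 * 2 ^ j" by (auto simp: field_simps)
      moreover have "(2::real) \<le> 2 ^ j" using power_increasing[OF j(1), of "2::real"] by simp
      ultimately have "2 ^ j / 2 \<le> 1 + norm \<xi>" "1 + norm \<xi> \<le> 2 * 2 ^ j" by linarith+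
      then have q: "2 ^ j / (1 + norm \<xi>) \<le> 2" "(1 + norm \<xi>) / 2 ^ j \<le> 2" "1 + norm \<xi> > 0"
        by (auto simp: field_simps add_pos_nonneg)
      have "2 powr (M * real j) = (2 ^ j) powr M"
        by (simp add: powr_realpow[symmetric] powr_powr mult.commute)
      also have "(2 ^ j) powr M = ((2 ^ j / (1 + norm \<xi>)) powr M) * (1 + norm \<xi>) powr M"
        using q(3) by (simp add: powr_divide)
      also have "(2 ^ j / (1 + norm \<xi>)) powr M \<le> 2 powr \<bar>M\<bar>"
      proof (cases "M \<ge> 0")
        case True
        then show ?thesis using q by (auto intro!: powr_mono2)
      next
        case False
        then have "(2 ^ j / (1 + norm \<xi>)) powr M = ((1 + norm \<xi>) / 2 ^ j) powr (- M)"
          using q(3) by (simp add: powr_divide powr_minus field_simps)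
        also have "\<dots> \<le> 2 powr (- M)" using q False by (intro powr_mono2) auto
        finally show ?thesis using False by simp
      qed
      finally have le: "2 powr (M * real j) \<le> 2 powr \<bar>M\<bar> * (1 + norm \<xi>) powr M"
        by (simp add: mult_right_mono)
      show ?thesis unfolding eq using mult_mono[OF le B(2)[of ?z]] by (simp add: mult_ac)
    qed
  qed
  then show "\<exists>c. \<forall>x \<xi>. norm (iter_deriv (map (\<lambda>i. (0, axis i 1)) \<alpha> @ map (\<lambda>i. (axis i 1, 0)) \<beta>) (ching_symbol e m) (x, \<xi>))
          \<le> c * (1 + norm \<xi>) powr (m - real (length \<alpha>) + real (length \<beta>))"
    unfolding us_def ws_def M_def by blast
qed

section \<open>Dilations, modulations and translations of bumps\<close>

lemma rapid_dil:
  fixes g :: "'a::euclidean_space \<Rightarrow> complex"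
  assumes g: "rapid g" and t: "t > 0"
  shows "rapid (dil t g)"
  unfolding rapid_def
proof (intro conjI allI)
  have "continuous_on UNIV g" using g by (simp add: rapid_def)
  moreover have "continuous_on UNIV (\<lambda>x::'a. t *\<^sub>R x)" by (intro continuous_intros)
  ultimately have "continuous_on UNIV (\<lambda>x. g (t *\<^sub>R x))" by (rule continuous_on_compose2) simp
  then show "continuous_on UNIV (dil t g)" unfolding dil_def by (intro continuous_intros)
  fix N :: nat
  obtain C where C: "C > 0" "\<And>x. (1 + norm x) ^ N * norm (g x) \<le> C"
    using rapidE[OF g] by blast
  define s where "s = max 1 (1 / t)"
  have "(1 + norm x) ^ N * norm (dil t g x) \<le> s ^ N * t ^ DIM('a) * C" for x :: 'a
  proof -
    have "1 * 1 + (1 / t) * norm (t *\<^sub>R x) \<le> s * 1 + s * norm (t *\<^sub>R x)"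
      by (intro add_mono mult_right_mono) (auto simp: s_def)
    then have "1 + norm x \<le> s * (1 + norm (t *\<^sub>R x))"
      using t by (simp add: algebra_simps)
    then have "(1 + norm x) ^ N \<le> (s * (1 + norm (t *\<^sub>R x))) ^ N"
      by (intro power_mono) auto
    then have "(1 + norm x) ^ N * norm (dil t g x) \<le> (s * (1 + norm (t *\<^sub>R x))) ^ N * norm (dil t g x)"
      by (intro mult_right_mono) auto
    also have "\<dots> = s ^ N * t ^ DIM('a) * ((1 + norm (t *\<^sub>R x)) ^ N * norm (g (t *\<^sub>R x)))"
      using t by (simp add: dil_def norm_mult norm_power power_mult_distrib)
    also have "\<dots> \<le> s ^ N * t ^ DIM('a) * C"
      using t by (intro mult_left_mono C) (auto simp: s_def)
    finally show ?thesis .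
  qed
  then show "\<exists>C. \<forall>x. (1 + norm x) ^ N * norm (dil t g x) \<le> C" by blast
qed

lemma fourier_modulate_translate:
  fixes g :: "'a::euclidean_space \<Rightarrow> complex"
  assumes "integrable lborel g"
  shows "fourier (\<lambda>y. cis (2 * pi * (w \<bullet> y)) * g (y - p)) \<xi> = fourier g (\<xi> - w) * cis (- 2 * pi * (p \<bullet> (\<xi> - w)))"
proof -
  have [measurable]: "g \<in> borel_measurable borel" by (rule integrable_lborel_measurable[OF assms])
  have "fourier (\<lambda>y. cis (2 * pi * (w \<bullet> y)) * g (y - p)) \<xi> =
      (LINT y|lborel. cis (2 * pi * (w \<bullet> (p + y))) * g y * cis (- 2 * pi * ((p + y) \<bullet> \<xi>)))"
    unfolding fourier_def
    using integral_lborel_affine[of "\<lambda>y. cis (2 * pi * (w \<bullet> y)) * g (y - p) * cis (- 2 * pi * (y \<bullet> \<xi>))" 1 p]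
    by simp
  also have "\<dots> = (LINT y|lborel. g y * cis (- 2 * pi * (y \<bullet> (\<xi> - w))) * cis (- 2 * pi * (p \<bullet> (\<xi> - w))))"
    by (intro Bochner_Integration.integral_cong refl)
       (simp add: cis_mult mult.left_commute[of "cis _" "g _"] mult.assoc,
        simp add: algebra_simps inner_diff_right inner_add_left inner_add_right inner_commute)
  finally show ?thesis by (simp add: fourier_def)
qed

lemma integrable_modulate_translate:
  fixes g :: "'a::euclidean_space \<Rightarrow> complex"
  assumes "integrable lborel g"
  shows "integrable lborel (\<lambda>y. cis (2 * pi * (w \<bullet> y)) * g (y - p))"
proof -
  have [measurable]: "g \<in> borel_measurable borel" by (rule integrable_lborel_measurable[OF assms])
  have "integrable lborel (\<lambda>y. g (y - p))"
    using integrable_lborel_affine[OF assms, of 1 "- p"] by simp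
  then show ?thesis
    by (rule Bochner_Integration.integrable_bound) (auto simp: norm_mult)
qed

lemma integrable_bounded_support:
  fixes g :: "'a::euclidean_space \<Rightarrow> complex"
  assumes [measurable]: "g \<in> borel_measurable borel" and "\<And>x. norm (g x) \<le> B" "\<And>x. g x \<noteq> 0 \<Longrightarrow> norm x \<le> R"
  shows "integrable lborel g"
proof (rule Bochner_Integration.integrable_bound)
  show "integrable lborel (\<lambda>x::'a. B * indicator (cball 0 R) x :: real)"
    using emeasure_lborel_cball_finite[of "0::'a" R]
    by (intro integrable_mult_right integrable_real_indicator) auto
  have "norm (g x) \<le> norm (B * indicator (cball 0 R) x :: real)" for x
    using assms(2)[of x] assms(3)[of x] by (cases "g x = 0") (auto simp: indicator_def)
  then show "AE x in lborel. norm (g x) \<le> norm (B * indicator (cball 0 R) x :: real)" by simp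
qed simp

lemma continuous_flat: "continuous_on UNIV (flat p)"
  by (intro continuous_at_imp_continuous_on ballI DERIV_isCont[OF flat_has_derivative])

lemma borel_measurable_bump [measurable (raw)]:
  assumes [measurable]: "f \<in> borel_measurable M"
  shows "(\<lambda>x. bump e (f x)) \<in> borel_measurable M"
proof -
  have [measurable]: "flat 1 \<in> borel_measurable borel"
    by (intro borel_measurable_continuous_onI continuous_flat)
  show ?thesis unfolding bump_def by measurable
qed

section \<open>Littlewood--Paley pairs\<close>

locale littlewood_paley_pair =
  fixes \<phi> \<Phi> :: "real^'n \<Rightarrow> complex"
  assumes lp: "littlewood_paley \<phi> \<Phi>"
begin

lemma rapid_phi: "rapid \<phi>" "rapid \<Phi>"
  using lp by (auto simp: littlewood_paley_def intro: schwartz_rapid)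

lemma dilate_eq_dil: "dilate (int k) g = dil (2 ^ k) (g :: real^'n \<Rightarrow> complex)"
proof -
  have "(2::real) powr (real_of_int (int k) * real CARD('n)) = (2 ^ k) ^ CARD('n)"
    by (simp add: powr_powr[symmetric] powr_realpow)
  then show ?thesis by (auto simp: dilate_def dil_def powr_realpow)
qed

lemma fourier_phi_zero_open: "norm \<xi> < 1/2 \<or> norm \<xi> > 2 \<Longrightarrow> fourier \<phi> \<xi> = 0"
  using lp unfolding littlewood_paley_def by fastforce

text \<open>The hypothesis allows the closed annulus; approaching the spheres of radius
  \<open>1/2\<close> and 2 from outside the annulus, continuity gives zero there as well. The exact
  splitting at dyadic radii rests on these boundary values.\<close>

lemma fourier_phi_zero:
  assumes "norm \<xi> \<le> 1/2 \<or> norm \<xi> \<ge> 2"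
  shows "fourier \<phi> \<xi> = 0"
proof (cases "norm \<xi> = 1/2 \<or> norm \<xi> = 2")
  case True
  define s where "s = (\<lambda>n::nat. if norm \<xi> = 2 then 1 + 1 / real (Suc n) else 1 - 1 / real (Suc n))"
  have c: "isCont (fourier \<phi>) x" for x
    using continuous_fourier[OF rapid_integrable[OF rapid_phi(1)]] by (simp add: continuous_on_eq_continuous_at)
  have inv: "(\<lambda>n. 1 / real (Suc n)) \<longlonglongrightarrow> 0"
    using LIMSEQ_inverse_real_of_nat by (simp add: inverse_eq_divide)
  have "s \<longlonglongrightarrow> 1"
    unfolding s_def using tendsto_add[OF tendsto_const[of 1] inv] tendsto_diff[OF tendsto_const[of 1] inv]
    by (cases "norm \<xi> = 2") (simp_all del: of_nat_Suc)
  then have "(\<lambda>n. s n *\<^sub>R \<xi>) \<longlonglongrightarrow> 1 *\<^sub>R \<xi>" by (intro tendsto_intros)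
  then have "(\<lambda>n. fourier \<phi> (s n *\<^sub>R \<xi>)) \<longlonglongrightarrow> fourier \<phi> (1 *\<^sub>R \<xi>)"
    by (intro isCont_tendsto_compose[OF c])
  moreover have "fourier \<phi> (s n *\<^sub>R \<xi>) = 0" for n
  proof (rule fourier_phi_zero_open)
    have t: "0 < 1 / real (Suc n)" "1 / real (Suc n) \<le> 1" by auto
    then have s: "norm (s n *\<^sub>R \<xi>) = s n * norm \<xi>" by (auto simp: s_def)
    show "norm (s n *\<^sub>R \<xi>) < 1/2 \<or> norm (s n *\<^sub>R \<xi>) > 2"
    proof (cases "norm \<xi> = 2")
      case False
      with True have n: "norm \<xi> = 1/2" by blast
      have "s n = 1 - 1 / real (Suc n)" using False by (simp add: s_def)
      then show ?thesis using t unfolding s n by simp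
    qed (use t s in \<open>simp add: s_def del: of_nat_Suc norm_scaleR\<close>)
  qed
  ultimately show ?thesis by (simp add: LIMSEQ_const_iff)
next
  case False
  with assms have "norm \<xi> < 1/2 \<or> norm \<xi> > 2" by linarith
  then show ?thesis by (rule fourier_phi_zero_open)
qed

lemma fourier_dilate: "fourier (dilate k \<phi>) \<xi> = fourier \<phi> (\<xi> /\<^sub>R 2 powr real_of_int k)"
proof -
  have "(2::real) powr (real_of_int k * real CARD('n)) = (2 powr real_of_int k) ^ CARD('n)"
    by (simp add: powr_powr[symmetric] powr_realpow)
  then have "dilate k \<phi> = dil (2 powr real_of_int k) \<phi>" by (auto simp: dilate_def dil_def)
  then show ?thesis by (simp add: fourier_dil rapid_integrable rapid_phi)
qed

definition K :: "nat \<Rightarrow> real^'n \<Rightarrow> complex" where "K = lp_kernel \<phi> \<Phi>"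

lemma K_0: "K 0 = \<Phi>" and K_pos: "k \<ge> 1 \<Longrightarrow> K k = dil (2 ^ k) \<phi>"
  by (auto simp: K_def lp_kernel_def dilate_eq_dil)

lemma fourier_K_pos: "k \<ge> 1 \<Longrightarrow> fourier (K k) \<xi> = fourier \<phi> (\<xi> /\<^sub>R 2 ^ k)"
  by (simp add: K_pos fourier_dil rapid_integrable rapid_phi)

lemma rapid_K: "rapid (K k)"
  using rapid_phi rapid_dil[of \<phi> "2 ^ k"] by (cases "k = 0") (auto simp: K_0 K_pos)

lemma integrable_K: "integrable lborel (K k)"
  by (rule rapid_integrable[OF rapid_K])

lemma fourier_K_support_lower:
  assumes "k \<ge> 1" "fourier (K k) \<xi> \<noteq> 0" shows "2 ^ k / 2 < norm \<xi>"
proof -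
  have "\<not> norm (\<xi> /\<^sub>R 2 ^ k) \<le> 1/2" using fourier_phi_zero[of "\<xi> /\<^sub>R 2 ^ k"] assms by (auto simp: fourier_K_pos)
  then show ?thesis by (simp add: field_simps)
qed

text \<open>Multipliers of index above \<open>N\<close> vanish on this ball, so the first identity
  is the formula for the transform of \<Phi>. For \<open>norm \<xi> \<ge> 2\<close> the indices
  \<open>k \<le> 0\<close> of the two-sided partition of unity vanish too, which gives the second.
  The difference of the two sums is the transform of \<Phi>, hence its support.\<close>

lemma fourier_Phi_partition:
  assumes "\<xi> \<noteq> 0" "norm \<xi> \<le> 2 ^ N"
  shows "(\<Sum>k\<le>N. fourier (K k) \<xi>) = 1" and "norm \<xi> \<ge> 2 \<Longrightarrow> (\<Sum>k\<in>{1..N}. fourier (K k) \<xi>) = 1"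
proof -
  have big: "fourier \<phi> (\<xi> /\<^sub>R 2 ^ k) = 0" if "k > N" for k
  proof (rule fourier_phi_zero)
    have "2 * 2 ^ N \<le> (2 ^ k :: real)" using that power_increasing[of "Suc N" k "2::real"] by simp
    then have "2 * norm \<xi> \<le> 2 ^ k" using assms by linarith
    then show "norm (\<xi> /\<^sub>R 2 ^ k) \<le> 1/2 \<or> norm (\<xi> /\<^sub>R 2 ^ k) \<ge> 2" by (simp add: field_simps)
  qed
  have eq: "fourier (dilate (int k) \<phi>) \<xi> = fourier \<phi> (\<xi> /\<^sub>R 2 ^ k)" for k
    by (simp add: fourier_dilate powr_realpow)
  have sum: "(\<Sum>k\<in>{1..N}. fourier (K k) \<xi>) = (\<Sum>k<N. fourier (dilate (int (Suc k)) \<phi>) \<xi>)"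
    unfolding eq by (rule sum.reindex_bij_witness[of _ Suc "\<lambda>k. k - 1"]) (auto simp: fourier_K_pos)
  have "(\<Sum>k. fourier (dilate (int (Suc k)) \<phi>) \<xi>) = (\<Sum>k<N. fourier (dilate (int (Suc k)) \<phi>) \<xi>)"
    unfolding eq by (rule suminf_finite) (auto simp del: power_Suc intro: big)
  moreover have "fourier \<Phi> \<xi> = 1 - (\<Sum>k. fourier (dilate (int (Suc k)) \<phi>) \<xi>)"
    using lp unfolding littlewood_paley_def by blast
  ultimately have "fourier \<Phi> \<xi> = 1 - (\<Sum>k\<in>{1..N}. fourier (K k) \<xi>)"
    by (simp only: sum)
  moreover have "{..N} = insert 0 {1..N}" by auto
  ultimately show "(\<Sum>k\<le>N. fourier (K k) \<xi>) = 1" by (simp add: K_0)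
  assume \<xi>2: "norm \<xi> \<ge> 2"
  have zero: "fourier (dilate k \<phi>) \<xi> = 0" if "k \<notin> int ` {1..N}" for k
  proof (cases "k \<le> 0")
    case True
    then have "2 powr real_of_int k \<le> 1" using powr_mono[of "real_of_int k" 0 2] by simp
    then have "2 * 2 powr real_of_int k \<le> norm \<xi>" using \<xi>2 by linarith
    then show ?thesis unfolding fourier_dilate by (intro fourier_phi_zero) (simp add: field_simps)
  next
    case False
    then obtain i where i: "k = int i" by (metis zero_le_imp_eq_int linear)
    then have "i > N" using that False by auto
    then show ?thesis using i eq big by simp
  qed
  have "((\<lambda>k. fourier (dilate k \<phi>) \<xi>) has_sum 1) UNIV"
    using lp assms(1) by (simp add: littlewood_paley_def)
  moreover have "((\<lambda>k. fourier (dilate k \<phi>) \<xi>) has_sum 1) UNIV \<longleftrightarrow>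
      ((\<lambda>k. fourier (dilate k \<phi>) \<xi>) has_sum 1) (int ` {1..N})"
    by (rule has_sum_cong_neutral) (auto intro: zero)
  ultimately have "((\<lambda>k. fourier (dilate k \<phi>) \<xi>) has_sum 1) (int ` {1..N})" by blast
  then have "(\<Sum>k\<in>int ` {1..N}. fourier (dilate k \<phi>) \<xi>) = 1"
    by (meson finite_atLeastAtMost finite_imageI has_sum_finite has_sum_unique)
  then show "(\<Sum>k\<in>{1..N}. fourier (K k) \<xi>) = 1"
    by (simp add: sum.reindex eq fourier_K_pos)
qed

lemma fourier_Phi_zero: "norm \<xi> \<ge> 2 \<Longrightarrow> fourier \<Phi> \<xi> = 0"
proof -
  assume \<xi>: "norm \<xi> \<ge> 2"
  obtain N where "norm \<xi> < 2 ^ N" using real_arch_pow[of 2 "norm \<xi>"] by auto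
  moreover have "{..N} = insert 0 {1..N}" by auto
  moreover have "\<xi> \<noteq> 0" using \<xi> by auto
  ultimately show ?thesis using fourier_Phi_partition[of \<xi> N] \<xi> by (simp add: K_0)
qed

lemma fourier_Phi_eq_1:
  assumes "norm \<xi> \<le> 1" shows "fourier \<Phi> \<xi> = 1"
proof -
  have "fourier (dilate (int (Suc k)) \<phi>) \<xi> = 0" for k
  proof -
    have "2 \<le> (2::real) ^ Suc k" by simp
    then have "2 * norm \<xi> \<le> 2 ^ Suc k" using assms by linarith
    then show ?thesis
      unfolding fourier_dilate
      by (intro fourier_phi_zero) (simp add: powr_realpow field_simps flip: of_nat_Suc)
  qed
  moreover have "fourier \<Phi> \<xi> = 1 - (\<Sum>k. fourier (dilate (int (Suc k)) \<phi>) \<xi>)"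
    using lp unfolding littlewood_paley_def by blast
  ultimately show ?thesis by (simp only: suminf_zero diff_zero)
qed

lemma fourier_K_support: "fourier (K k) \<xi> \<noteq> 0 \<Longrightarrow> norm \<xi> < 2 * 2 ^ k"
proof (cases "k = 0")
  case False
  assume "fourier (K k) \<xi> \<noteq> 0"
  then have "\<not> norm (\<xi> /\<^sub>R 2 ^ k) \<ge> 2"
    using False fourier_phi_zero[of "\<xi> /\<^sub>R 2 ^ k"] by (auto simp: fourier_K_pos)
  then show ?thesis by (simp add: field_simps)
qed (use fourier_Phi_zero[of \<xi>] in \<open>auto simp: K_0 not_le[symmetric]\<close>)

lemma fourier_K_dyadic_sphere:
  assumes "n \<ge> 1" "norm \<xi> = 2 ^ n"
  shows "fourier (K k) \<xi> = (if k = n then 1 else 0)"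
proof -
  have zero: "fourier (K k) \<xi> = 0" if "k \<noteq> n" for k
  proof (rule ccontr)
    assume nz: "fourier (K k) \<xi> \<noteq> 0"
    show False
    proof (cases "k < n")
      case True
      then have "2 * 2 ^ k \<le> (2 ^ n :: real)" using power_increasing[of "Suc k" n "2::real"] by simp
      then show False using fourier_K_support[OF nz] assms by linarith
    next
      case False
      then have "2 * 2 ^ n \<le> (2 ^ k :: real)" using that power_increasing[of "Suc n" k "2::real"] by simp
      then show False using fourier_K_support_lower[OF _ nz] False assms by linarith
    qed
  qed
  have "\<xi> \<noteq> 0" using assms by auto
  then have "(\<Sum>k\<le>n. fourier (K k) \<xi>) = 1" using fourier_Phi_partition(1)[of \<xi> n] assms by simp
  moreover have "(\<Sum>k\<le>n. fourier (K k) \<xi>) = (\<Sum>k\<in>{n}. fourier (K k) \<xi>)"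
    by (rule sum.mono_neutral_right) (use zero in auto)
  ultimately show ?thesis using zero by simp
qed

lemma integrable_fourier_K: "integrable lborel (fourier (K k))"
  by (rule integrable_bounded_support[where R = "2 * 2 ^ k"])
     (auto intro!: norm_fourier_le borel_measurable_fourier integrable_K less_imp_le[OF fourier_K_support])

lemma K_conv:
  assumes "integrable lborel h"
  shows "(LINT y|lborel. h y * K k (x - y)) =
    (LINT \<xi>|lborel. fourier h \<xi> * (fourier (K k) \<xi> * cis (2 * pi * (x \<bullet> \<xi>))))"
proof -
  obtain B where "\<And>x. norm (K k x) \<le> B" using rapid_bounded[OF rapid_K] by blast
  then show ?thesis
    using rapid_K[of k]
    by (intro conv_fourier_formula assms integrable_K integrable_fourier_K) (auto simp: rapid_def)
qed

lemma K_inversion: "(LINT \<xi>|lborel. fourier (K k) \<xi> * cis (2 * pi * (x \<bullet> \<xi>))) = K k x"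
proof -
  obtain B where "\<And>x. norm (K k x) \<le> B" using rapid_bounded[OF rapid_K] by blast
  then show ?thesis
    using rapid_K[of k]
    by (intro fourier_inversion integrable_K integrable_fourier_K) (auto simp: rapid_def)
qed

text \<open>The factor \<open>1/32\<close> confines the spectrum of \<open>\<psi>\<close> to a ball of radius \<open>1/16\<close>, the size of the
  plateau of \<^const>\<open>bump\<close>.\<close>

definition \<psi> :: "real^'n \<Rightarrow> complex" where "\<psi> = dil (1/32) \<Phi>"

lemma rapid_psi: "rapid \<psi>"
  unfolding \<psi>_def by (intro rapid_dil rapid_phi) simp

lemma integrable_psi: "integrable lborel \<psi>"
  by (rule rapid_integrable[OF rapid_psi])

lemma fourier_psi: "fourier \<psi> \<xi> = fourier \<Phi> (32 *\<^sub>R \<xi>)"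
  unfolding \<psi>_def by (subst fourier_dil) (auto intro: rapid_integrable rapid_phi)

lemma fourier_psi_support: "fourier \<psi> \<xi> \<noteq> 0 \<Longrightarrow> norm \<xi> < 1/16"
  using fourier_Phi_zero[of "32 *\<^sub>R \<xi>"] by (force simp: fourier_psi)

lemma fourier_psi_eq_1: "norm \<xi> \<le> 1/32 \<Longrightarrow> fourier \<psi> \<xi> = 1"
  using fourier_Phi_eq_1[of "32 *\<^sub>R \<xi>"] by (simp add: fourier_psi)

lemma fourier_dil_psi: "fourier (dil (2 ^ r) \<psi>) \<xi> = fourier \<psi> (\<xi> /\<^sub>R 2 ^ r)"
  by (simp add: fourier_dil integrable_psi)

lemma integrable_dil_psi: "integrable lborel (dil (2 ^ r) \<psi>)"
  by (simp add: integrable_dil integrable_psi)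

text \<open>The transform of the kernel lives in the ball of radius \<open>2 * 2 ^ k\<close>, and
  that of the bump is 1 on the ball of radius \<open>2 ^ r / 32\<close>. The gap of 6 puts the
  former inside the latter, so the bump acts as a point mass at \<open>p\<close>.\<close>

lemma dil_psi_conv_K:
  assumes "k + 6 \<le> r"
  shows "(LINT y|lborel. dil (2 ^ r) \<psi> (y - p) * K k (x - y)) = K k (x - p)"
proof -
  have [measurable]: "dil (2 ^ r) \<psi> \<in> borel_measurable borel" "K k \<in> borel_measurable borel"
    using borel_measurable_integrable[OF integrable_dil_psi] borel_measurable_integrable[OF integrable_K] by simp_all
  have "(LINT y|lborel. dil (2 ^ r) \<psi> (y - p) * K k (x - y)) = (LINT y|lborel. dil (2 ^ r) \<psi> y * K k (x - p - y))"
    using integral_lborel_affine[of "\<lambda>y. dil (2 ^ r) \<psi> (y - p) * K k (x - y)" 1 p] by (simp add: algebra_simps)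
  also have "\<dots> = (LINT \<xi>|lborel. fourier (dil (2 ^ r) \<psi>) \<xi> * (fourier (K k) \<xi> * cis (2 * pi * ((x - p) \<bullet> \<xi>))))"
    by (rule K_conv[OF integrable_dil_psi])
  also have "\<dots> = (LINT \<xi>|lborel. fourier (K k) \<xi> * cis (2 * pi * ((x - p) \<bullet> \<xi>)))"
  proof (intro Bochner_Integration.integral_cong refl)
    fix \<xi>
    show "fourier (dil (2 ^ r) \<psi>) \<xi> * (fourier (K k) \<xi> * cis (2 * pi * ((x - p) \<bullet> \<xi>))) =
        fourier (K k) \<xi> * cis (2 * pi * ((x - p) \<bullet> \<xi>))"
    proof (cases "fourier (K k) \<xi> = 0")
      case False
      have "64 * 2 ^ k \<le> (2 ^ r :: real)" using assms power_increasing[of "k + 6" r "2::real"] by (simp add: power_add)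
      then have "norm \<xi> \<le> 2 ^ r / 32" using fourier_K_support[OF False] by linarith
      then have "fourier (dil (2 ^ r) \<psi>) \<xi> = 1"
        unfolding fourier_dil_psi by (intro fourier_psi_eq_1) (simp add: field_simps)
      then show ?thesis by simp
    qed simp
  qed
  also have "\<dots> = K k (x - p)" by (rule K_inversion)
  finally show ?thesis .
qed

end

section \<open>Weighted series of bumps as distributions\<close>

text \<open>One power of decay is what a pairing with the series below consumes. The class contains
  the reflected translates of the kernels without any estimate of derivatives.\<close>

definition weakly_decaying :: "('a::euclidean_space \<Rightarrow> complex) \<Rightarrow> bool" where
  "weakly_decaying g \<longleftrightarrow> g \<in> borel_measurable borel \<and> (\<exists>S. \<forall>x. (1 + norm x) * norm (g x) \<le> S)"

lemma rapid_weakly_decaying: "rapid g \<Longrightarrow> weakly_decaying g"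
  unfolding weakly_decaying_def using rapidE[of g 1] borel_measurable_rapid[of g] by (metis power_one_right)

lemma rapid_reflect_weakly_decaying:
  assumes "rapid g" shows "weakly_decaying (\<lambda>y. g (x - y))"
proof -
  have [measurable]: "g \<in> borel_measurable borel" using assms by (rule borel_measurable_rapid)
  obtain C where C: "C > 0" "\<And>x. (1 + norm x) * norm (g x) \<le> C"
    using rapidE[OF assms, of 1] by (metis power_one_right)
  have "(1 + norm y) * norm (g (x - y)) \<le> (1 + norm x) * C" for y
  proof -
    have "norm y \<le> norm x + norm (x - y)" using norm_triangle_sub[of y x] by (simp add: norm_minus_commute)
    then have "1 + norm y \<le> (1 + norm x) * (1 + norm (x - y))"
      using mult_nonneg_nonneg[OF norm_ge_zero[of x] norm_ge_zero[of "x - y"]]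
      by (simp only: ring_distribs mult_1 mult_1_right)
    then have "(1 + norm y) * norm (g (x - y)) \<le> (1 + norm x) * (1 + norm (x - y)) * norm (g (x - y))"
      by (intro mult_right_mono) auto
    also have "\<dots> \<le> (1 + norm x) * C"
      unfolding mult.assoc by (intro mult_left_mono C) auto
    finally show ?thesis .
  qed
  then show ?thesis unfolding weakly_decaying_def by (auto intro!: exI)
qed

lemma weakly_decaying_bounded:
  assumes "weakly_decaying g" obtains B where "\<And>x. norm (g x) \<le> B"
proof -
  obtain S where "\<And>x. (1 + norm x) * norm (g x) \<le> S" using assms by (auto simp: weakly_decaying_def)
  moreover have "norm (g x) \<le> (1 + norm x) * norm (g x)" for x by (simp add: algebra_simps)
  ultimately show ?thesis using that order_trans by blast
qed

text \<open>All \<open>A n\<close> are dominated by rescaled translates of one profile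
  \<open>w\<close>, and the coefficients are summable only after division by the size of the
  centres. The atoms, their demodulated profiles and the errors of the partial sums are
  instances.\<close>

locale weighted_series =
  fixes A :: "nat \<Rightarrow> 'a::euclidean_space \<Rightarrow> complex" and c :: "nat \<Rightarrow> real"
    and t :: "nat \<Rightarrow> real" and p :: "nat \<Rightarrow> 'a" and w :: "'a \<Rightarrow> real"
  assumes w: "integrable lborel (\<lambda>z. (1 + norm z) * w z)" "\<And>z. w z \<ge> 0" "w \<in> borel_measurable borel"
    and t: "\<And>n. 1 \<le> t n"
    and A: "\<And>n. A n \<in> borel_measurable borel" "\<And>n x. norm (A n x) \<le> t n ^ DIM('a) * w (t n *\<^sub>R (x - p n))"
    and c: "summable (\<lambda>n. \<bar>c n\<bar> / (1 + norm (p n)))"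
begin

definition pair :: "('a \<Rightarrow> complex) \<Rightarrow> complex" where
  "pair g = (\<Sum>n. c n *\<^sub>R (LINT x|lborel. A n x * g x))"

definition mass :: real where "mass = (LINT z|lborel. (1 + norm z) * w z)"

lemma term_bound:
  assumes "\<And>x. (1 + norm x) * norm (g x) \<le> S"
  shows "norm (c n *\<^sub>R (LINT x|lborel. A n x * g x)) \<le> \<bar>c n\<bar> / (1 + norm (p n)) * (mass * S)"
  using mult_left_mono[OF weighted_pairing_bound[where h = "A n" and t = "t n" and p = "p n", OF w t A(2) assms], of "\<bar>c n\<bar>"]
  by (simp add: mass_def)

lemma terms_tendsto_0:
  assumes "weakly_decaying g"
  shows "(\<lambda>n. c n *\<^sub>R (LINT x|lborel. A n x * g x)) \<longlonglongrightarrow> 0"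
proof -
  obtain S where S: "\<And>x. (1 + norm x) * norm (g x) \<le> S" using assms by (auto simp: weakly_decaying_def)
  have "(\<lambda>n. \<bar>c n\<bar> / (1 + norm (p n)) * (mass * S)) \<longlonglongrightarrow> 0"
    using tendsto_mult_right[OF summable_LIMSEQ_zero[OF c], of "mass * S"] by simp
  then show ?thesis
    by (rule Lim_null_comparison[rotated]) (use term_bound[OF S] in auto)
qed

lemma summable_terms:
  assumes "weakly_decaying g"
  shows "summable (\<lambda>n. c n *\<^sub>R (LINT x|lborel. A n x * g x))"
proof -
  obtain S where S: "\<And>x. (1 + norm x) * norm (g x) \<le> S" using assms by (auto simp: weakly_decaying_def)
  show ?thesis
    by (rule summable_comparison_test'[OF summable_mult2[OF c, of "mass * S"]]) (rule term_bound[OF S])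
qed

lemma pair_bound:
  assumes S: "\<And>x. (1 + norm x) * norm (g x) \<le> S"
  shows "norm (pair g) \<le> (\<Sum>n. \<bar>c n\<bar> / (1 + norm (p n))) * (mass * S)"
proof -
  have s: "summable (\<lambda>n. \<bar>c n\<bar> / (1 + norm (p n)) * (mass * S))" by (rule summable_mult2[OF c])
  then have s': "summable (\<lambda>n. norm (c n *\<^sub>R (LINT x|lborel. A n x * g x)))"
    by (rule summable_comparison_test'[where N = 0]) (use term_bound[OF S] in simp)
  have "norm (pair g) \<le> (\<Sum>n. norm (c n *\<^sub>R (LINT x|lborel. A n x * g x)))"
    unfolding pair_def by (rule summable_norm[OF s'])
  also have "\<dots> \<le> (\<Sum>n. \<bar>c n\<bar> / (1 + norm (p n)) * (mass * S))"
    by (rule suminf_le[OF term_bound[OF S] s' s])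
  also have "\<dots> = (\<Sum>n. \<bar>c n\<bar> / (1 + norm (p n))) * (mass * S)"
    by (rule suminf_mult2[OF c, symmetric])
  finally show ?thesis .
qed

lemma integrable_A: "integrable lborel (A n)"
proof (rule Bochner_Integration.integrable_bound)
  have [measurable]: "w \<in> borel_measurable borel" by (rule w)
  have "integrable lborel w"
    by (rule Bochner_Integration.integrable_bound[OF w(1)])
       (auto intro!: AE_I2 simp: abs_mult w(2) algebra_simps mult_nonneg_nonneg)
  then have "integrable lborel (\<lambda>x. w (- t n *\<^sub>R p n + t n *\<^sub>R x))"
    using t[of n] by (intro integrable_lborel_affine) auto
  then show "integrable lborel (\<lambda>x. t n ^ DIM('a) * w (t n *\<^sub>R (x - p n)))"
    by (simp add: algebra_simps)
  show "AE x in lborel. norm (A n x) \<le> norm (t n ^ DIM('a) * w (t n *\<^sub>R (x - p n)))"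
    using order_trans[OF A(2) abs_ge_self] by (intro AE_I2) simp
qed (simp add: A)

lemma integrable_A_mult:
  assumes "weakly_decaying g"
  shows "integrable lborel (\<lambda>x. A n x * g x)"
proof -
  have [measurable]: "g \<in> borel_measurable borel" "A n \<in> borel_measurable borel"
    using assms A by (auto simp: weakly_decaying_def)
  obtain B where B: "\<And>x. norm (g x) \<le> B" using weakly_decaying_bounded[OF assms] by blast
  have "integrable lborel (\<lambda>x. B * norm (A n x))"
    using integrable_A by (intro integrable_mult_right integrable_norm)
  then show ?thesis
  proof (rule Bochner_Integration.integrable_bound)
    have "norm (A n x * g x) \<le> norm (B * norm (A n x))" for x
      using mult_left_mono[OF B[of x], of "norm (A n x)"] abs_ge_self[of "B * norm (A n x)"]
      by (simp add: norm_mult mult.commute)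
    then show "AE x in lborel. norm (A n x * g x) \<le> norm (B * norm (A n x))" by simp
  qed simp
qed

lemma pair_diff:
  assumes "weakly_decaying g" "weakly_decaying h"
  shows "pair (\<lambda>x. g x - h x) = pair g - pair h"
  unfolding pair_def using summable_terms[OF assms(1)] summable_terms[OF assms(2)]
  by (simp add: suminf_diff integrable_A_mult assms right_diff_distrib scaleR_diff_right)

lemma tempered_pair: "tempered pair"
  unfolding tempered_def
proof (intro conjI allI impI)
  fix g h :: "'a \<Rightarrow> complex" assume "schwartz g" "schwartz h"
  then have gh: "weakly_decaying g" "weakly_decaying h"
    by (auto intro: schwartz_rapid rapid_weakly_decaying)
  show "pair (\<lambda>x. g x + h x) = pair g + pair h"
    unfolding pair_def using summable_terms[OF gh(1)] summable_terms[OF gh(2)]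
    by (simp add: suminf_add integrable_A_mult gh distrib_left scaleR_add_right)
next
  fix z and g :: "'a \<Rightarrow> complex" assume "schwartz g"
  then have g: "weakly_decaying g" by (auto intro: schwartz_rapid rapid_weakly_decaying)
  have "(\<lambda>n. c n *\<^sub>R (LINT x|lborel. A n x * (z * g x))) = (\<lambda>n. z * (c n *\<^sub>R (LINT x|lborel. A n x * g x)))"
    by (simp add: mult.left_commute[of _ z])
  moreover have "(\<Sum>n. z * (c n *\<^sub>R (LINT x|lborel. A n x * g x))) = z * (\<Sum>n. c n *\<^sub>R (LINT x|lborel. A n x * g x))"
    by (rule suminf_mult[OF summable_terms[OF g]])
  ultimately show "pair (\<lambda>x. z * g x) = z * pair g"
    unfolding pair_def by (simp only:)
next
  fix G and g :: "'a \<Rightarrow> complex"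
  assume G: "\<forall>n. schwartz (G n)" and g: "schwartz g" and lim: "schwartz_tendsto G g"
  \<comment> \<open>Continuity holds already for the seminorm with one power of decay and no
    derivative.\<close>
  define S where "S = (\<lambda>n. schwartz_seminorm 1 [] (\<lambda>x. G n x - g x))"
  have decay: "weakly_decaying (G n)" "weakly_decaying g" for n
    using G g by (auto intro: schwartz_rapid rapid_weakly_decaying)
  \<comment> \<open>The seminorm is a supremum of reals, so the set has to be shown bounded before
    the supremum dominates its members.\<close>
  have S: "(1 + norm x) * norm (G n x - g x) \<le> S n" for n x
  proof -
    obtain B B' where B: "\<And>x. (1 + norm x) * norm (G n x) \<le> B" "\<And>x. (1 + norm x) * norm (g x) \<le> B'"
      using decay(1)[of n] decay(2) by (auto simp: weakly_decaying_def)
    have "(1 + norm x) * norm (G n x - g x) \<le> B + B'" for x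
    proof -
      have "(1 + norm x) * norm (G n x - g x) \<le> (1 + norm x) * (norm (G n x) + norm (g x))"
        by (intro mult_left_mono norm_triangle_ineq4) auto
      also have "\<dots> \<le> B + B'" using add_mono[OF B(1)[of x] B(2)[of x]] by (simp add: algebra_simps)
      finally show ?thesis .
    qed
    then have "bdd_above (range (\<lambda>x. (1 + norm x) * norm (G n x - g x)))"
      by (intro bdd_aboveI2)
    from cSUP_upper[OF UNIV_I this, of x] show ?thesis
      by (simp add: S_def schwartz_seminorm_def)
  qed
  have "S \<longlonglongrightarrow> 0"
    using lim unfolding schwartz_tendsto_def S_def by (metis empty_set empty_subsetI)
  then have "(\<lambda>n. (\<Sum>n. \<bar>c n\<bar> / (1 + norm (p n))) * (mass * S n)) \<longlonglongrightarrow>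
      (\<Sum>n. \<bar>c n\<bar> / (1 + norm (p n))) * (mass * 0)"
    by (intro tendsto_intros)
  moreover have "norm (pair (G n) - pair g) \<le> (\<Sum>n. \<bar>c n\<bar> / (1 + norm (p n))) * (mass * S n)" for n
    using pair_bound[OF S, of n] by (simp add: pair_diff decay)
  ultimately have "(\<lambda>n. pair (G n) - pair g) \<longlonglongrightarrow> 0"
    by (intro Lim_null_comparison[of "\<lambda>n. pair (G n) - pair g"]) auto
  then show "(\<lambda>n. pair (G n)) \<longlonglongrightarrow> pair g" by (simp add: LIM_zero_iff)
qed

end

section \<open>Modulated bumps and their images\<close>

lemma norm_inverse_scale: "c > 0 \<Longrightarrow> norm (v /\<^sub>R c) = norm v / c"
  by (simp add: divide_inverse mult.commute)

text \<open>\<open>D\<close> holds the coefficients of the image and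
  \<open>2 powr (- m * n) * D n\<close> those of the input, so both series need summability.
  Vanishing for \<open>n < 2\<close> keeps the three bands \<open>n - 1\<close>, \<open>n\<close>,
  \<open>n + 1\<close> of an atom at index at least 1, where the kernels are dilates of
  \<phi>.\<close>

locale ching_atoms = littlewood_paley_pair \<phi> \<Phi> for \<phi> \<Phi> :: "real^'n \<Rightarrow> complex" +
  fixes e :: "real^'n" and m :: real and D :: "nat \<Rightarrow> real" and p :: "nat \<Rightarrow> real^'n" and r :: "nat \<Rightarrow> nat"
  assumes e: "norm e = 1"
    and r_le: "\<And>n. r n \<le> n"
    and D_0: "\<And>n. n < 2 \<Longrightarrow> D n = 0"
    and D_summable: "summable (\<lambda>n. \<bar>D n\<bar> / (1 + norm (p n)))"
    and D_summable_m: "summable (\<lambda>n. \<bar>2 powr (- m * real n) * D n\<bar> / (1 + norm (p n)))"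
begin

definition profile :: "nat \<Rightarrow> real^'n \<Rightarrow> complex" where
  "profile n y = dil (2 ^ r n) \<psi> (y - p n)"

definition atom :: "nat \<Rightarrow> real^'n \<Rightarrow> complex" where
  "atom n y = cis (2 * pi * ((2 ^ n *\<^sub>R e) \<bullet> y)) * profile n y"

definition W :: "nat \<Rightarrow> nat \<Rightarrow> real^'n \<Rightarrow> complex" where
  "W n k x = (LINT y|lborel. atom n y * K k (x - y))"

lemma integrable_atom: "integrable lborel (atom n)"
  unfolding atom_def[abs_def] profile_def by (rule integrable_modulate_translate[OF integrable_dil_psi])

lemma integrable_profile: "integrable lborel (profile n)"
  unfolding profile_def[abs_def]
  using integrable_modulate_translate[OF integrable_dil_psi, of 0] by simp

lemma norm_profile: "norm (profile n x) = (2 ^ r n) ^ CARD('n) * norm (\<psi> (2 ^ r n *\<^sub>R (x - p n)))"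
  by (simp add: profile_def dil_def norm_mult norm_power)

lemma fourier_atom: "fourier (atom n) \<xi> =
    fourier \<psi> ((\<xi> - 2 ^ n *\<^sub>R e) /\<^sub>R 2 ^ r n) * cis (- 2 * pi * (p n \<bullet> (\<xi> - 2 ^ n *\<^sub>R e)))"
  unfolding atom_def[abs_def] profile_def by (simp only: fourier_modulate_translate[OF integrable_dil_psi] fourier_dil_psi)

lemma fourier_atom_support:
  assumes "fourier (atom n) \<xi> \<noteq> 0"
  shows "norm (\<xi> - 2 ^ n *\<^sub>R e) < 2 ^ n / 16" "15/16 * 2 ^ n < norm \<xi>" "norm \<xi> < 17/16 * 2 ^ n"
proof -
  have "fourier \<psi> ((\<xi> - 2 ^ n *\<^sub>R e) /\<^sub>R 2 ^ r n) \<noteq> 0" using assms by (auto simp: fourier_atom)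
  then have "norm ((\<xi> - 2 ^ n *\<^sub>R e) /\<^sub>R 2 ^ r n) < 1/16" by (rule fourier_psi_support)
  then have "norm (\<xi> - 2 ^ n *\<^sub>R e) / 2 ^ r n < 1/16"
    by (simp only: norm_inverse_scale zero_less_power zero_less_numeral)
  then have "norm (\<xi> - 2 ^ n *\<^sub>R e) < 2 ^ r n / 16" by (simp add: divide_less_eq)
  moreover have "(2::real) ^ r n \<le> 2 ^ n" using r_le by (intro power_increasing) auto
  ultimately show *: "norm (\<xi> - 2 ^ n *\<^sub>R e) < 2 ^ n / 16" by linarith
  have "norm (2 ^ n *\<^sub>R e) = 2 ^ n" using e by simp
  then show "15/16 * 2 ^ n < norm \<xi>" "norm \<xi> < 17/16 * 2 ^ n"
    using * norm_triangle_sub[of \<xi> "2 ^ n *\<^sub>R e"] norm_triangle_sub[of "2 ^ n *\<^sub>R e" \<xi>]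
    by (simp_all only: norm_minus_commute[of _ \<xi>])
qed

text \<open>The spectrum of the \<open>n\<close>-th atom lies within \<open>2 ^ n / 16\<close> of
  \<open>2 ^ n e\<close>, where the cutoff of index \<open>n\<close> is 1, and its annulus misses
  the supports of the other cutoffs.\<close>

lemma bump_fourier_atom:
  "fourier (atom n) \<xi> * complex_of_real (bump e (\<xi> /\<^sub>R 2 ^ j)) = (if j = n then fourier (atom n) \<xi> else 0)"
proof (cases "fourier (atom n) \<xi> = 0")
  case False
  note supp = fourier_atom_support[OF False]
  show ?thesis
  proof (cases "j = n")
    case True
    have "norm (\<xi> /\<^sub>R 2 ^ n - e) = norm (\<xi> - 2 ^ n *\<^sub>R e) / 2 ^ n"
    proof -
      have "\<xi> /\<^sub>R 2 ^ n - e = (\<xi> - 2 ^ n *\<^sub>R e) /\<^sub>R 2 ^ n" by (simp add: scaleR_diff_right)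
      then show ?thesis by (simp only: norm_inverse_scale zero_less_power zero_less_numeral)
    qed
    also have "\<dots> \<le> 1/16" using supp(1) by (simp add: field_simps)
    finally show ?thesis using True by (simp add: bump_eq_1)
  next
    case False
    have "bump e (\<xi> /\<^sub>R 2 ^ j) = 0"
    proof (rule ccontr)
      assume "bump e (\<xi> /\<^sub>R 2 ^ j) \<noteq> 0"
      note b = bump_scaled_nonzero[OF e this]
      show False
      proof (cases "j < n")
        case True
        then have "2 * 2 ^ j \<le> (2 ^ n :: real)" using power_increasing[of "Suc j" n "2::real"] by simp
        moreover have "(2::real) ^ n > 0" by simp
        ultimately show False using b supp by linarith
      next
        case F: False
        then have "2 * 2 ^ n \<le> (2 ^ j :: real)" using False power_increasing[of "Suc n" j "2::real"] by simp
        moreover have "(2::real) ^ n > 0" by simp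
        ultimately show False using b supp by linarith
      qed
    qed
    then show ?thesis using False by simp
  qed
qed simp

lemma W_fourier:
  "W n k x = (LINT \<xi>|lborel. fourier (atom n) \<xi> * (fourier (K k) \<xi> * cis (2 * pi * (x \<bullet> \<xi>))))"
  unfolding W_def by (rule K_conv[OF integrable_atom])

lemma fourier_atom_K_zero:
  assumes "n \<ge> 2" "\<not> (k \<le> n + 1 \<and> n \<le> k + 1)"
  shows "fourier (atom n) \<xi> * fourier (K k) \<xi> = 0"
proof (rule ccontr)
  assume "fourier (atom n) \<xi> * fourier (K k) \<xi> \<noteq> 0"
  then have nz: "fourier (atom n) \<xi> \<noteq> 0" "fourier (K k) \<xi> \<noteq> 0" by auto
  note supp = fourier_atom_support(2,3)[OF nz(1)]
  have pos: "(2::real) ^ n > 0" by simp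
  show False
  proof (cases "k > n + 1")
    case True
    then have "4 * 2 ^ n \<le> (2 ^ k :: real)" using power_increasing[of "n + 2" k "2::real"] by simp
    then show False using fourier_K_support_lower[OF _ nz(2)] True supp pos by simp
  next
    case False
    then have "4 * 2 ^ k \<le> (2 ^ n :: real)" using assms power_increasing[of "k + 2" n "2::real"] by simp
    then show False using fourier_K_support[OF nz(2)] supp pos by linarith
  qed
qed

lemma integrable_fourier_atom: "integrable lborel (fourier (atom n))"
proof (rule integrable_bounded_support[OF _ norm_fourier_le])
  show "fourier (atom n) \<in> borel_measurable borel"
    by (intro borel_measurable_fourier integrable_atom) simp
  show "norm \<xi> \<le> 17/16 * 2 ^ n" if "fourier (atom n) \<xi> \<noteq> 0" for \<xi>
    using fourier_atom_support(3)[OF that] by linarith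
qed

lemma integrable_fourier_atom_K: "integrable lborel (\<lambda>\<xi>. fourier (atom n) \<xi> * fourier (K k) \<xi>)"
proof (rule Bochner_Integration.integrable_bound)
  have [measurable]: "fourier (atom n) \<in> borel_measurable borel" "fourier (K k) \<in> borel_measurable borel" for k
    using borel_measurable_integrable[OF integrable_fourier_atom] borel_measurable_integrable[OF integrable_fourier_K]
    by simp_all
  show "integrable lborel (\<lambda>\<xi>. (LINT y|lborel. norm (K k y)) * norm (fourier (atom n) \<xi>))"
    by (intro integrable_mult_right integrable_norm integrable_fourier_atom)
  have "norm (fourier (atom n) \<xi>) * norm (fourier (K k) \<xi>) \<le> (LINT y|lborel. norm (K k y)) * norm (fourier (atom n) \<xi>)" for \<xi>
    using mult_left_mono[OF norm_fourier_le[of "K k" \<xi>], of "norm (fourier (atom n) \<xi>)"] by (simp add: mult.commute)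
  then show "AE \<xi> in lborel. norm (fourier (atom n) \<xi> * fourier (K k) \<xi>) \<le>
      norm ((LINT y|lborel. norm (K k y)) * norm (fourier (atom n) \<xi>))"
    by (intro AE_I2) (simp add: norm_mult order_trans[OF _ abs_ge_self])
  show "(\<lambda>\<xi>. fourier (atom n) \<xi> * fourier (K k) \<xi>) \<in> borel_measurable lborel" by measurable
qed

lemma borel_measurable_W: "W n k \<in> borel_measurable borel"
proof -
  \<comment> \<open>Up to a reflection \<open>W n k\<close> is the Fourier transform of an
    integrable function, which is continuous and therefore measurable.\<close>
  have "W n k = (\<lambda>x. fourier (\<lambda>\<xi>. fourier (atom n) \<xi> * fourier (K k) \<xi>) (- x))"
    unfolding W_fourier[abs_def] fourier_def[of "\<lambda>\<xi>. fourier (atom n) \<xi> * fourier (K k) \<xi>"]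
    by (simp add: mult.assoc inner_commute)
  then show ?thesis
    by (simp only:) (intro borel_measurable_fourier integrable_fourier_atom_K, measurable)
qed

lemma W_zero:
  assumes "n \<ge> 2" "\<not> (k \<le> n + 1 \<and> n \<le> k + 1)"
  shows "W n k x = 0"
  unfolding W_fourier mult.assoc[symmetric] by (simp only: fourier_atom_K_zero[OF assms]) simp

text \<open>The modulation takes the place of the bounded factor \<open>u\<close> in
  \<open>conv_dil_bound\<close>. If band \<open>k\<close> meets the atom, then
  \<open>r n \<le> n \<le> k + 1\<close>, which is the requirement
  \<open>t \<le> 2 * t'\<close>.\<close>

lemma W_bound:
  obtains C where "C > 0"
    "\<And>n k x. n \<ge> 2 \<Longrightarrow> norm (W n k x) \<le> C * (2 ^ r n) ^ CARD('n) / (1 + 2 ^ r n * norm (x - p n)) ^ M"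
proof -
  obtain C where C: "C > 0"
    "\<And>t t' x p u. \<lbrakk>0 < t; t \<le> 2 * t'; \<And>y. norm (u y) \<le> 1\<rbrakk> \<Longrightarrow>
       norm (LINT y|lborel. u y * dil t \<psi> (y - p) * dil t' \<phi> (x - y))
         \<le> C * t ^ DIM(real^'n) / (1 + t * norm (x - p)) ^ M"
    using conv_dil_bound[OF rapid_phi(1) rapid_psi] by blast
  have "norm (W n k x) \<le> C * (2 ^ r n) ^ CARD('n) / (1 + 2 ^ r n * norm (x - p n)) ^ M" if n: "n \<ge> 2" for n k x
  proof (cases "k \<le> n + 1 \<and> n \<le> k + 1")
    case True
    have "r n \<le> Suc k" using r_le[of n] True by linarith
    then have "(2::real) ^ r n \<le> 2 ^ Suc k" by (intro power_increasing) auto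
    moreover have "K k = dil (2 ^ k) \<phi>" using True n by (intro K_pos) linarith
    ultimately show ?thesis
      unfolding W_def atom_def profile_def
      using C(2)[of "2 ^ r n" "2 ^ k" "\<lambda>y. cis (2 * pi * ((2 ^ n *\<^sub>R e) \<bullet> y))" "p n" x] by simp
  next
    case False
    then show ?thesis using W_zero[OF n False] C(1) by simp
  qed
  with C(1) show ?thesis using that by blast
qed

lemma continuous_atom: "continuous_on UNIV (atom n)"
proof -
  have "continuous_on UNIV (dil (2 ^ r n) \<psi>)" using rapid_dil[OF rapid_psi, of "2 ^ r n"] by (simp add: rapid_def)
  moreover have "continuous_on UNIV (\<lambda>y. y - p n)" by (intro continuous_intros)
  ultimately have "continuous_on UNIV (\<lambda>y. dil (2 ^ r n) \<psi> (y - p n))" by (rule continuous_on_compose2) simp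
  then show ?thesis unfolding atom_def[abs_def] profile_def by (intro continuous_intros)
qed

text \<open>The spectrum may reach up to \<open>17/16 * 2 ^ n\<close>, slightly outside the ball of
  radius \<open>2 ^ n\<close>; the kernels up to \<open>N\<close> are guaranteed to sum to 1 on it
  from \<open>N = n + 1\<close> on.\<close>

lemma W_sum:
  assumes n: "n \<ge> 2" and N: "n + 1 \<le> N"
  shows "(\<Sum>k\<le>N. W n k x) = atom n x"
proof -
  obtain B where B: "\<And>x. norm (dil (2 ^ r n) \<psi> x) \<le> B"
    using rapid_bounded[OF rapid_dil[OF rapid_psi]] by (metis zero_less_numeral zero_less_power)
  have "integrable lborel (\<lambda>\<xi>. fourier (atom n) \<xi> * (fourier (K k) \<xi> * cis (2 * pi * (x \<bullet> \<xi>))))" for k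
    using fourier_integrand_integrable[OF integrable_fourier_atom_K, where t = "2 * pi" and \<xi> = x]
    by (simp add: inner_commute mult.assoc)
  then have "(\<Sum>k\<le>N. W n k x) =
      (LINT \<xi>|lborel. (\<Sum>k\<le>N. fourier (atom n) \<xi> * (fourier (K k) \<xi> * cis (2 * pi * (x \<bullet> \<xi>)))))"
    unfolding W_fourier by (intro Bochner_Integration.integral_sum[symmetric])
  also have "\<dots> = (LINT \<xi>|lborel. fourier (atom n) \<xi> * cis (2 * pi * (x \<bullet> \<xi>)))"
  proof (intro Bochner_Integration.integral_cong refl)
    fix \<xi>
    have "fourier (atom n) \<xi> * (\<Sum>k\<le>N. fourier (K k) \<xi>) = fourier (atom n) \<xi>"
    proof (cases "fourier (atom n) \<xi> = 0")
      case False
      note supp = fourier_atom_support(2,3)[OF False]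
      have "2 * 2 ^ n \<le> (2 ^ N :: real)" using N power_increasing[of "Suc n" N "2::real"] by simp
      then have "norm \<xi> \<le> 2 ^ N" using supp zero_less_power[of "2::real" n] by linarith
      moreover have "\<xi> \<noteq> 0" using supp zero_less_power[of "2::real" n] by auto
      ultimately show ?thesis by (simp add: fourier_Phi_partition)
    qed simp
    moreover have "(\<Sum>k\<le>N. fourier (atom n) \<xi> * (fourier (K k) \<xi> * cis (2 * pi * (x \<bullet> \<xi>)))) =
        fourier (atom n) \<xi> * (\<Sum>k\<le>N. fourier (K k) \<xi>) * cis (2 * pi * (x \<bullet> \<xi>))"
      by (simp add: sum_distrib_left sum_distrib_right mult.assoc)
    ultimately show "(\<Sum>k\<le>N. fourier (atom n) \<xi> * (fourier (K k) \<xi> * cis (2 * pi * (x \<bullet> \<xi>)))) =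
        fourier (atom n) \<xi> * cis (2 * pi * (x \<bullet> \<xi>))" by simp
  qed
  also have "\<dots> = atom n x"
    by (rule fourier_inversion[OF continuous_atom _ integrable_atom integrable_fourier_atom, of _ B])
       (use B in \<open>simp add: atom_def profile_def norm_mult\<close>)
  finally show ?thesis .
qed

text \<open>For fixed \<xi> the symbol is a multiple of a single exponential in \<open>x\<close> of
  frequency \<open>- 2 ^ i e\<close>. Convolution multiplies it by the transform of the kernel at
  that point of a dyadic sphere, which is exactly 0 or 1.\<close>

lemma conv_K_ching_symbol:
  "conv (K j) (\<lambda>y. ching_symbol e m (y, \<xi>)) x = (if j = 0 then 0 else symbol_term e m j (x, \<xi>))"
proof -
  obtain i U where i: "1 \<le> i" "\<And>w. w \<in> U \<Longrightarrow> ching_symbol e m w = symbol_term e m i w" "\<And>x. (x, \<xi>) \<in> U"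
    "\<And>j. 1 \<le> j \<Longrightarrow> j \<noteq> i \<Longrightarrow> bump e (\<xi> /\<^sub>R 2 ^ j) = 0"
    using ching_symbol_local[OF e, of "(0, \<xi>)" m] by (metis snd_conv)
  have [measurable]: "K j \<in> borel_measurable borel" by (rule borel_measurable_rapid[OF rapid_K])
  have shift: "symbol_term e m i (x - z, \<xi>) = symbol_term e m i (x, \<xi>) * cis (- 2 * pi * (z \<bullet> - (2 ^ i *\<^sub>R e)))" for z
  proof -
    have "cis (- (2 * pi) * ((2 ^ i *\<^sub>R (x - z)) \<bullet> e)) =
        cis (- (2 * pi) * ((2 ^ i *\<^sub>R x) \<bullet> e)) * cis (- 2 * pi * (z \<bullet> - (2 ^ i *\<^sub>R e)))"
      by (simp add: cis_mult inner_diff_left algebra_simps)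
    then show ?thesis by (simp add: symbol_term_def base_symbol_def mult.assoc)
  qed
  have "(\<lambda>y. symbol_term e m i (y, \<xi>)) \<in> borel_measurable borel"
    unfolding symbol_term_def base_symbol_def fst_conv snd_conv by measurable
  then have "(LINT y|lborel. K j (x - y) * symbol_term e m i (y, \<xi>)) = (LINT z|lborel. K j z * symbol_term e m i (x - z, \<xi>))"
    using integral_lborel_affine[of "\<lambda>y. K j (x - y) * symbol_term e m i (y, \<xi>)" "-1" x] by simp
  also have "\<dots> = symbol_term e m i (x, \<xi>) * fourier (K j) (- (2 ^ i *\<^sub>R e))"
    unfolding shift fourier_def by (simp add: mult.left_commute[of "K j _"])
  also have "fourier (K j) (- (2 ^ i *\<^sub>R e)) = (if j = i then 1 else 0)"
    using i(1) e by (intro fourier_K_dyadic_sphere) auto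
  finally have "conv (K j) (\<lambda>y. ching_symbol e m (y, \<xi>)) x = symbol_term e m i (x, \<xi>) * (if j = i then 1 else 0)"
    unfolding conv_def using i by simp
  moreover have "symbol_term e m j (x, \<xi>) = 0" if "j \<noteq> i" "j \<noteq> 0"
    using i(4)[of j] that by (simp add: symbol_term_def base_symbol_def)
  ultimately show ?thesis using i(1) by auto
qed

text \<open>\<open>F.pair\<close> is the input distribution; \<open>U.pair\<close> below turns out
  to be its image under the operator, see \<open>psido_ching\<close>.\<close>

sublocale F: weighted_series atom "\<lambda>n. 2 powr (- m * real n) * D n" "\<lambda>n. 2 ^ r n" p "\<lambda>z. norm (\<psi> z)"
proof
  show "integrable lborel (\<lambda>z. (1 + norm z) * norm (\<psi> z))"
    using rapid_weight_integrable[OF rapid_psi, of 1] by simp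
  show "(\<lambda>z. norm (\<psi> z)) \<in> borel_measurable borel"
    using borel_measurable_rapid[OF rapid_psi] by measurable
  show "atom n \<in> borel_measurable borel" for n
    by (rule integrable_lborel_measurable[OF integrable_atom])
  show "norm (atom n x) \<le> (2 ^ r n) ^ DIM(real^'n) * norm (\<psi> (2 ^ r n *\<^sub>R (x - p n)))" for n x
    by (simp add: atom_def norm_mult norm_profile)
qed (use D_summable_m in auto)

sublocale U: weighted_series profile D "\<lambda>n. 2 ^ r n" p "\<lambda>z. norm (\<psi> z)"
proof
  show "profile n \<in> borel_measurable borel" for n
    by (rule integrable_lborel_measurable[OF integrable_profile])
qed (use D_summable F.w in \<open>auto simp: norm_profile\<close>)

text \<open>The functional is a series, so its value at a Fourier transform is computed term by term
  with the multiplication formula. The cutoff of index \<open>j\<close> keeps only the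
  \<open>j\<close>-th atom, and \<open>2 powr (m * j)\<close> cancels the input factor.\<close>

lemma psido_compact_ching:
  "psido_compact (symbol_piece \<phi> \<Phi> (ching_symbol e m) j k) F.pair x =
     D j *\<^sub>R (cis (- 2 * pi * ((2 ^ j *\<^sub>R e) \<bullet> x)) * W j k x)"
proof (cases "j = 0")
  case True
  then have "symbol_piece \<phi> \<Phi> (ching_symbol e m) j k (x, \<xi>) = 0" for \<xi>
    using conv_K_ching_symbol[of 0] by (simp add: symbol_piece_def K_def)
  \<comment> \<open>The piece with \<open>j = 0\<close> is zero, and the right-hand side agrees
    because \<open>D 0 = 0\<close>.\<close>
  then show ?thesis
    using True D_0[of 0] unfolding psido_compact_def fourier_dist_def fourier_def[abs_def] F.pair_def by simp
next
  case False
  define a where "a = complex_of_real (2 powr (m * real j)) * cis (- 2 * pi * ((2 ^ j *\<^sub>R e) \<bullet> x))"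
  define G where "G = (\<lambda>\<xi>. a * (complex_of_real (bump e (\<xi> /\<^sub>R 2 ^ j)) * (fourier (K k) \<xi> * cis (2 * pi * (x \<bullet> \<xi>)))))"
  have [measurable]: "fourier (K k) \<in> borel_measurable borel"
    by (rule integrable_lborel_measurable[OF integrable_fourier_K])
  have "integrable lborel (\<lambda>\<xi>. complex_of_real (bump e (\<xi> /\<^sub>R 2 ^ j)) * (fourier (K k) \<xi> * cis (2 * pi * (x \<bullet> \<xi>))))"
    by (rule Bochner_Integration.integrable_bound[OF integrable_fourier_K[of k]])
       (auto simp: norm_mult bump_bounds intro!: AE_I2 mult_left_le_one_le)
  then have G: "integrable lborel G" unfolding G_def by simp
  have piece: "symbol_piece \<phi> \<Phi> (ching_symbol e m) j k (x, \<xi>) * cis (2 * pi * (x \<bullet> \<xi>)) = G \<xi>" for \<xi>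
    using False conv_K_ching_symbol[of j \<xi> x]
    by (simp add: symbol_piece_def K_def[symmetric] G_def a_def symbol_term_def base_symbol_def inner_commute)
  have pair: "(LINT y|lborel. atom n y * fourier G y) = (if n = j then a * W j k x else 0)" for n
  proof -
    have "(LINT y|lborel. atom n y * fourier G y) = (LINT \<xi>|lborel. fourier (atom n) \<xi> * G \<xi>)"
      by (rule fourier_multiplication_formula[OF integrable_atom G])
    also have "\<dots> = (LINT \<xi>|lborel. a * ((if j = n then fourier (atom n) \<xi> else 0) * (fourier (K k) \<xi> * cis (2 * pi * (x \<bullet> \<xi>)))))"
      unfolding bump_fourier_atom[symmetric] G_def
      by (intro Bochner_Integration.integral_cong refl) (simp only: mult_ac)
    also have "\<dots> = (if n = j then a * W j k x else 0)"
      by (simp add: W_fourier)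
    finally show ?thesis .
  qed
  have "psido_compact (symbol_piece \<phi> \<Phi> (ching_symbol e m) j k) F.pair x = F.pair (fourier G)"
    unfolding psido_compact_def fourier_dist_def piece ..
  also have "\<dots> = (\<Sum>n. (2 powr (- m * real n) * D n) *\<^sub>R (if n = j then a * W j k x else 0))"
    unfolding F.pair_def pair ..
  also have "\<dots> = (\<Sum>n\<in>{j}. (2 powr (- m * real n) * D n) *\<^sub>R (if n = j then a * W j k x else 0))"
    by (rule suminf_finite) auto
  also have "\<dots> = D j *\<^sub>R (2 powr (- m * real j) *\<^sub>R (a * W j k x))" by (simp add: mult.commute)
  also have "2 powr (- m * real j) *\<^sub>R (a * W j k x) =
      complex_of_real (2 powr (- m * real j) * 2 powr (m * real j)) * (cis (- 2 * pi * ((2 ^ j *\<^sub>R e) \<bullet> x)) * W j k x)"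
    by (simp add: a_def scaleR_conv_of_real)
  also have "2 powr (- m * real j) * 2 powr (m * real j) = 1" by (simp add: powr_add[symmetric])
  finally show ?thesis by simp
qed

definition demodulate :: "nat \<Rightarrow> real^'n \<Rightarrow> complex" where
  "demodulate n x = cis (- 2 * pi * ((2 ^ n *\<^sub>R e) \<bullet> x))"

lemma demodulate_atom: "demodulate n x * atom n x = profile n x"
  by (simp add: demodulate_def atom_def cis_mult mult.assoc[symmetric])

lemma norm_demodulate: "norm (demodulate n x) = 1"
  by (simp add: demodulate_def)

lemma borel_measurable_demodulate: "demodulate n \<in> borel_measurable borel"
  unfolding demodulate_def[abs_def] by measurable

text \<open>The partial sums with upper limit \<open>n\<close> miss one frequency band of the \<open>n\<close>-th atom.\<close>

definition tail_error :: "nat \<Rightarrow> real^'n \<Rightarrow> complex" where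
  "tail_error n x = (if n < 2 then 0 else demodulate n x * W n (Suc n) x)"

lemma
  assumes "weakly_decaying g"
  shows tail_error_tendsto_0: "(\<lambda>n. D n *\<^sub>R (LINT x|lborel. tail_error n x * g x)) \<longlonglongrightarrow> 0"
    and integrable_demodulate_W: "n \<ge> 2 \<Longrightarrow> integrable lborel (\<lambda>x. demodulate n x * W n k x * g x)"
proof -
  \<comment> \<open>\<open>CARD('n) + 1\<close> powers for integrability and one more for the first
    moment required of \<open>w\<close>.\<close>
  define M where "M = CARD('n) + 2"
  obtain C where C: "C > 0"
    "\<And>n k x. n \<ge> 2 \<Longrightarrow> norm (W n k x) \<le> C * (2 ^ r n) ^ CARD('n) / (1 + 2 ^ r n * norm (x - p n)) ^ M"
    using W_bound[where M = M] by blast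
  define w where "w = (\<lambda>z::real^'n. C / (1 + norm z) ^ M)"
  have [measurable]: "w \<in> borel_measurable borel" by (simp add: w_def)
  have "(1 + norm z) * w z = C * (1 / (1 + norm z) ^ (CARD('n) + 1))" for z
  proof -
    have "a * (C / a ^ (CARD('n) + 2)) = C * (1 / a ^ (CARD('n) + 1))" if "a > 0" for a :: real
      using that by simp
    from this[of "1 + norm z"] show ?thesis by (simp add: w_def M_def add_pos_nonneg)
  qed
  then have w: "integrable lborel (\<lambda>z. (1 + norm z) * w z)"
    using integrable_mult_right[OF integrable_inverse_power[where 'a = "real^'n"], of C] by (simp del: power_Suc)
  have w0: "w z \<ge> 0" for z using C(1) by (simp add: w_def)
  have bound: "norm (demodulate n x * W n k x) \<le> (2 ^ r n) ^ DIM(real^'n) * w (2 ^ r n *\<^sub>R (x - p n))" if "n \<ge> 2" for n k x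
    using C(2)[OF that, of k x] by (simp add: norm_mult norm_demodulate w_def mult.commute)
  interpret E: weighted_series tail_error D "\<lambda>n. 2 ^ r n" p w
  proof
    show "tail_error n \<in> borel_measurable borel" for n
      unfolding tail_error_def[abs_def]
      using borel_measurable_W borel_measurable_demodulate by (cases "n < 2") simp_all
    show "norm (tail_error n x) \<le> (2 ^ r n) ^ DIM(real^'n) * w (2 ^ r n *\<^sub>R (x - p n))" for n x
      using bound[of n x "Suc n"] w0 by (simp add: tail_error_def)
  qed (use w w0 D_summable in auto)
  show "(\<lambda>n. D n *\<^sub>R (LINT x|lborel. tail_error n x * g x)) \<longlonglongrightarrow> 0"
    by (rule E.terms_tendsto_0[OF assms])
  assume n: "n \<ge> 2"
  \<comment> \<open>The coefficients are zero: only the integrability of a single term against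
    \<open>g\<close> is wanted.\<close>
  interpret B: weighted_series "\<lambda>_ x. demodulate n x * W n k x" "\<lambda>_. 0" "\<lambda>_. 2 ^ r n" "\<lambda>_. p n" w
  proof
    show "(\<lambda>x. demodulate n x * W n k x) \<in> borel_measurable borel"
      using borel_measurable_W borel_measurable_demodulate by simp
  qed (use w w0 bound[OF n] in auto)
  show "integrable lborel (\<lambda>x. demodulate n x * W n k x * g x)"
    by (rule B.integrable_A_mult[OF assms])
qed

abbreviation "ching_image \<equiv> psido \<phi> \<Phi> (ching_symbol e m) F.pair"

text \<open>After summation over \<open>k\<close>, an atom with \<open>n < N\<close> has all its
  bands and merely loses its modulation; the atom \<open>n = N\<close> lacks the band
  \<open>N + 1\<close>, whence the correction.\<close>

lemma psido_partial_ching: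
  assumes g: "weakly_decaying g"
  shows "psido_partial \<phi> \<Phi> (ching_symbol e m) F.pair N g =
    (\<Sum>n\<le>N. D n *\<^sub>R (LINT x|lborel. profile n x * g x)) - D N *\<^sub>R (LINT x|lborel. tail_error N x * g x)"
proof -
  define I where "I = (\<lambda>n. \<Sum>k\<le>N. D n *\<^sub>R (LINT x|lborel. demodulate n x * W n k x * g x))"
  have I: "I n = D n *\<^sub>R (LINT x|lborel. profile n x * g x) - (if n = N then D N *\<^sub>R (LINT x|lborel. tail_error N x * g x) else 0)"
    if nN: "n \<le> N" for n
  proof (cases "n < 2")
    case True
    then show ?thesis by (simp add: I_def D_0)
  next
    case False
    then have n: "n \<ge> 2" by simp
    note int = integrable_demodulate_W[OF g n]
    have full: "(\<Sum>k\<le>Suc M. LINT x|lborel. demodulate n x * W n k x * g x) = (LINT x|lborel. profile n x * g x)"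
      if "n \<le> M" for M
    proof -
      have "(\<Sum>k\<le>Suc M. LINT x|lborel. demodulate n x * W n k x * g x) =
          (LINT x|lborel. (\<Sum>k\<le>Suc M. demodulate n x * W n k x * g x))"
        by (rule Bochner_Integration.integral_sum[symmetric]) (rule int)
      also have "\<dots> = (LINT x|lborel. demodulate n x * (\<Sum>k\<le>Suc M. W n k x) * g x)"
        by (intro Bochner_Integration.integral_cong refl) (simp only: sum_distrib_left sum_distrib_right)
      also have "\<dots> = (LINT x|lborel. profile n x * g x)"
        using W_sum[OF n, of "Suc M"] that by (simp only: demodulate_atom)
      finally show ?thesis .
    qed
    show ?thesis
    proof (cases "n = N")
      case True
      have "(\<Sum>k\<le>N. LINT x|lborel. demodulate n x * W n k x * g x) =
          (LINT x|lborel. profile n x * g x) - (LINT x|lborel. tail_error N x * g x)"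
        using full[of N] nN True n by (simp add: tail_error_def algebra_simps)
      then show ?thesis using True by (simp add: I_def scaleR_sum_right[symmetric] scaleR_diff_right)
    next
      case False
      then obtain M where M: "N = Suc M" "n \<le> M" using nN by (cases N) auto
      then show ?thesis using full[OF M(2)] False by (simp add: I_def scaleR_sum_right[symmetric] del: sum.atMost_Suc)
    qed
  qed
  have "psido_partial \<phi> \<Phi> (ching_symbol e m) F.pair N g = (\<Sum>k\<le>N. \<Sum>n\<le>N. D n *\<^sub>R (LINT x|lborel. demodulate n x * W n k x * g x))"
    unfolding psido_partial_def function_dist_def psido_compact_ching demodulate_def by (simp add: mult.assoc)
  also have "\<dots> = (\<Sum>n\<le>N. I n)" unfolding I_def by (rule sum.swap)
  also have "\<dots> = (\<Sum>n\<le>N. D n *\<^sub>R (LINT x|lborel. profile n x * g x) -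
      (if n = N then D N *\<^sub>R (LINT x|lborel. tail_error N x * g x) else 0))"
    using I by (intro sum.cong) auto
  also have "\<dots> = (\<Sum>n\<le>N. D n *\<^sub>R (LINT x|lborel. profile n x * g x)) - D N *\<^sub>R (LINT x|lborel. tail_error N x * g x)"
    by (simp add: sum_subtractf)
  finally show ?thesis .
qed

lemma psido_partial_tendsto:
  assumes g: "weakly_decaying g"
  shows "(\<lambda>N. psido_partial \<phi> \<Phi> (ching_symbol e m) F.pair N g) \<longlonglongrightarrow> U.pair g"
proof -
  have "(\<lambda>N. \<Sum>n\<le>N. D n *\<^sub>R (LINT x|lborel. profile n x * g x)) \<longlonglongrightarrow> U.pair g"
    unfolding U.pair_def by (rule summable_LIMSEQ'[OF U.summable_terms[OF g]])
  from tendsto_diff[OF this tail_error_tendsto_0[OF g]] show ?thesis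
    unfolding psido_partial_ching[OF g] by simp
qed

lemma psido_converges_ching: "psido_converges \<phi> \<Phi> (ching_symbol e m) F.pair"
  unfolding psido_converges_def tempered_tendsto_def
  using U.tempered_pair psido_partial_tendsto rapid_weakly_decaying schwartz_rapid by blast

lemma psido_ching:
  assumes "weakly_decaying g"
  shows "psido \<phi> \<Phi> (ching_symbol e m) F.pair g = U.pair g"
  unfolding psido_def by (rule limI[OF psido_partial_tendsto[OF assms]])

lemma LP_input: "LP \<phi> \<Phi> k F.pair x = (\<Sum>n. (2 powr (- m * real n) * D n) *\<^sub>R W n k x)"
  unfolding LP_def conv_dist_def F.pair_def W_def K_def ..

lemma LP_output:
  "LP \<phi> \<Phi> k ching_image x = (\<Sum>n. D n *\<^sub>R (LINT y|lborel. profile n y * K k (x - y)))"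
proof -
  have "weakly_decaying (\<lambda>y. K k (x - y))" by (rule rapid_reflect_weakly_decaying[OF rapid_K])
  from psido_ching[OF this] show ?thesis
    unfolding LP_def conv_dist_def U.pair_def K_def by simp
qed

end

section \<open>Norms over dyadic cubes\<close>

lemma ennpowr_mono:
  assumes "x \<le> y" "0 \<le> a" shows "ennpowr x a \<le> ennpowr y a"
proof (cases "y = \<infinity>")
  case False
  then have "x < \<infinity>" "y < \<infinity>" using assms(1) by (auto simp: less_top intro: le_less_trans)
  then have "enn2real x \<le> enn2real y" using assms(1) by (simp add: enn2real_mono)
  then show ?thesis using False \<open>x < \<infinity>\<close> assms(2)
    by (auto simp: ennpowr_def intro!: ennreal_leI powr_mono2)
qed (simp add: ennpowr_def)

lemma dyadic_cube_emeasure: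
  fixes R :: "(real^'n) set"
  assumes "R \<in> dyadic_cubes \<mu>"
  shows "R \<in> sets borel" "emeasure lborel R = ennreal ((1 / 2 ^ \<mu>) ^ CARD('n))"
proof -
  obtain l :: "'n \<Rightarrow> int" where R: "R = {x. \<forall>i. of_int (l i) / 2 ^ \<mu> \<le> x $ i \<and> x $ i < (of_int (l i) + 1) / 2 ^ \<mu>}"
    using assms by (auto simp: dyadic_cubes_def)
  define a b :: "real^'n" where "a = (\<chi> i. of_int (l i) / 2 ^ \<mu>)" and "b = (\<chi> i. (of_int (l i) + 1) / 2 ^ \<mu>)"
  have "R = (\<Inter>i\<in>UNIV. {x. a $ i \<le> x $ i} \<inter> {x. x $ i < b $ i})"
    by (auto simp: R a_def b_def)
  moreover have "{x :: real^'n. a $ i \<le> x $ i} \<inter> {x. x $ i < b $ i} \<in> sets borel" for i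
    by (intro sets.Int borel_closed borel_open closed_Collect_le open_Collect_less continuous_intros)
  ultimately show R_sets: "R \<in> sets borel" by (simp only:) (intro sets.finite_INT, auto)
  have ab: "a \<bullet> i \<le> b \<bullet> i" "(b - a) \<bullet> i = 1 / 2 ^ \<mu>" if "i \<in> Basis" for i
    using that by (auto simp: Basis_vec_def inner_axis a_def b_def field_simps)
  then have "(\<Prod>i\<in>Basis. (b - a) \<bullet> i) = (1 / 2 ^ \<mu>) ^ CARD('n)" by simp
  then have vol: "emeasure lborel (box a b) = ennreal ((1 / 2 ^ \<mu>) ^ CARD('n))"
      "emeasure lborel (cbox a b) = ennreal ((1 / 2 ^ \<mu>) ^ CARD('n))"
    using ab(1) by (simp_all only: emeasure_lborel_box emeasure_lborel_cbox)
  have "box a b \<subseteq> R" "R \<subseteq> cbox a b" by (auto simp: R mem_box_cart a_def b_def less_imp_le)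
  then have "emeasure lborel (box a b) \<le> emeasure lborel R" "emeasure lborel R \<le> emeasure lborel (cbox a b)"
    using R_sets by (auto intro!: emeasure_mono)
  with vol show "emeasure lborel R = ennreal ((1 / 2 ^ \<mu>) ^ CARD('n))" by simp
qed

text \<open>An integer multiple of a unit vector plus half the diagonal of a cube of side
  \<open>1 / 2 ^ \<mu>\<close> is the midpoint of a dyadic cube, so the whole inscribed ball is
  available. The centres of the bumps will have this form.\<close>

lemma dyadic_cube_containing_ball:
  fixes i0 :: "'n::finite" and N \<mu> :: nat
  defines "c \<equiv> real N *\<^sub>R axis i0 1 + (\<chi> i. 1 / 2 ^ Suc \<mu>) :: real^'n"
  obtains R where "R \<in> dyadic_cubes \<mu>" "ball c (1 / 2 ^ Suc \<mu>) \<subseteq> R"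
proof -
  define l :: "'n \<Rightarrow> int" where "l i = (if i = i0 then int N * 2 ^ \<mu> else 0)" for i
  define R where "R = {x::real^'n. \<forall>i. of_int (l i) / 2 ^ \<mu> \<le> x $ i \<and> x $ i < (of_int (l i) + 1) / 2 ^ \<mu>}"
  have c: "c $ i = of_int (l i) / 2 ^ \<mu> + 1 / 2 ^ Suc \<mu>" for i
    by (simp add: c_def l_def axis_def)
  have "x \<in> R" if "x \<in> ball c (1 / 2 ^ Suc \<mu>)" for x
  proof -
    have "\<bar>x $ i - c $ i\<bar> < 1 / 2 ^ Suc \<mu>" for i
      using that component_le_norm_cart[of "x - c" i] by (simp add: dist_norm norm_minus_commute)
    moreover have "1 / 2 ^ Suc \<mu> + 1 / 2 ^ Suc \<mu> = 1 / (2::real) ^ \<mu>" by simp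
    ultimately have "of_int (l i) / 2 ^ \<mu> \<le> x $ i \<and> x $ i < of_int (l i) / 2 ^ \<mu> + 1 / 2 ^ \<mu>" for i
      unfolding c by (smt (verit))
    then show ?thesis by (simp add: R_def add_divide_distrib)
  qed
  moreover have "R \<in> dyadic_cubes \<mu>" by (auto simp: R_def dyadic_cubes_def)
  ultimately show ?thesis using that by blast
qed

lemma set_nn_integral_le: "(\<integral>\<^sup>+x\<in>R. f x \<partial>M) \<le> (\<integral>\<^sup>+x. f x \<partial>M)"
  by (intro nn_integral_mono) (simp split: split_indicator)

lemma ennpowr_divide_finite:
  assumes "x < \<infinity>" "v > 0" shows "ennpowr (x / ennreal v) a < \<infinity>"
  using assms by (cases x) (auto simp: divide_ennreal ennpowr_def)

text \<open>All cubes of one generation have the same volume, so a bound for the integral over the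
  whole space bounds every mean.\<close>

lemma cube_norm_finite:
  fixes F :: "nat \<Rightarrow> real^'n \<Rightarrow> complex"
  assumes q: "q > 0"
    and fin: "(\<integral>\<^sup>+x. (\<Sum>k. ennreal (2 powr (s * real (\<mu> + k) * q) * norm (F (\<mu> + k) x) powr q)) \<partial>lborel) < \<infinity>"
  shows "cube_norm s q \<mu> F < \<infinity>"
proof -
  let ?f = "\<lambda>x. \<Sum>k. ennreal (2 powr (s * real (\<mu> + k) * q) * norm (F (\<mu> + k) x) powr q)"
  let ?v = "ennreal ((1 / 2 ^ \<mu>) ^ CARD('n))"
  have "cube_norm s q \<mu> F \<le> ennpowr ((\<integral>\<^sup>+x. ?f x \<partial>lborel) / ?v) (1 / q)"
    unfolding cube_norm_def
  proof (rule SUP_least)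
    fix R :: "(real^'n) set" assume R: "R \<in> dyadic_cubes \<mu>"
    show "ennpowr ((\<integral>\<^sup>+x\<in>R. ?f x \<partial>lborel) / emeasure lborel R) (1 / q) \<le> ennpowr ((\<integral>\<^sup>+x. ?f x \<partial>lborel) / ?v) (1 / q)"
      unfolding dyadic_cube_emeasure(2)[OF R]
      by (rule ennpowr_mono[OF divide_right_mono_ennreal[OF set_nn_integral_le]]) (use q in simp)
  qed
  also have "\<dots> < \<infinity>" by (rule ennpowr_divide_finite[OF fin]) simp
  finally show ?thesis .
qed

text \<open>Cubes have volume at most 1, so means dominate integrals and it is enough that the local
  integrals are unbounded.\<close>

lemma cube_norm_infinite:
  fixes F :: "nat \<Rightarrow> real^'n \<Rightarrow> complex"
  assumes q: "q > 0"
    and inf: "\<And>T::real. \<exists>R\<in>dyadic_cubes \<mu>. ennreal T \<le>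
        (\<integral>\<^sup>+x\<in>R. (\<Sum>k. ennreal (2 powr (s * real (\<mu> + k) * q) * norm (F (\<mu> + k) x) powr q)) \<partial>lborel)"
  shows "cube_norm s q \<mu> F = \<infinity>"
proof (rule ccontr)
  assume "cube_norm s q \<mu> F \<noteq> \<infinity>"
  then obtain B where B: "cube_norm s q \<mu> F = ennreal B" "B \<ge> 0" by (cases "cube_norm s q \<mu> F") auto
  \<comment> \<open>The \<open>q\<close>-th root of \<open>T\<close> is \<open>B + 1\<close>, beyond
    the assumed supremum.\<close>
  define T where "T = (B + 1) powr q"
  let ?f = "\<lambda>x. \<Sum>k. ennreal (2 powr (s * real (\<mu> + k) * q) * norm (F (\<mu> + k) x) powr q)"
  obtain R where R: "R \<in> dyadic_cubes \<mu>" "ennreal T \<le> (\<integral>\<^sup>+x\<in>R. ?f x \<partial>lborel)" using inf[of T] by (elim bexE)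
  define v where "v = (1 / (2::real) ^ \<mu>) ^ CARD('n)"
  have v: "0 < v" "v \<le> 1" by (auto simp: v_def intro!: power_le_one)
  have "T \<le> T / v" using v by (simp add: T_def le_divide_eq mult_left_le)
  then have "ennreal T \<le> ennreal T / ennreal v" using v by (simp add: divide_ennreal T_def ennreal_leI)
  also have "\<dots> \<le> (\<integral>\<^sup>+x\<in>R. ?f x \<partial>lborel) / emeasure lborel R"
    unfolding dyadic_cube_emeasure(2)[OF R(1)] v_def by (rule divide_right_mono_ennreal[OF R(2)])
  finally have "ennpowr (ennreal T) (1 / q) \<le> ennpowr ((\<integral>\<^sup>+x\<in>R. ?f x \<partial>lborel) / emeasure lborel R) (1 / q)"
    by (rule ennpowr_mono) (use q in simp)
  also have "\<dots> \<le> cube_norm s q \<mu> F"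
    unfolding cube_norm_def by (intro SUP_upper R(1))
  finally have "ennpowr (ennreal T) (1 / q) \<le> ennreal B" using B by simp
  moreover have "ennpowr (ennreal T) (1 / q) = ennreal (B + 1)"
    using B(2) q by (simp add: ennpowr_def T_def powr_powr)
  ultimately show False using B(2) by simp
qed

text \<open>Comparison with the largest of the three summands works for every positive exponent,
  also where \<open>x powr q\<close> is not convex.\<close>

lemma add_powr_le:
  fixes a b c q :: real
  assumes "a \<ge> 0" "b \<ge> 0" "c \<ge> 0" "q > 0"
  shows "(a + b + c) powr q \<le> 3 powr q * (a powr q + b powr q + c powr q)"
proof -
  define M where "M = max a (max b c)"
  have "(a + b + c) powr q \<le> (3 * M) powr q"
    using assms by (intro powr_mono2) (auto simp: M_def)
  also have "\<dots> = 3 powr q * M powr q" using assms by (simp add: powr_mult M_def)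
  also have "M powr q \<le> a powr q + b powr q + c powr q"
    using assms powr_ge_zero[of a q] powr_ge_zero[of b q] powr_ge_zero[of c q]
    unfolding M_def max_def by (simp split: if_splits)
  finally show ?thesis by simp
qed

lemma suminf_ennreal_shift_le: "(\<Sum>j. f (j + i)) \<le> (suminf f :: ennreal)"
  using suminf_offset[of f i] by simp

section \<open>Norm of the input and lower bounds for its image\<close>

context ching_atoms begin

lemma LP_input_eq:
  assumes "k \<ge> 1"
  shows "LP \<phi> \<Phi> k F.pair x = (\<Sum>n\<in>{k - 1, k, k + 1}. (2 powr (- m * real n) * D n) *\<^sub>R W n k x)"
  unfolding LP_input
proof (rule suminf_finite)
  fix n assume n: "n \<notin> {k - 1, k, k + 1}"
  show "(2 powr (- m * real n) * D n) *\<^sub>R W n k x = 0"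
  proof (cases "n < 2")
    case False
    then have "W n k x = 0" using n assms by (intro W_zero) auto
    then show ?thesis by simp
  qed (simp add: D_0)
qed simp

lemma LP_input_low:
  assumes "\<And>n. n \<le> k + 1 \<Longrightarrow> D n = 0"
  shows "LP \<phi> \<Phi> k F.pair x = 0"
proof -
  have "(2 powr (- m * real n) * D n) *\<^sub>R W n k x = 0" for n
  proof (cases "n \<le> k + 1")
    case False
    then have "n < 2 \<or> W n k x = 0" by (cases "n < 2") (auto intro: W_zero)
    then show ?thesis using D_0 by auto
  qed (simp add: assms)
  then show ?thesis unfolding LP_input by (simp only: suminf_zero)
qed

text \<open>Each band meets three atoms and each atom three bands, so the norm is controlled by one
  series of integrals over the whole space. For \<open>k\<close> within 1 of \<open>n\<close> the
  weight \<open>2 powr ((s + m) * k)\<close> is \<open>2 powr ((s + m) * n)\<close> up to a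
  constant, and the factor \<open>2 powr (- m * n)\<close> of the input leaves
  \<open>2 powr (s * n)\<close>.\<close>

lemma input_norm_finite:
  assumes q: "q > 0" and \<mu>: "\<mu> \<ge> 1"
    and sum: "summable (\<lambda>n. (2 powr (s * real n) * \<bar>D n\<bar> * 2 powr (real (r n) * real CARD('n) * (1 - 1 / q))) powr q)"
  shows "cube_norm (s + m) q \<mu> (\<lambda>k. LP \<phi> \<Phi> k F.pair) < \<infinity>"
proof (rule cube_norm_finite[OF q])
  \<comment> \<open>With this \<open>M\<close> the \<open>q\<close>-th power of the decay in
    \<open>W_bound\<close> is integrable, also for small \<open>q\<close>.\<close>
  obtain M :: nat where "real (CARD('n) + 1) / q \<le> real M" using real_arch_simple by blast
  then have Mq: "real M * q \<ge> real (DIM(real^'n) + 1)" using q by (simp add: field_simps)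
  obtain C where C: "C > 0"
    "\<And>n k x. n \<ge> 2 \<Longrightarrow> norm (W n k x) \<le> C * (2 ^ r n) ^ CARD('n) / (1 + 2 ^ r n * norm (x - p n)) ^ M"
    using W_bound[where M = M] by blast
  define h where "h = (\<lambda>n x. C * (2 ^ r n) ^ CARD('n) / (1 + 2 ^ r n * norm (x - p n)) ^ M)"
  have h0: "h n x \<ge> 0" for n x unfolding h_def using C(1) by simp
  define a where "a = (\<lambda>n. 3 powr q * 2 powr (\<bar>s + m\<bar> * q) * (2 powr (s * real n) * \<bar>D n\<bar>) powr q)"
  define T where "T = (\<lambda>n x. ennreal (a n * h n x powr q))"
  have T_meas [measurable]: "T n \<in> borel_measurable borel" for n
    unfolding T_def h_def by measurable
  have bound: "ennreal (2 powr ((s + m) * real k * q) * norm (LP \<phi> \<Phi> k F.pair x) powr q) \<le> T (k - 1) x + T k x + T (k + 1) x"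
    if k: "k \<ge> 1" for k x
  proof -
    define b where "b = (\<lambda>n. 2 powr (- m * real n) * \<bar>D n\<bar> * h n x)"
    have b0: "b n \<ge> 0" for n by (simp add: b_def h0)
    have Wb: "norm ((2 powr (- m * real n) * D n) *\<^sub>R W n k x) \<le> b n" for n
    proof (cases "n < 2")
      case False
      then have "norm (W n k x) \<le> h n x" unfolding h_def by (intro C) simp
      then show ?thesis by (simp add: b_def abs_mult mult_left_mono)
    qed (simp add: D_0 b_def)
    have "norm (LP \<phi> \<Phi> k F.pair x) \<le> (\<Sum>n\<in>{k - 1, k, k + 1}. b n)"
      unfolding LP_input_eq[OF k] by (rule order_trans[OF norm_sum sum_mono]) (rule Wb)
    also have "\<dots> = b (k - 1) + b k + b (k + 1)" using k by (cases k) simp_all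
    finally have "norm (LP \<phi> \<Phi> k F.pair x) powr q \<le> (b (k - 1) + b k + b (k + 1)) powr q"
      using q by (intro powr_mono2) auto
    also have "\<dots> \<le> 3 powr q * (b (k - 1) powr q + b k powr q + b (k + 1) powr q)"
      by (rule add_powr_le[OF b0 b0 b0 q])
    finally have le: "2 powr ((s + m) * real k * q) * norm (LP \<phi> \<Phi> k F.pair x) powr q \<le>
        2 powr ((s + m) * real k * q) * (3 powr q * (b (k - 1) powr q + b k powr q + b (k + 1) powr q))"
      by (intro mult_left_mono) auto
    have term_le: "2 powr ((s + m) * real k * q) * (3 powr q * b n powr q) \<le> a n * h n x powr q"
      if n: "\<bar>real k - real n\<bar> \<le> 1" for n
    proof -
      have "(s + m) * (real k - real n) \<le> \<bar>s + m\<bar> * 1"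
        by (rule order_trans[OF abs_ge_self]) (simp only: abs_mult mult_left_mono[OF n abs_ge_zero])
      then have "2 powr ((s + m) * real k) \<le> 2 powr (\<bar>s + m\<bar> + (s + m) * real n)"
        by (intro powr_mono) (auto simp: algebra_simps)
      then have "(2 powr ((s + m) * real k)) powr q \<le> (2 powr \<bar>s + m\<bar> * 2 powr ((s + m) * real n)) powr q"
        using q by (intro powr_mono2) (auto simp: powr_add)
      then have "(2 powr ((s + m) * real k)) powr q * (3 powr q * b n powr q) \<le>
          (2 powr \<bar>s + m\<bar> * 2 powr ((s + m) * real n)) powr q * (3 powr q * b n powr q)"
        by (intro mult_right_mono) auto
      also have "\<dots> = 3 powr q * (2 powr \<bar>s + m\<bar>) powr q * (2 powr ((s + m) * real n) * b n) powr q"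
        using b0 by (simp add: powr_mult)
      also have "2 powr ((s + m) * real n) * b n = (2 powr (s * real n) * \<bar>D n\<bar>) * h n x"
      proof -
        have "2 powr ((s + m) * real n) * 2 powr (- m * real n) = 2 powr (s * real n)"
          by (simp add: powr_add[symmetric] algebra_simps)
        then show ?thesis by (simp add: b_def mult.assoc[symmetric])
      qed
      also have "\<dots> powr q = (2 powr (s * real n) * \<bar>D n\<bar>) powr q * h n x powr q"
        using h0 by (simp add: powr_mult)
      finally show ?thesis by (simp add: a_def powr_powr mult.assoc)
    qed
    have "2 powr ((s + m) * real k * q) * norm (LP \<phi> \<Phi> k F.pair x) powr q \<le>
       a (k - 1) * h (k - 1) x powr q + a k * h k x powr q + a (k + 1) * h (k + 1) x powr q"
      using le term_le[of "k - 1"] term_le[of k] term_le[of "k + 1"] k by (simp add: algebra_simps)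
    moreover have "a n * h n x powr q \<ge> 0" for n by (simp add: a_def)
    ultimately show ?thesis unfolding T_def
      by (simp add: ennreal_leI flip: ennreal_plus)
  qed
  have Tint: "(\<integral>\<^sup>+x. (\<Sum>n. T n x) \<partial>lborel) < \<infinity>"
  proof -
    define I where "I = (\<integral>\<^sup>+x. ennreal ((1 / (1 + norm (x::real^'n)) ^ M) powr q) \<partial>lborel)"
    have I: "I < \<infinity>" unfolding I_def by (rule inverse_power_powr_finite[OF Mq q])
    define \<delta> where "\<delta> = (\<lambda>n. (2 powr (s * real n) * \<bar>D n\<bar> * 2 powr (real (r n) * real CARD('n) * (1 - 1 / q))) powr q)"
    define Q where "Q = 3 powr q * 2 powr (\<bar>s + m\<bar> * q) * C powr q"
    have "(\<integral>\<^sup>+x. T n x \<partial>lborel) = ennreal (Q * \<delta> n) * I" for n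
    proof -
      have "(\<integral>\<^sup>+x. T n x \<partial>lborel) = ennreal (a n) * (\<integral>\<^sup>+x. ennreal (h n x powr q) \<partial>lborel)"
      proof -
        have "(\<lambda>x. ennreal (h n x powr q)) \<in> borel_measurable borel" unfolding h_def by measurable
        then show ?thesis unfolding T_def
          by (subst nn_integral_cmult[symmetric]) (auto simp: ennreal_mult' a_def)
      qed
      also have "(\<integral>\<^sup>+x. ennreal (h n x powr q) \<partial>lborel) = ennreal (C powr q * (2 ^ r n) powr (real CARD('n) * (q - 1))) * I"
        unfolding h_def I_def using nn_integral_dil_decay_powr[of "2 ^ r n" C "p n" M q] C(1) by simp
      also have "ennreal (a n) * (ennreal (C powr q * (2 ^ r n) powr (real CARD('n) * (q - 1))) * I) =
          ennreal (a n * (C powr q * (2 ^ r n) powr (real CARD('n) * (q - 1)))) * I"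
        by (simp add: ennreal_mult' a_def mult.assoc)
      also have "a n * (C powr q * (2 ^ r n) powr (real CARD('n) * (q - 1))) = Q * \<delta> n"
      proof -
        have "real (r n) * real CARD('n) * (1 - 1 / q) * q = real (r n) * (real CARD('n) * (q - 1))"
          using q by (simp add: field_simps)
        moreover have "(2 ^ r n) powr y = 2 powr (real (r n) * y)" for y :: real
          by (simp add: powr_realpow[symmetric] powr_powr)
        ultimately have "(2 ^ r n) powr (real CARD('n) * (q - 1)) = (2 powr (real (r n) * real CARD('n) * (1 - 1 / q))) powr q"
          by (simp only: powr_powr)
        then show ?thesis by (simp add: a_def Q_def \<delta>_def powr_mult)
      qed
      finally show ?thesis .
    qed
    then have "(\<integral>\<^sup>+x. (\<Sum>n. T n x) \<partial>lborel) = (\<Sum>n. ennreal (Q * \<delta> n) * I)"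
      by (subst nn_integral_suminf) auto
    also have "\<dots> = (\<Sum>n. ennreal (Q * \<delta> n)) * I" by (rule ennreal_suminf_multc)
    also have "(\<Sum>n. ennreal (Q * \<delta> n)) = ennreal (\<Sum>n. Q * \<delta> n)"
      using sum unfolding \<delta>_def[symmetric] by (intro suminf_ennreal2 summable_mult) (auto simp: Q_def \<delta>_def)
    also have "\<dots> * I < \<infinity>" using I by (simp add: ennreal_mult_less_top)
    finally show ?thesis .
  qed
  have "(\<Sum>k. ennreal (2 powr ((s + m) * real (\<mu> + k) * q) * norm (LP \<phi> \<Phi> (\<mu> + k) F.pair x) powr q)) \<le>
     3 * (\<Sum>n. T n x)" for x
  proof -
    have "(\<Sum>k. ennreal (2 powr ((s + m) * real (\<mu> + k) * q) * norm (LP \<phi> \<Phi> (\<mu> + k) F.pair x) powr q)) \<le>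
       (\<Sum>k. T (k + (\<mu> - 1)) x + T (k + \<mu>) x + T (k + (\<mu> + 1)) x)"
    proof (rule suminf_le)
      fix k
      show "ennreal (2 powr ((s + m) * real (\<mu> + k) * q) * norm (LP \<phi> \<Phi> (\<mu> + k) F.pair x) powr q) \<le>
          T (k + (\<mu> - 1)) x + T (k + \<mu>) x + T (k + (\<mu> + 1)) x"
        using bound[of "\<mu> + k" x] \<mu> by (simp add: add.commute)
    qed auto
    also have "\<dots> = (\<Sum>k. T (k + (\<mu> - 1)) x) + (\<Sum>k. T (k + \<mu>) x) + (\<Sum>k. T (k + (\<mu> + 1)) x)"
      by (simp add: suminf_add[symmetric])
    also have "\<dots> \<le> (\<Sum>n. T n x) + (\<Sum>n. T n x) + (\<Sum>n. T n x)"
      by (intro add_mono suminf_ennreal_shift_le[of "\<lambda>n. T n x"])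
    also have "\<dots> = 3 * (\<Sum>n. T n x)"
    proof -
      have "(3::ennreal) = 1 + 1 + 1" by simp
      then show ?thesis by (simp only: distrib_right mult_1)
    qed
    finally show ?thesis .
  qed
  then have "(\<integral>\<^sup>+x. (\<Sum>k. ennreal (2 powr ((s + m) * real (\<mu> + k) * q) * norm (LP \<phi> \<Phi> (\<mu> + k) F.pair x) powr q)) \<partial>lborel)
     \<le> (\<integral>\<^sup>+x. 3 * (\<Sum>n. T n x) \<partial>lborel)"
    by (rule nn_integral_mono)
  also have "\<dots> = 3 * (\<integral>\<^sup>+x. (\<Sum>n. T n x) \<partial>lborel)" by (rule nn_integral_cmult) measurable
  also have "\<dots> < \<infinity>" using Tint by (simp add: ennreal_mult_less_top)
  finally show "(\<integral>\<^sup>+x. (\<Sum>k. ennreal (2 powr ((s + m) * real (\<mu> + k) * q) * norm (LP \<phi> \<Phi> (\<mu> + k) F.pair x) powr q)) \<partial>lborel) < \<infinity>" .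
qed

text \<open>For \<open>k \<le> r n\<close> the kernel is the coarser of the two bumps and dictates
  scale and decay; for \<open>k > r n\<close> the spectra are disjoint. One power of decay is kept,
  for the influence of distant centres.\<close>

lemma profile_K_bound:
  obtains C where "C > 0"
    "\<And>n k x. k \<ge> 1 \<Longrightarrow> norm (LINT y|lborel. profile n y * K k (x - y)) \<le> C * (2 ^ k) ^ CARD('n) / (1 + 2 ^ k * norm (x - p n))"
proof -
  obtain C where C: "C > 0"
    "\<And>t t' x p u. \<lbrakk>0 < t; t \<le> 2 * t'; \<And>y. norm (u y) \<le> 1\<rbrakk> \<Longrightarrow>
       norm (LINT y|lborel. u y * dil t \<phi> (y - p) * dil t' \<psi> (x - y))
         \<le> C * t ^ DIM(real^'n) / (1 + t * norm (x - p)) ^ 1"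
    using conv_dil_bound[OF rapid_psi rapid_phi(1), of 1] by blast
  have "norm (LINT y|lborel. profile n y * K k (x - y)) \<le> C * (2 ^ k) ^ CARD('n) / (1 + 2 ^ k * norm (x - p n))"
    if k: "k \<ge> 1" for n k x
  proof (cases "k \<le> r n")
    case True
    have [measurable]: "profile n \<in> borel_measurable borel" "K k \<in> borel_measurable borel"
      using borel_measurable_integrable[OF integrable_profile] borel_measurable_integrable[OF integrable_K] by simp_all
    \<comment> \<open>Reflecting \<open>y\<close> exchanges kernel and profile, so that the kernel
      takes the coarse slot \<open>t\<close> of \<open>conv_dil_bound\<close>.\<close>
    have "(LINT y|lborel. profile n y * K k (x - y)) = (LINT y|lborel. profile n (x + p n - y) * K k (x - (x + p n - y)))"
      using integral_lborel_affine[of "\<lambda>y. profile n y * K k (x - y)" "-1" "x + p n"] by simp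
    also have "\<dots> = (LINT y|lborel. 1 * dil (2 ^ k) \<phi> (y - p n) * dil (2 ^ r n) \<psi> (x - y))"
      using k by (intro Bochner_Integration.integral_cong refl) (simp add: profile_def K_pos algebra_simps)
    also have "norm \<dots> \<le> C * (2 ^ k) ^ DIM(real^'n) / (1 + 2 ^ k * norm (x - p n)) ^ 1"
    proof (rule C(2))
      have "(2::real) ^ k \<le> 2 ^ r n" using True by (intro power_increasing) auto
      then show "(2::real) ^ k \<le> 2 * 2 ^ r n" using zero_less_power[of "2::real" "r n"] by linarith
    qed auto
    finally show ?thesis by simp
  next
    case False
    have zero: "fourier (profile n) \<xi> * fourier (K k) \<xi> = 0" for \<xi>
    proof (rule ccontr)
      assume "fourier (profile n) \<xi> * fourier (K k) \<xi> \<noteq> 0"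
      then have nz: "fourier (profile n) \<xi> \<noteq> 0" "fourier (K k) \<xi> \<noteq> 0" by auto
      have "fourier (profile n) \<xi> = fourier \<psi> (\<xi> /\<^sub>R 2 ^ r n) * cis (- 2 * pi * (p n \<bullet> \<xi>))"
        unfolding profile_def[abs_def]
        using fourier_modulate_translate[OF integrable_dil_psi, of 0 "r n" "p n" \<xi>] by (simp add: fourier_dil_psi)
      then have "norm (\<xi> /\<^sub>R 2 ^ r n) < 1/16" using nz(1) fourier_psi_support by force
      then have "norm \<xi> / 2 ^ r n < 1/16" by (simp only: norm_inverse_scale zero_less_power zero_less_numeral)
      then have "norm \<xi> < 2 ^ r n / 16" by (simp add: divide_less_eq)
      moreover have "(2::real) ^ r n \<le> 2 ^ k" using False by (intro power_increasing) auto
      moreover have "2 ^ k / 2 < norm \<xi>" by (rule fourier_K_support_lower[OF k nz(2)])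
      ultimately show False using zero_less_power[of "2::real" k] by linarith
    qed
    have "(LINT y|lborel. profile n y * K k (x - y)) = 0"
      unfolding K_conv[OF integrable_profile] mult.assoc[symmetric] by (simp only: zero) simp
    moreover have "C * (2 ^ k) ^ CARD('n) / (1 + 2 ^ k * norm (x - p n)) \<ge> 0"
      using C(1) by (intro divide_nonneg_nonneg mult_nonneg_nonneg add_nonneg_nonneg) auto
    ultimately show ?thesis by simp
  qed
  with C(1) show ?thesis using that by blast
qed

text \<open>Bumps with common centre \<open>P\<close> and \<open>k + 6 \<le> r n\<close> act as
  point masses, so they add up coherently to \<open>\<Sum>n\<in>I. D n\<close> times the kernel at
  \<open>x - P\<close>; the terms outside \<open>I\<close> cost at most half of the resulting lower
  bound.\<close>

lemma output_lower_bound: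
  assumes I: "finite I" "\<And>n. n \<in> I \<Longrightarrow> p n = P" "\<And>n. n \<in> I \<Longrightarrow> k + 6 \<le> r n"
    and k: "k \<ge> 1"
    and C: "\<And>n. norm (LINT y|lborel. profile n y * K k (x - y)) \<le> C * (2 ^ k) ^ CARD('n) / (1 + 2 ^ k * norm (x - p n))" "C > 0"
    and \<phi>: "norm (\<phi> (2 ^ k *\<^sub>R (x - P))) \<ge> c"
    and sum: "summable (\<lambda>n. if n \<in> I then 0 else \<bar>D n\<bar> / (1 + norm (x - p n)))"
    and small: "C * (\<Sum>n. if n \<in> I then 0 else \<bar>D n\<bar> / (1 + norm (x - p n))) \<le> c / 2 * (\<Sum>n\<in>I. D n)"
    and pos: "(\<Sum>n\<in>I. D n) \<ge> 0"
  shows "norm (LP \<phi> \<Phi> k ching_image x) \<ge> c / 2 * (\<Sum>n\<in>I. D n) * (2 ^ k) ^ CARD('n)"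
proof -
  define V where "V = (\<lambda>n. LINT y|lborel. profile n y * K k (x - y))"
  define g where "g = (\<lambda>n. D n *\<^sub>R V n)"
  define \<epsilon> where "\<epsilon> = (\<lambda>n. if n \<in> I then 0 else \<bar>D n\<bar> / (1 + norm (x - p n)))"
  have g: "summable g"
    unfolding g_def V_def by (rule U.summable_terms[OF rapid_reflect_weakly_decaying[OF rapid_K]])
  have main: "(\<Sum>n\<in>I. g n) = (\<Sum>n\<in>I. D n) *\<^sub>R K k (x - P)"
    unfolding scaleR_sum_left g_def V_def profile_def
    using I by (intro sum.cong refl) (simp add: dil_psi_conv_K)
  have "norm (if n \<in> I then 0 else g n) \<le> C * (2 ^ k) ^ CARD('n) * \<epsilon> n" for n
  proof (cases "n \<in> I")
    case False
    have "norm (V n) \<le> C * (2 ^ k) ^ CARD('n) / (1 + norm (x - p n))"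
      unfolding V_def
    proof (rule order_trans[OF C(1)])
      have "1 * norm (x - p n) \<le> 2 ^ k * norm (x - p n)" by (intro mult_right_mono) auto
      then show "C * (2 ^ k) ^ CARD('n) / (1 + 2 ^ k * norm (x - p n)) \<le> C * (2 ^ k) ^ CARD('n) / (1 + norm (x - p n))"
        using C(2) by (intro divide_left_mono mult_pos_pos mult_nonneg_nonneg) (auto intro: add_pos_nonneg)
    qed
    then have "\<bar>D n\<bar> * norm (V n) \<le> \<bar>D n\<bar> * (C * (2 ^ k) ^ CARD('n) / (1 + norm (x - p n)))"
      by (rule mult_left_mono) simp
    then show ?thesis using False by (simp add: g_def \<epsilon>_def mult_ac)
  qed (simp add: \<epsilon>_def)
  note le = this
  have \<epsilon>: "summable (\<lambda>n. C * (2 ^ k) ^ CARD('n) * \<epsilon> n)"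
    using sum unfolding \<epsilon>_def[symmetric] by (rule summable_mult)
  have s: "summable (\<lambda>n. norm (if n \<in> I then 0 else g n))"
    by (rule summable_comparison_test'[OF \<epsilon>, of 0]) (use le in simp)
  have "norm (\<Sum>n. if n \<in> I then 0 else g n) \<le> (\<Sum>n. norm (if n \<in> I then 0 else g n))"
    by (rule summable_norm[OF s])
  also have "\<dots> \<le> (\<Sum>n. C * (2 ^ k) ^ CARD('n) * \<epsilon> n)" by (rule suminf_le[OF le s \<epsilon>])
  also have "\<dots> = (2 ^ k) ^ CARD('n) * (C * (\<Sum>n. \<epsilon> n))"
    using suminf_mult[OF sum[folded \<epsilon>_def], of "C * (2 ^ k) ^ CARD('n)"] by (simp add: mult_ac)
  also have "\<dots> \<le> (2 ^ k) ^ CARD('n) * (c / 2 * (\<Sum>n\<in>I. D n))"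
    using small unfolding \<epsilon>_def by (intro mult_left_mono) auto
  finally have rest: "norm (\<Sum>n. if n \<in> I then 0 else g n) \<le> (2 ^ k) ^ CARD('n) * (c / 2 * (\<Sum>n\<in>I. D n))" .
  have "(\<Sum>n. g n) = (\<Sum>n. (if n \<in> I then g n else 0) + (if n \<in> I then 0 else g n))"
    by (intro suminf_cong) simp
  also have "\<dots> = (\<Sum>n. if n \<in> I then g n else 0) + (\<Sum>n. if n \<in> I then 0 else g n)"
    by (intro suminf_add[symmetric] summable_norm_cancel[OF s] summable_finite[OF I(1)]) auto
  also have "(\<Sum>n. if n \<in> I then g n else 0) = (\<Sum>n\<in>I. g n)"
    by (subst suminf_finite[OF I(1)]) auto
  finally have "norm (\<Sum>n. g n) \<ge> norm (\<Sum>n\<in>I. g n) - norm (\<Sum>n. if n \<in> I then 0 else g n)"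
    using norm_diff_ineq[of "\<Sum>n\<in>I. g n" "\<Sum>n. if n \<in> I then 0 else g n"] by simp
  moreover have "norm (\<Sum>n\<in>I. g n) \<ge> (\<Sum>n\<in>I. D n) * ((2 ^ k) ^ CARD('n) * c)"
    unfolding main using pos \<phi> k by (simp add: K_pos dil_def norm_mult norm_power mult_left_mono)
  ultimately have "norm (\<Sum>n. g n) \<ge> c / 2 * (\<Sum>n\<in>I. D n) * (2 ^ k) ^ CARD('n)"
    using rest by (simp add: algebra_simps)
  then show ?thesis unfolding LP_output g_def V_def .
qed

text \<open>In band \<open>k\<close> the lower bound for \<phi> is used on a copy of the ball shrunk
  by \<open>2 ^ k\<close> and moved to \<open>P\<close>; its volume, of order
  \<open>2 powr (- k * d)\<close>, and the height \<open>2 ^ (k * d)\<close> of the kernel give the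
  exponent. The copy fits into the cube once \<open>k \<ge> \<kappa>\<close>, and
  \<open>k < L - 5\<close> means \<open>k + 6 \<le> L\<close>.\<close>

lemma output_integral_lower_bound:
  fixes R :: "(real^'n) set"
  assumes q: "q > 0" and \<kappa>: "1 \<le> \<kappa>" "\<mu> \<le> \<kappa>"
    and I: "finite I" "\<And>n. n \<in> I \<Longrightarrow> p n = P" "\<And>n. n \<in> I \<Longrightarrow> r n = L"
    and E: "E = (\<Sum>n\<in>I. D n)" "E \<ge> 0"
    and C: "\<And>n k x. k \<ge> 1 \<Longrightarrow> norm (LINT y|lborel. profile n y * K k (x - y)) \<le> C * (2 ^ k) ^ CARD('n) / (1 + 2 ^ k * norm (x - p n))"
      "C > 0"
    and c: "c > 0" "\<And>z. z \<in> ball x0 \<rho> \<Longrightarrow> norm (\<phi> z) \<ge> c" "norm x0 + \<rho> \<le> 2 ^ \<kappa> / 2 ^ Suc \<mu>"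
    and R: "ball P (1 / 2 ^ Suc \<mu>) \<subseteq> R"
    and sum: "\<And>x. x \<in> ball P (1 / 2 ^ Suc \<mu>) \<Longrightarrow> summable (\<lambda>n. if n \<in> I then 0 else \<bar>D n\<bar> / (1 + norm (x - p n)))"
    and small: "\<And>x. x \<in> ball P (1 / 2 ^ Suc \<mu>) \<Longrightarrow>
      C * (\<Sum>n. if n \<in> I then 0 else \<bar>D n\<bar> / (1 + norm (x - p n))) \<le> c / 2 * E"
  shows "ennreal ((c / 2 * E) powr q * measure lborel (ball x0 \<rho>) *
        (\<Sum>k\<in>{\<kappa>..<L - 5}. 2 powr (real k * q * (s + real CARD('n) - real CARD('n) / q)))) \<le>
    (\<integral>\<^sup>+x\<in>R. (\<Sum>k. ennreal (2 powr (s * real (\<mu> + k) * q) *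
       norm (LP \<phi> \<Phi> (\<mu> + k) ching_image x) powr q)) \<partial>lborel)"
proof -
  define v where "v = measure lborel (ball x0 \<rho>)"
  define f where "f = (\<lambda>k x. ennreal (2 powr (s * real k * q) *
       norm (LP \<phi> \<Phi> k ching_image x) powr q))"
  define a where "a = (\<lambda>k. 2 powr (s * real k * q) * (c / 2 * E * (2 ^ k) ^ CARD('n)) powr q)"
  define B :: "nat \<Rightarrow> real^'n \<Rightarrow> ennreal" where "B = (\<lambda>k x. indicator (ball x0 \<rho>) (2 ^ k *\<^sub>R (x - P)))"
  have [measurable]: "B k \<in> borel_measurable borel" for k
    unfolding B_def by (rule measurable_compose[of _ borel borel]) (auto intro!: borel_measurable_indicator borel_open)
  have ptw: "ennreal (a k) * B k x \<le> f k x * indicator R x" if k: "k \<in> {\<kappa>..<L - 5}" for k x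
  proof (cases "2 ^ k *\<^sub>R (x - P) \<in> ball x0 \<rho>")
    case True
    have "norm (2 ^ k *\<^sub>R (x - P)) \<le> norm x0 + norm (2 ^ k *\<^sub>R (x - P) - x0)" by (rule norm_triangle_sub)
    also have "\<dots> < norm x0 + \<rho>" using True by (simp add: dist_norm norm_minus_commute)
    also have "\<dots> \<le> 2 ^ \<kappa> / 2 ^ Suc \<mu>" by (rule c)
    also have "\<dots> \<le> 2 ^ k / 2 ^ Suc \<mu>" using k by (intro divide_right_mono power_increasing) auto
    finally have "2 ^ k * norm (x - P) < 2 ^ k * (1 / 2 ^ Suc \<mu>)" by simp
    then have x: "x \<in> ball P (1 / 2 ^ Suc \<mu>)"
      by (simp only: mult_less_cancel_left_pos zero_less_power zero_less_numeral mem_ball dist_norm norm_minus_commute)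
    have k1: "k \<ge> 1" using k \<kappa> by simp
    have "c / 2 * (\<Sum>n\<in>I. D n) * (2 ^ k) ^ CARD('n) \<le> norm (LP \<phi> \<Phi> k ching_image x)"
    proof (rule output_lower_bound[OF I(1,2) _ k1 C(1)[OF k1] C(2) c(2)[OF True] sum[OF x]])
      show "k + 6 \<le> r n" if "n \<in> I" for n using I(3)[OF that] k by auto
    qed (use small[OF x] E in auto)
    then have "a k \<le> 2 powr (s * real k * q) * norm (LP \<phi> \<Phi> k ching_image x) powr q"
      unfolding a_def E(1)[symmetric] using q c(1) E(2)
      by (intro mult_left_mono powr_mono2) auto
    then have "ennreal (a k) \<le> f k x" unfolding f_def by (rule ennreal_leI)
    then show ?thesis using x R True by (simp add: B_def subset_iff)
  qed (simp add: B_def)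
  have "(\<integral>\<^sup>+x. B k x \<partial>lborel) = ennreal ((1 / 2 ^ k) ^ CARD('n)) * ennreal v" for k
  proof -
    have "(\<integral>\<^sup>+x. B k x \<partial>lborel) = ennreal (\<bar>1 / 2 ^ k\<bar> ^ DIM(real^'n)) * (\<integral>\<^sup>+x. B k (P + (1 / 2 ^ k) *\<^sub>R x) \<partial>lborel)"
      by (rule nn_integral_lborel_affine) auto
    also have "(\<integral>\<^sup>+x. B k (P + (1 / 2 ^ k) *\<^sub>R x) \<partial>lborel) = emeasure lborel (ball x0 \<rho>)"
      by (simp add: B_def)
    also have "\<dots> = ennreal v"
      unfolding v_def using emeasure_lborel_ball_finite[of x0 \<rho>] by (intro emeasure_eq_ennreal_measure) auto
    finally show ?thesis by simp
  qed
  then have int: "(\<integral>\<^sup>+x. ennreal (a k) * B k x \<partial>lborel) =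
      ennreal ((c / 2 * E) powr q * v * 2 powr (real k * q * (s + real CARD('n) - real CARD('n) / q)))" for k
  proof -
    have "((2 ^ k) ^ CARD('n)) powr q * (1 / 2 ^ k) ^ CARD('n) = 2 powr (real k * real CARD('n) * q - real k * real CARD('n))"
    proof -
      have eq: "((2::real) ^ k) ^ CARD('n) = 2 powr (real k * real CARD('n))"
        by (simp add: powr_realpow[symmetric] powr_powr)
      have "((2::real) ^ k) ^ CARD('n) * (1 / 2 ^ k) ^ CARD('n) = 1" by (simp add: power_mult_distrib[symmetric])
      then have "(1 / (2::real) ^ k) ^ CARD('n) = 2 powr (- (real k * real CARD('n)))"
        unfolding eq by (simp add: powr_minus field_simps)
      then show ?thesis unfolding eq by (simp add: powr_powr powr_add[symmetric])
    qed
    moreover have "s * real k * q + (real k * real CARD('n) * q - real k * real CARD('n)) =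
        real k * q * (s + real CARD('n) - real CARD('n) / q)"
      using q by (simp add: field_simps)
    ultimately have "2 powr (s * real k * q) * (((2 ^ k) ^ CARD('n)) powr q * (1 / 2 ^ k) ^ CARD('n)) =
        2 powr (real k * q * (s + real CARD('n) - real CARD('n) / q))"
      by (simp only: powr_add[symmetric])
    moreover have "a k = (c / 2 * E) powr q * (2 powr (s * real k * q) * ((2 ^ k) ^ CARD('n)) powr q)"
    proof -
      have "(c / 2 * E * (2 ^ k) ^ CARD('n)) powr q = (c / 2 * E) powr q * ((2 ^ k) ^ CARD('n)) powr q"
        by (rule powr_mult)
      then show ?thesis unfolding a_def by (simp only: mult_ac)
    qed
    ultimately have "a k * ((1 / 2 ^ k) ^ CARD('n) * v) =
        (c / 2 * E) powr q * v * 2 powr (real k * q * (s + real CARD('n) - real CARD('n) / q))"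
      by (simp only: mult_ac)
    moreover have "a k \<ge> 0" by (simp add: a_def)
    moreover have "v \<ge> 0" by (simp add: v_def)
    ultimately show ?thesis
      using \<open>\<And>k. (\<integral>\<^sup>+x. B k x \<partial>lborel) = ennreal ((1 / 2 ^ k) ^ CARD('n)) * ennreal v\<close>[of k]
      by (subst nn_integral_cmult) (simp_all flip: ennreal_mult)
  qed
  have "ennreal ((c / 2 * E) powr q * v * (\<Sum>k\<in>{\<kappa>..<L - 5}. 2 powr (real k * q * (s + real CARD('n) - real CARD('n) / q)))) =
      (\<Sum>k\<in>{\<kappa>..<L - 5}. \<integral>\<^sup>+x. ennreal (a k) * B k x \<partial>lborel)"
    unfolding int sum_distrib_left by (rule sum_ennreal[symmetric]) (simp add: v_def)
  also have "\<dots> = (\<integral>\<^sup>+x. (\<Sum>k\<in>{\<kappa>..<L - 5}. ennreal (a k) * B k x) \<partial>lborel)"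
    by (rule nn_integral_sum[symmetric]) measurable
  also have "\<dots> \<le> (\<integral>\<^sup>+x\<in>R. (\<Sum>k. f (\<mu> + k) x) \<partial>lborel)"
  proof (rule nn_integral_mono)
    fix x
    have "(\<Sum>k\<in>{\<kappa>..<L - 5}. ennreal (a k) * B k x) \<le> (\<Sum>k\<in>{\<kappa>..<L - 5}. f (\<mu> + (k - \<mu>)) x * indicator R x)"
    proof (rule sum_mono)
      fix k assume k: "k \<in> {\<kappa>..<L - 5}"
      then have "\<mu> + (k - \<mu>) = k" using \<kappa> by simp
      then show "ennreal (a k) * B k x \<le> f (\<mu> + (k - \<mu>)) x * indicator R x" using ptw[OF k, of x] by (simp only:)
    qed
    also have "\<dots> = (\<Sum>k\<in>(\<lambda>k. k - \<mu>) ` {\<kappa>..<L - 5}. f (\<mu> + k) x) * indicator R x"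
      using \<kappa>(2) by (subst sum.reindex) (auto simp: sum_distrib_right intro!: inj_onI)
    also have "\<dots> \<le> (\<Sum>k. f (\<mu> + k) x) * indicator R x"
      by (intro mult_right_mono sum_le_suminf) auto
    finally show "(\<Sum>k\<in>{\<kappa>..<L - 5}. ennreal (a k) * B k x) \<le> (\<Sum>k. f (\<mu> + k) x) * indicator R x" .
  qed
  finally show ?thesis unfolding f_def v_def .
qed

end

text \<open>If \<phi> vanished, so would its transform, against the value 1 of the first band on the
  sphere of radius 2. Continuity spreads a nonzero value to a ball.\<close>

lemma (in littlewood_paley_pair) phi_lower_bound:
  obtains x0 \<rho> c where "c > 0" "\<rho> > 0" "\<And>z. z \<in> ball x0 \<rho> \<Longrightarrow> norm (\<phi> z) \<ge> c"
proof -
  have "\<exists>x. \<phi> x \<noteq> 0"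
  proof (rule ccontr)
    assume "\<not> ?thesis"
    then have "fourier \<phi> \<xi> = 0" for \<xi> by (simp add: fourier_def)
    then have "fourier (K 1) ((2::real) *\<^sub>R axis undefined 1) = 0" by (simp add: fourier_K_pos)
    moreover have "fourier (K 1) ((2::real) *\<^sub>R axis undefined 1) = 1"
      using fourier_K_dyadic_sphere[of 1 "(2::real) *\<^sub>R axis undefined 1" 1] by simp
    ultimately show False by simp
  qed
  then obtain x0 where x0: "\<phi> x0 \<noteq> 0" by blast
  have "isCont \<phi> x0" using rapid_phi(1) by (simp add: rapid_def continuous_on_eq_continuous_at)
  then obtain \<rho> where \<rho>: "\<rho> > 0" "\<And>z. dist z x0 < \<rho> \<Longrightarrow> dist (\<phi> z) (\<phi> x0) < norm (\<phi> x0) / 2"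
    using x0 unfolding continuous_at_eps_delta by (metis zero_less_norm_iff half_gt_zero)
  have "norm (\<phi> z) \<ge> norm (\<phi> x0) / 2" if "z \<in> ball x0 \<rho>" for z
  proof -
    have "dist (\<phi> z) (\<phi> x0) < norm (\<phi> x0) / 2" using that by (intro \<rho>) (simp add: dist_commute)
    then show ?thesis using norm_triangle_sub[of "\<phi> x0" "\<phi> z"] by (simp add: dist_norm norm_minus_commute)
  qed
  then show ?thesis using that[of "norm (\<phi> x0) / 2" \<rho> x0] x0 \<rho>(1) by simp
qed

section \<open>Choice of the weights\<close>

text \<open>The integer part of the binary logarithm for \<open>n \<ge> 1\<close>, and 0 at
  \<open>n = 0\<close>.\<close>

definition dyadic_block :: "nat \<Rightarrow> nat" where
  "dyadic_block n = (LEAST l. n < 2 ^ Suc l)"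

lemma dyadic_block_less: "n < 2 ^ Suc (dyadic_block n)"
  unfolding dyadic_block_def by (rule LeastI[of _ n]) (rule less_le_trans[OF less_exp], simp)

lemma dyadic_block_eqI: "2 ^ l \<le> n \<Longrightarrow> n < 2 ^ Suc l \<Longrightarrow> dyadic_block n = l"
  unfolding dyadic_block_def
proof (rule Least_equality)
  fix i assume "2 ^ l \<le> n" "n < 2 ^ Suc i"
  then have "(2::nat) ^ l < 2 ^ Suc i" by linarith
  then show "l \<le> i" by (simp only: power_strict_increasing_iff)
qed

text \<open>Centres moving off to infinity so fast that the blocks do not interact and the
  exponentially growing coefficients still define tempered distributions.\<close>

definition centre_height :: "(nat \<Rightarrow> real) \<Rightarrow> (nat \<Rightarrow> real) \<Rightarrow> nat \<Rightarrow> real" where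
  "centre_height b E l = 4 ^ l * ((1 + (\<Sum>n<2 ^ Suc l. 2 ^ n * b n)) * (1 + (\<Sum>i\<le>l. 1 / E i)))"

text \<open>The factor \<open>4 ^ l\<close> separates the heights, the first sum dominates every
  coefficient of the blocks up to \<open>l\<close> with the margin \<open>2 ^ n\<close>, and the
  second makes the height large even relative to a small mass \<open>E i\<close>. Blocks of mass
  zero add nothing, because \<open>1 / 0 = 0\<close>.\<close>

lemma centre_height:
  assumes b: "\<And>n. b n \<ge> 0" and E: "\<And>i. E i \<ge> 0"
  shows "1 \<le> centre_height b E l"
    and "n < 2 ^ Suc l \<Longrightarrow> 2 ^ n * b n \<le> centre_height b E l"
    and "n < 2 ^ Suc l \<Longrightarrow> i \<le> l \<Longrightarrow> E i > 0 \<Longrightarrow> 4 ^ i * (2 ^ n * b n) \<le> E i * centre_height b E l"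
    and "i < l \<Longrightarrow> 4 * centre_height b E i \<le> centre_height b E l"
proof -
  define A where "A = (\<lambda>l. 1 + (\<Sum>n<2 ^ Suc l. 2 ^ n * b n))"
  define G where "G = (\<lambda>l. 1 + (\<Sum>i\<le>l. 1 / E i))"
  have Y: "centre_height b E l = 4 ^ l * (A l * G l)" for l by (simp add: centre_height_def A_def G_def)
  have A1: "A l \<ge> 1" "G l \<ge> 1" for l using b E by (auto simp: A_def G_def intro!: sum_nonneg)
  have AG1: "A l * G l \<ge> 1" for l using mult_mono[OF A1(1) A1(2), of l l] A1(1)[of l] by simp
  have four: "(4::real) ^ l \<ge> 1" for l by simp
  show "1 \<le> centre_height b E l"
    using mult_mono[OF four AG1, of l l] by (simp add: Y)
  have Ab: "2 ^ n * b n \<le> A l" if "n < 2 ^ Suc l" for n l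
  proof -
    have "2 ^ n * b n \<le> (\<Sum>n<2 ^ Suc l. 2 ^ n * b n)"
      using that b by (intro member_le_sum) auto
    then show ?thesis by (simp add: A_def)
  qed
  show "2 ^ n * b n \<le> centre_height b E l" if n: "n < 2 ^ Suc l"
  proof -
    have "2 ^ n * b n * 1 \<le> A l * G l" using A1 b by (intro mult_mono Ab n) (auto intro: order_trans[OF zero_le_one])
    also have "\<dots> \<le> centre_height b E l"
      unfolding Y using mult_right_mono[OF four[of l], of "A l * G l"] AG1[of l] by simp
    finally show ?thesis by simp
  qed
  show "4 ^ i * (2 ^ n * b n) \<le> E i * centre_height b E l" if n: "n < 2 ^ Suc l" "i \<le> l" "E i > 0"
  proof -
    have "1 / E i \<le> (\<Sum>i\<le>l. 1 / E i)" using n E by (intro member_le_sum) auto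
    then have "1 \<le> E i * G l" using n(3) by (simp add: G_def field_simps)
    then have m1: "(2 ^ n * b n) * 1 \<le> A l * (E i * G l)"
      using A1 b by (intro mult_mono Ab n) (auto intro: order_trans[OF zero_le_one])
    have m2: "(4::real) ^ i \<le> 4 ^ l" using n by (intro power_increasing) auto
    have "4 ^ i * ((2 ^ n * b n) * 1) \<le> 4 ^ l * (A l * (E i * G l))"
      by (rule mult_mono[OF m2 m1]) (use b in auto)
    then show ?thesis by (simp add: Y mult_ac)
  qed
  show "4 * centre_height b E i \<le> centre_height b E l" if "i < l"
  proof -
    have "(\<Sum>n<2 ^ Suc i. 2 ^ n * b n) \<le> (\<Sum>n<2 ^ Suc l. 2 ^ n * b n)"
    proof (rule sum_mono2)
      have "(2::nat) ^ Suc i \<le> 2 ^ Suc l" using that by (intro power_increasing) auto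
      then show "{..<(2::nat) ^ Suc i} \<subseteq> {..<2 ^ Suc l}" by auto
    qed (use b in auto)
    moreover have "(\<Sum>i\<le>i. 1 / E i) \<le> (\<Sum>i\<le>l. 1 / E i)"
      using that E by (intro sum_mono2) auto
    ultimately have n1: "A i * G i \<le> A l * G l"
      using A1[of i] A1[of l] by (intro mult_mono) (auto simp: A_def G_def)
    have n2: "(4::real) * 4 ^ i \<le> 4 ^ l" using that power_increasing[of "Suc i" l "4::real"] by simp
    have "4 * 4 ^ i * (A i * G i) \<le> 4 ^ l * (A l * G l)"
      by (rule mult_mono[OF n2 n1]) (use AG1[of i] in auto)
    then show ?thesis by (simp add: Y)
  qed
qed

lemma Linf_norm_zero: "Linf_norm (\<lambda>x::real^'n. 0) = 0"
  unfolding Linf_norm_def by (simp add: esssup_const)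

abbreviation block_mass :: "(nat \<Rightarrow> real) \<Rightarrow> nat \<Rightarrow> real" where
  "block_mass D l \<equiv> \<Sum>n | dyadic_block n = l \<and> D n \<noteq> 0. D n"

text \<open>The \<open>n\<close>-th atom has frequency \<open>2 ^ n\<close> and width \<open>2 ^ - r n\<close>, and \<open>D n\<close> is the coefficient
  of its demodulated image; \<open>L l\<close> is the common value of \<open>r\<close> on the \<open>l\<close>-th dyadic block. The
  summability bounds the norm of the input, the last condition makes that of the image infinite.\<close>

definition admissible_weights ::
    "real \<Rightarrow> real \<Rightarrow> real \<Rightarrow> nat \<Rightarrow> nat \<Rightarrow> (nat \<Rightarrow> real) \<Rightarrow> (nat \<Rightarrow> nat) \<Rightarrow> (nat \<Rightarrow> nat) \<Rightarrow> bool" where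
  "admissible_weights q d s \<mu> \<kappa> D r L \<longleftrightarrow>
     (\<forall>n. r n \<le> n) \<and> (\<forall>n. 0 \<le> D n) \<and> (\<forall>n\<le>\<mu>. D n = 0) \<and>
     (\<forall>n. D n \<noteq> 0 \<longrightarrow> r n = L (dyadic_block n)) \<and>
     summable (\<lambda>n. (2 powr (s * real n) * D n * 2 powr (real (r n) * d * (1 - 1 / q))) powr q) \<and>
     (\<forall>T N. \<exists>l\<ge>N. block_mass D l > 0 \<and>
        T \<le> block_mass D l powr q *
          (\<Sum>k\<in>{\<kappa>..<L l - 5}. 2 powr (real k * q * (s + d - d / q))))"

section \<open>Counterexample from admissible weights\<close>

context littlewood_paley_pair begin

definition unbounded_on_S11 :: "real \<Rightarrow> nat \<Rightarrow> real \<Rightarrow> real \<Rightarrow> bool" where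
  "unbounded_on_S11 q \<mu> m s \<longleftrightarrow>
    (\<exists>(a :: (real^'n) \<times> (real^'n) \<Rightarrow> complex) (f :: (real^'n) functional).
      symbol_S11 m a \<and> tempered f \<and>
      (SUP k\<in>{0..\<mu> - 1}. Linf_norm (\<lambda>x. complex_of_real (2 powr (real k * (s + m))) * LP \<phi> \<Phi> k f x))
        + cube_norm (s + m) q \<mu> (\<lambda>k. LP \<phi> \<Phi> k f) < \<infinity> \<and>
      psido_converges \<phi> \<Phi> a f \<and>
      cube_norm s q \<mu> (\<lambda>k. LP \<phi> \<Phi> k (psido \<phi> \<Phi> a f)) = \<infinity>)"

text \<open>The threshold \<kappa> depends only on \<phi> and \<mu> and is fixed before the weights,
  since for \<open>q > 1\<close> the width of the bumps is chosen in terms of it.\<close>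

lemma counterexample_from_weights:
  assumes q: "q > 0" and \<mu>: "\<mu> \<ge> 1"
  obtains \<kappa> where
    "\<And>m s D r L. admissible_weights q (real CARD('n)) s \<mu> \<kappa> D r L \<Longrightarrow> unbounded_on_S11 q \<mu> m s"
proof -
  obtain c \<rho> x0 where \<phi>: "c > 0" "\<rho> > 0" "\<And>z. z \<in> ball x0 \<rho> \<Longrightarrow> norm (\<phi> z) \<ge> c"
  proof -
    have "\<exists>c \<rho> x0. 0 < c \<and> 0 < \<rho> \<and> (\<forall>z\<in>ball x0 \<rho>. c \<le> norm (\<phi> z))"
      by (rule phi_lower_bound) blast
    then show thesis using that by blast
  qed
  obtain \<kappa>0 where \<kappa>0: "(norm x0 + \<rho>) * 2 ^ Suc \<mu> < 2 ^ \<kappa>0"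
    using real_arch_pow[of 2 "(norm x0 + \<rho>) * 2 ^ Suc \<mu>"] by auto
  define \<kappa> where "\<kappa> = max \<mu> \<kappa>0"
  have "(2::real) ^ \<kappa>0 \<le> 2 ^ \<kappa>" unfolding \<kappa>_def by (intro power_increasing) auto
  with \<kappa>0 have "(norm x0 + \<rho>) * 2 ^ Suc \<mu> \<le> 2 ^ \<kappa>" by linarith
  then have \<kappa>: "1 \<le> \<kappa>" "\<mu> \<le> \<kappa>" "norm x0 + \<rho> \<le> 2 ^ \<kappa> / 2 ^ Suc \<mu>"
    using \<mu> by (auto simp: \<kappa>_def le_divide_eq)
  show ?thesis
  proof (rule that)
    fix m s :: real and D :: "nat \<Rightarrow> real" and r L :: "nat \<Rightarrow> nat"
    assume "admissible_weights q (real CARD('n)) s \<mu> \<kappa> D r L"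
    then have r: "\<And>n. r n \<le> n" and D: "\<And>n. D n \<ge> 0" "\<And>n. n \<le> \<mu> \<Longrightarrow> D n = 0"
      and L: "\<And>n. D n \<noteq> 0 \<Longrightarrow> r n = L (dyadic_block n)"
      and H1: "summable (\<lambda>n. (2 powr (s * real n) * D n * 2 powr (real (r n) * real CARD('n) * (1 - 1 / q))) powr q)"
      and H2: "\<And>T N. \<exists>l\<ge>N. block_mass D l > 0 \<and>
         T \<le> block_mass D l powr q *
           (\<Sum>k\<in>{\<kappa>..<L l - 5}. 2 powr (real k * q * (s + real CARD('n) - real CARD('n) / q)))"
      unfolding admissible_weights_def by blast+
    define I where "I = (\<lambda>l. {n. dyadic_block n = l \<and> D n \<noteq> 0})"
    have finI: "finite (I l)" for l
      by (rule finite_subset[of _ "{..<2 ^ Suc l}"]) (use dyadic_block_less in \<open>auto simp: I_def\<close>)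
    define E where "E = (\<lambda>l. \<Sum>n\<in>I l. D n)"
    have E0: "E l \<ge> 0" for l unfolding E_def using D by (intro sum_nonneg)
    \<comment> \<open>\<open>b\<close> dominates both coefficient sequences, so one choice of
      centres serves input and image.\<close>
    define b where "b = (\<lambda>n. D n + 2 powr (- m * real n) * D n)"
    have b: "b n \<ge> 0" "D n \<le> b n" "2 powr (- m * real n) * D n \<le> b n" for n
      using D(1)[of n] by (auto simp: b_def)
    define y where "y = centre_height b E"
    note y = centre_height[of b E, OF b(1) E0, folded y_def]
    \<comment> \<open>Rounding to integers places the centres at midpoints of dyadic cubes.\<close>
    define \<Lambda> where "\<Lambda> = (\<lambda>l. nat \<lceil>y l\<rceil>)"
    have \<Lambda>: "y l \<le> real (\<Lambda> l)" "real (\<Lambda> l) \<le> y l + 1" for l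
      using y(1)[of l] unfolding \<Lambda>_def by linarith+
    define i0 :: 'n where "i0 = undefined"
    define e :: "real^'n" where "e = axis i0 1"
    define h :: "real^'n" where "h = (\<chi> i. 1 / 2 ^ Suc \<mu>)"
    define P where "P = (\<lambda>l. real (\<Lambda> l) *\<^sub>R e + h)"
    define p where "p = (\<lambda>n. P (dyadic_block n))"
    have e: "norm e = 1" by (simp add: e_def)
    have norm_p: "y (dyadic_block n) \<le> 1 + norm (p n)" for n
    proof -
      have "p n $ i0 = real (\<Lambda> (dyadic_block n)) + 1 / 2 ^ Suc \<mu>" by (simp add: p_def P_def e_def h_def)
      then have "real (\<Lambda> (dyadic_block n)) \<le> norm (p n)"
        using component_le_norm_cart[of "p n" i0] by (smt (verit) divide_nonneg_nonneg zero_le_power)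
      then show ?thesis using \<Lambda>(1)[of "dyadic_block n"] by linarith
    qed
    have summable_p: "summable (\<lambda>n. \<bar>d n\<bar> / (1 + norm (p n)))" if d: "\<And>n. 0 \<le> d n" "\<And>n. d n \<le> b n" for d
    proof (rule summable_comparison_test'[where g = "\<lambda>n. (1/2)^n" and N = 0])
      fix n
      have "2 ^ n * d n \<le> 2 ^ n * b n" using d by simp
      also have "\<dots> \<le> y (dyadic_block n)" by (rule y(2)[OF dyadic_block_less])
      also have "\<dots> \<le> 1 + norm (p n)" by (rule norm_p)
      finally show "norm (\<bar>d n\<bar> / (1 + norm (p n))) \<le> (1/2)^n"
        using d(1)[of n] by (simp add: power_divide field_simps add_pos_nonneg)
    qed (simp add: summable_geometric)
    have "ching_atoms \<phi> \<Phi> e m D p r"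
    proof (intro ching_atoms.intro ching_atoms_axioms.intro)
      show "littlewood_paley_pair \<phi> \<Phi>" by unfold_locales
      show "summable (\<lambda>n. \<bar>D n\<bar> / (1 + norm (p n)))" by (rule summable_p) (use D b in auto)
      show "summable (\<lambda>n. \<bar>2 powr (- m * real n) * D n\<bar> / (1 + norm (p n)))"
        by (rule summable_p) (use D b in auto)
    qed (use e r D \<mu> in auto)
    then interpret X: ching_atoms \<phi> \<Phi> e m D p r .
    obtain C where C: "C > 0" "\<And>n k x. k \<ge> 1 \<Longrightarrow>
        norm (LINT y|lborel. X.profile n y * K k (x - y)) \<le> C * (2 ^ k) ^ CARD('n) / (1 + 2 ^ k * norm (x - p n))"
    proof -
      have "\<exists>C>0. \<forall>n k x. k \<ge> 1 \<longrightarrow> norm (LINT y|lborel. X.profile n y * K k (x - y)) \<le> C * (2 ^ k) ^ CARD('n) / (1 + 2 ^ k * norm (x - p n))"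
        by (rule X.profile_K_bound) blast
      then show thesis using that by blast
    qed
    have separated: "y (max l l') / 2 \<le> \<bar>real (\<Lambda> l) - real (\<Lambda> l')\<bar>" if "l \<noteq> l'" for l l'
    proof -
      \<comment> \<open>As \<open>y j \<ge> 4 * y i\<close> and \<open>y i \<ge> 1\<close>, the
        rounded height of block \<open>i\<close> is at most
        \<open>y i + 1 \<le> y j / 2\<close>.\<close>
      have *: "y j / 2 \<le> real (\<Lambda> j) - real (\<Lambda> i)" if "i < j" for i j
        using y(4)[OF that] y(1)[of i] \<Lambda>(2)[of i] \<Lambda>(1)[of j] by linarith
      consider "l < l'" | "l' < l" using \<open>l \<noteq> l'\<close> by linarith
      then show ?thesis
      proof cases
        case 1
        then have eq: "max l l' = l'" by simp
        show ?thesis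
          unfolding eq using *[OF 1] abs_ge_minus_self[of "real (\<Lambda> l) - real (\<Lambda> l')"] by linarith
      next
        case 2
        then have eq: "max l l' = l" by simp
        show ?thesis
          unfolding eq using *[OF 2] abs_ge_self[of "real (\<Lambda> l) - real (\<Lambda> l')"] by linarith
      qed
    qed
    \<comment> \<open>With \<open>j\<close> the later of the two blocks, a foreign centre is at
      distance at least \<open>y j / 2 - 1\<close> from \<open>x\<close>, and
      \<open>E l * y j\<close> is at least \<open>4 ^ l * (2 ^ n * b n)\<close>. The bound sums over
      \<open>n\<close> to \<open>4 * E l / 4 ^ l\<close>.\<close>
    have interference: "(if n \<in> I l then 0 else \<bar>D n\<bar> / (1 + norm (x - p n))) \<le> 2 * E l / 4 ^ l * (1/2) ^ n"
      if x: "x \<in> ball (P l) (1 / 2 ^ Suc \<mu>)" and E: "E l > 0" for n l x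
    proof (cases "n \<in> I l \<or> D n = 0")
      case False
      define j where "j = max l (dyadic_block n)"
      have nj: "n < 2 ^ Suc j"
        by (rule less_le_trans[OF dyadic_block_less]) (auto simp: j_def intro!: power_increasing)
      have "norm (P l - x) < 1"
      proof -
        have "1 / 2 ^ Suc \<mu> \<le> (1::real)" by (simp del: power_Suc)
        then show ?thesis using x unfolding mem_ball dist_norm by linarith
      qed
      moreover have "P l - p n = (real (\<Lambda> l) - real (\<Lambda> (dyadic_block n))) *\<^sub>R e"
        by (simp add: P_def p_def algebra_simps)
      then have "norm (P l - p n) = \<bar>real (\<Lambda> l) - real (\<Lambda> (dyadic_block n))\<bar>" using e by simp
      moreover have "y j / 2 \<le> \<bar>real (\<Lambda> l) - real (\<Lambda> (dyadic_block n))\<bar>"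
        unfolding j_def using False by (intro separated) (auto simp: I_def)
      moreover have "norm (P l - p n) \<le> norm (P l - x) + norm (x - p n)"
        using norm_triangle_ineq[of "P l - x" "x - p n"] by simp
      ultimately have far: "y j / 2 \<le> 1 + norm (x - p n)" by linarith
      have "4 ^ l * (2 ^ n * D n) \<le> 4 ^ l * (2 ^ n * b n)" using b(2) by simp
      also have "\<dots> \<le> E l * y j" using y(3)[OF nj, of l] E by (simp add: j_def)
      also have "\<dots> \<le> E l * (2 * (1 + norm (x - p n)))" using far E by (intro mult_left_mono) auto
      finally have "D n \<le> 2 * E l / 4 ^ l * (1/2) ^ n * (1 + norm (x - p n))"
        by (simp add: power_divide field_simps)
      then have "D n / (1 + norm (x - p n)) \<le> 2 * E l / 4 ^ l * (1/2) ^ n"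
        by (simp add: divide_le_eq add_pos_nonneg)
      then show ?thesis using False D(1)[of n] by simp
    qed (use E0 in auto)
    have geo: "summable (\<lambda>n. 2 * E l / 4 ^ l * (1/2) ^ n)" "(\<Sum>n. 2 * E l / 4 ^ l * (1/2) ^ n) = 4 * E l / 4 ^ l" for l
      using suminf_geometric[of "1/2::real"]
        suminf_mult[OF summable_geometric[of "1/2::real"], of "2 * E l / 4 ^ l"]
      by (simp_all add: summable_geometric)
    have out: "cube_norm s q \<mu> (\<lambda>k. LP \<phi> \<Phi> k (psido \<phi> \<Phi> (ching_symbol e m) X.F.pair)) = \<infinity>"
    proof (rule cube_norm_infinite[OF q])
      fix T :: real
      define v where "v = measure lborel (ball x0 \<rho>)"
      have v: "v > 0" unfolding v_def using \<phi>(2) by (simp add: content_ball)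
      \<comment> \<open>From \<open>l \<ge> N\<close> on, \<open>C\<close> times the interference
        \<open>4 * E l / 4 ^ l\<close> is at most \<open>c / 2 * E l\<close>.\<close>
      obtain N where "8 * C / c < 4 ^ N" using real_arch_pow[of 4 "8 * C / c"] by auto
      obtain l where l: "l \<ge> N" "E l > 0" and lT: "T / ((c / 2) powr q * v) \<le> E l powr q *
           (\<Sum>k\<in>{\<kappa>..<L l - 5}. 2 powr (real k * q * (s + real CARD('n) - real CARD('n) / q)))"
        using H2[of N "T / ((c / 2) powr q * v)"] unfolding E_def I_def by blast
      obtain R where R: "R \<in> dyadic_cubes \<mu>" "ball (P l) (1 / 2 ^ Suc \<mu>) \<subseteq> R"
        using dyadic_cube_containing_ball[of \<mu> "\<Lambda> l" i0] unfolding P_def e_def h_def by blast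
      have "(4::real) ^ N \<le> 4 ^ l" using l by (intro power_increasing) auto
      then have "8 * C / c \<le> 4 ^ l" using \<open>8 * C / c < 4 ^ N\<close> by linarith
      then have small: "C * (4 * E l / 4 ^ l) \<le> c / 2 * E l" using \<phi>(1) l(2) by (simp add: field_simps)
      have sum: "summable (\<lambda>n. if n \<in> I l then 0 else \<bar>D n\<bar> / (1 + norm (x - p n)))"
        if "x \<in> ball (P l) (1 / 2 ^ Suc \<mu>)" for x
        by (rule summable_comparison_test'[OF geo(1)[of l], of 0]) (use interference[OF that l(2)] in \<open>auto split: if_splits\<close>)
      have "ennreal ((c / 2 * E l) powr q * measure lborel (ball x0 \<rho>) *
          (\<Sum>k\<in>{\<kappa>..<L l - 5}. 2 powr (real k * q * (s + real CARD('n) - real CARD('n) / q)))) \<le>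
        (\<integral>\<^sup>+x\<in>R. (\<Sum>k. ennreal (2 powr (s * real (\<mu> + k) * q) *
          norm (LP \<phi> \<Phi> (\<mu> + k) (psido \<phi> \<Phi> (ching_symbol e m) X.F.pair) x) powr q)) \<partial>lborel)"
      proof (rule X.output_integral_lower_bound[OF q \<kappa>(1,2) finI _ _ E_def[THEN fun_cong] E0 C(2,1) \<phi>(1,3) \<kappa>(3) R(2) sum])
        show "p n = P l" if "n \<in> I l" for n using that by (simp add: I_def p_def)
        show "r n = L l" if "n \<in> I l" for n using that L by (auto simp: I_def)
        show "C * (\<Sum>n. if n \<in> I l then 0 else \<bar>D n\<bar> / (1 + norm (x - p n))) \<le> c / 2 * E l"
          if x: "x \<in> ball (P l) (1 / 2 ^ Suc \<mu>)" for x
        proof -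
          have "(\<Sum>n. if n \<in> I l then 0 else \<bar>D n\<bar> / (1 + norm (x - p n))) \<le> 4 * E l / 4 ^ l"
            unfolding geo(2)[symmetric] by (rule suminf_le[OF interference[OF x l(2)] sum[OF x] geo(1)])
          then show ?thesis using C(1) small by (meson less_imp_le mult_left_mono order_trans)
        qed
      qed
      moreover have "T \<le> (c / 2 * E l) powr q * v *
          (\<Sum>k\<in>{\<kappa>..<L l - 5}. 2 powr (real k * q * (s + real CARD('n) - real CARD('n) / q)))"
      proof -
        have "(c / 2 * E l) powr q = (c / 2) powr q * E l powr q"
          by (rule powr_mult)
        moreover have "(c / 2) powr q * v > 0" using \<phi>(1) v by simp
        ultimately show ?thesis using lT by (simp add: divide_le_eq mult_ac)
      qed
      ultimately show "\<exists>R\<in>dyadic_cubes \<mu>. ennreal T \<le> (\<integral>\<^sup>+x\<in>R. (\<Sum>k. ennreal (2 powr (s * real (\<mu> + k) * q) *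
          norm (LP \<phi> \<Phi> (\<mu> + k) (psido \<phi> \<Phi> (ching_symbol e m) X.F.pair) x) powr q)) \<partial>lborel)"
        using R(1) unfolding v_def by (blast intro: order_trans[OF ennreal_leI])
    qed
    \<comment> \<open>For \<open>k \<le> \<mu> - 1\<close> the band reaches only atoms with
      \<open>n \<le> \<mu>\<close>, whose coefficients are zero.\<close>
    have "Linf_norm (\<lambda>x. complex_of_real (2 powr (real k * (s + m))) * LP \<phi> \<Phi> k X.F.pair x) = 0" if "k \<in> {0..\<mu> - 1}" for k
    proof -
      have "LP \<phi> \<Phi> k X.F.pair x = 0" for x using that \<mu> by (intro X.LP_input_low D(2)) auto
      then show ?thesis by (simp add: Linf_norm_zero)
    qed
    then have "(SUP k\<in>{0..\<mu> - 1}. Linf_norm (\<lambda>x. complex_of_real (2 powr (real k * (s + m))) * LP \<phi> \<Phi> k X.F.pair x)) = 0"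
      by simp
    moreover have "cube_norm (s + m) q \<mu> (\<lambda>k. LP \<phi> \<Phi> k X.F.pair) < \<infinity>"
      by (rule X.input_norm_finite[OF q \<mu>]) (use H1 D(1) in simp)
    ultimately show "unbounded_on_S11 q \<mu> m s"
      unfolding unbounded_on_S11_def
      using ching_symbol_S11[OF e, of m] X.F.tempered_pair X.psido_converges_ching out
      by (intro exI[of _ "ching_symbol e m"] exI[of _ X.F.pair]) simp
  qed
qed

end

text \<open>The weights cancel the exponential factors of the input series and leave
  \<open>n powr (- (1/2))\<close>, summable along powers of two. In the image the exponent
  \<open>s - \<tau>\<close> is at most 0, so each of the roughly \<open>n\<close> bands below
  \<open>n\<close> counts at least as much as band \<open>n\<close> would, and the total is at least
  of order \<open>n * n powr (- (1/2))\<close>.\<close>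

lemma sparse_weights_conditions:
  fixes s d \<tau> q :: real and \<kappa> \<mu> :: nat
  assumes q: "0 < q" and \<tau>: "\<tau> = d / q - d" and s: "s \<le> \<tau>"
    and D_def: "D = (\<lambda>n. if \<mu> < n \<and> n = 2 ^ dyadic_block n
        then 2 powr (real n * (\<tau> - s)) * real n powr (- (1 / (2 * q))) else 0)"
  shows "summable (\<lambda>n. (2 powr (s * real n) * D n * 2 powr (real n * d * (1 - 1 / q))) powr q)"
    and "\<exists>l\<ge>N. block_mass D l > 0 \<and>
         T \<le> block_mass D l powr q *
           (\<Sum>k\<in>{\<kappa>..<2 ^ l - 5}. 2 powr (real k * q * (s + d - d / q)))"
proof -
  have block: "dyadic_block (2 ^ l) = l" for l by (rule dyadic_block_eqI) auto
  have half: "(real n powr (- (1 / (2 * q)))) powr q = real n powr (- (1/2))" for n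
    using q by (simp add: powr_powr)
  have term_eq: "(2 powr (s * real n) * D n * 2 powr (real n * d * (1 - 1 / q))) powr q =
      (if \<mu> < n \<and> n = 2 ^ dyadic_block n then real n powr (- (1/2)) else 0)" for n
  proof (cases "\<mu> < n \<and> n = 2 ^ dyadic_block n")
    case True
    have "s * real n + real n * (\<tau> - s) + real n * d * (1 - 1 / q) = 0"
      using q by (simp add: \<tau> field_simps)
    then have one: "2 powr (s * real n) * 2 powr (real n * (\<tau> - s)) * 2 powr (real n * d * (1 - 1 / q)) = 1"
      by (simp only: powr_add[symmetric]) simp
    have Dn: "D n = 2 powr (real n * (\<tau> - s)) * real n powr (- (1 / (2 * q)))"
      unfolding D_def if_P[OF True] ..
    have "2 powr (s * real n) * D n * 2 powr (real n * d * (1 - 1 / q)) =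
        (2 powr (s * real n) * 2 powr (real n * (\<tau> - s)) * 2 powr (real n * d * (1 - 1 / q))) * real n powr (- (1 / (2 * q)))"
      unfolding Dn by (simp only: mult_ac)
    then show ?thesis unfolding one if_P[OF True] by (simp only: mult_1 half)
  next
    case False
    then show ?thesis unfolding D_def if_not_P[OF False] by simp
  qed
  have "summable (\<lambda>l. (2 powr (- (1/2))) ^ l :: real)"
    by (rule summable_geometric) (simp add: powr_less_one)
  then have "summable (\<lambda>l. if \<mu> < 2 ^ l \<and> (2::nat) ^ l = 2 ^ dyadic_block (2 ^ l) then real (2 ^ l) powr (- (1/2)) else 0)"
    by (rule summable_comparison_test'[where N = 0])
       (simp add: powr_realpow[symmetric] powr_powr mult.commute)
  then show "summable (\<lambda>n. (2 powr (s * real n) * D n * 2 powr (real n * d * (1 - 1 / q))) powr q)"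
    unfolding term_eq
    by (subst (asm) summable_mono_reindex[of "\<lambda>l. 2 ^ l"]) (auto simp: strict_mono_def)
  \<comment> \<open>The bound \<open>2 * (\<kappa> + 5)\<close> leaves at least \<open>n / 2\<close>
    bands, and \<open>4 * T\<^sup>2\<close> ensures \<open>T \<le> sqrt n / 2\<close>.\<close>
  define X where "X = max (real \<mu>) (max (real (2 * (\<kappa> + 5))) (4 * T\<^sup>2))"
  obtain l0 where l0: "X < 2 ^ l0" using real_arch_pow[of 2 X] by auto
  define l where "l = max l0 N"
  define n :: nat where "n = 2 ^ l"
  have "(2::real) ^ l0 \<le> 2 ^ l" unfolding l_def by (intro power_increasing) auto
  with l0 have "X < 2 ^ l" by linarith
  then have "X < real n" by (simp add: n_def)
  then have n: "real \<mu> < real n" "real (2 * (\<kappa> + 5)) \<le> real n" "4 * T\<^sup>2 \<le> real n"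
    unfolding X_def by linarith+
  have n0: "real n > 0" by (simp add: n_def)
  have Dn: "D n = 2 powr (real n * (\<tau> - s)) * real n powr (- (1 / (2 * q)))"
    using n(1) block[of l] by (simp add: D_def n_def)
  then have "D n > 0" using n0 by simp
  then have "{n. dyadic_block n = l \<and> D n \<noteq> 0} = {n}"
    using block[of l] by (auto simp: n_def D_def split: if_splits)
  then have sum: "block_mass D l = D n" by simp
  have "real (n - 5 - \<kappa>) * 2 powr (real n * q * (s - \<tau>)) \<le> (\<Sum>k\<in>{\<kappa>..<n - 5}. 2 powr (real k * q * (s + d - d / q)))"
  proof -
    have "2 powr (real n * q * (s - \<tau>)) \<le> 2 powr (real k * q * (s + d - d / q))" if "k \<in> {\<kappa>..<n - 5}" for k
    proof (rule powr_mono)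
      have "real k * (q * (\<tau> - s)) \<le> real n * (q * (\<tau> - s))" using that q s by (intro mult_right_mono) auto
      moreover have "real j * q * (s - \<tau>) = - (real j * (q * (\<tau> - s)))" for j by (simp add: algebra_simps)
      moreover have "s + d - d / q = s - \<tau>" by (simp add: \<tau>)
      ultimately show "real n * q * (s - \<tau>) \<le> real k * q * (s + d - d / q)" by (simp only: neg_le_iff_le)
    qed simp
    from sum_mono[OF this, of "{\<kappa>..<n - 5}" "\<lambda>k. k"] show ?thesis by simp
  qed
  then have "D n powr q * (real (n - 5 - \<kappa>) * 2 powr (real n * q * (s - \<tau>))) \<le>
      D n powr q * (\<Sum>k\<in>{\<kappa>..<n - 5}. 2 powr (real k * q * (s + d - d / q)))"
    by (intro mult_left_mono) auto
  moreover have "D n powr q * (real (n - 5 - \<kappa>) * 2 powr (real n * q * (s - \<tau>))) = real (n - 5 - \<kappa>) * real n powr (- (1/2))"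
  proof -
    have "D n powr q = 2 powr (real n * (\<tau> - s) * q) * real n powr (- (1/2))"
      unfolding Dn half[symmetric] powr_mult by (simp add: powr_powr)
    moreover have "2 powr (real n * (\<tau> - s) * q) * 2 powr (real n * q * (s - \<tau>)) = 1"
      by (simp add: powr_add[symmetric] algebra_simps)
    ultimately show ?thesis by (simp add: mult_ac)
  qed
  moreover have "T \<le> real (n - 5 - \<kappa>) * real n powr (- (1/2))"
  proof -
    have "T \<le> sqrt (real n) / 2"
      using real_sqrt_le_mono[OF n(3)] by (simp add: real_sqrt_mult)
    also have "sqrt (real n) / 2 = real n / 2 * real n powr (- (1/2))"
    proof -
      have "real n * real n powr (- (1/2)) = real n powr (1 + - (1/2))"
        using n0 by (simp only: powr_add) simp
      then show ?thesis using n0 by (simp add: powr_half_sqrt)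
    qed
    also have "\<dots> \<le> real (n - 5 - \<kappa>) * real n powr (- (1/2))"
      using n(2) by (intro mult_right_mono) auto
    finally show ?thesis .
  qed
  ultimately have le: "T \<le> D n powr q * (\<Sum>k\<in>{\<kappa>..<n - 5}. 2 powr (real k * q * (s + d - d / q)))" by linarith
  show "\<exists>l\<ge>N. block_mass D l > 0 \<and>
         T \<le> block_mass D l powr q *
           (\<Sum>k\<in>{\<kappa>..<2 ^ l - 5}. 2 powr (real k * q * (s + d - d / q)))"
  proof (intro exI[of _ l] conjI)
    show "N \<le> l" by (simp add: l_def)
    show "block_mass D l > 0" unfolding sum by fact
    show "T \<le> block_mass D l powr q *
           (\<Sum>k\<in>{\<kappa>..<2 ^ l - 5}. 2 powr (real k * q * (s + d - d / q)))"
      unfolding sum using le by (simp only: n_def)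
  qed
qed

lemma sparse_weights:
  assumes "0 < q" "s \<le> d / q - d"
  obtains D where "admissible_weights q d s \<mu> \<kappa> D (\<lambda>n. n) (\<lambda>l. 2 ^ l)"
proof -
  define D where "D = (\<lambda>n. if \<mu> < n \<and> n = 2 ^ dyadic_block n
    then 2 powr (real n * (d / q - d - s)) * real n powr (- (1 / (2 * q))) else 0)"
  note conditions = sparse_weights_conditions[OF assms(1) refl assms(2) D_def]
  have "admissible_weights q d s \<mu> \<kappa> D (\<lambda>n. n) (\<lambda>l. 2 ^ l)"
    unfolding admissible_weights_def
  proof (intro conjI allI)
    show "D n \<noteq> 0 \<longrightarrow> n = 2 ^ dyadic_block n" for n by (simp only: D_def split: if_split) blast
  qed (rule conditions | simp add: D_def)+
  then show ?thesis by (rule that)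
qed

text \<open>\<theta> is the midpoint of \<open>1 / q\<close> and 1: \<open>\<theta> * q > 1\<close>
  makes the input summable, while \<open>\<theta> < 1\<close> makes the block masses grow at least
  like \<open>2 powr (l * (1 - \<theta>))\<close>. The width index is at most
  \<open>\<kappa> + 6\<close>, so the factor from the L^q norm is bounded, and the single band
  \<open>k = \<kappa>\<close> of the image is enough.\<close>

lemma dense_weights_conditions:
  fixes s d q :: real and \<kappa> N0 :: nat
  assumes q: "1 < q" and d: "d \<ge> 0" and s: "s \<le> 0"
    and \<theta>_def: "\<theta> = (1 + 1 / q) / 2"
    and D_def: "D = (\<lambda>n. if N0 \<le> n then 2 powr (- s * real n) * real n powr (- \<theta>) else 0)"
  shows "summable (\<lambda>n. (2 powr (s * real n) * D n * 2 powr (real (min n (\<kappa> + 6)) * d * (1 - 1 / q))) powr q)"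
    and "\<exists>l\<ge>N. block_mass D l > 0 \<and>
         T \<le> block_mass D l powr q *
           (\<Sum>k\<in>{\<kappa>..<\<kappa> + 6 - 5}. 2 powr (real k * q * (s + d - d / q)))"
proof -
  have \<theta>: "0 < \<theta>" "\<theta> < 1" "\<theta> * q > 1" using q by (auto simp: \<theta>_def field_simps)
  define B where "B = 2 powr (real (\<kappa> + 6) * d * (1 - 1 / q))"
  show "summable (\<lambda>n. (2 powr (s * real n) * D n * 2 powr (real (min n (\<kappa> + 6)) * d * (1 - 1 / q))) powr q)"
  proof (rule summable_comparison_test'[where N = 0])
    show "summable (\<lambda>n. B powr q * real n powr (- (\<theta> * q)))"
      using \<theta>(3) by (intro summable_mult) (simp add: summable_real_powr_iff)
    fix n
    have "2 powr (s * real n) * D n \<le> real n powr (- \<theta>)"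
    proof -
      have "2 powr (s * real n) * 2 powr (- s * real n) = 1" by (simp add: powr_add[symmetric])
      then show ?thesis by (simp add: D_def mult.assoc[symmetric])
    qed
    moreover have "2 powr (real (min n (\<kappa> + 6)) * d * (1 - 1 / q)) \<le> B"
      unfolding B_def using q d by (intro powr_mono mult_right_mono) auto
    ultimately have "2 powr (s * real n) * D n * 2 powr (real (min n (\<kappa> + 6)) * d * (1 - 1 / q)) \<le> real n powr (- \<theta>) * B"
      by (rule mult_mono) auto
    then have "(2 powr (s * real n) * D n * 2 powr (real (min n (\<kappa> + 6)) * d * (1 - 1 / q))) powr q \<le> (real n powr (- \<theta>) * B) powr q"
      using q by (intro powr_mono2) (auto simp: D_def)
    then show "norm ((2 powr (s * real n) * D n * 2 powr (real (min n (\<kappa> + 6)) * d * (1 - 1 / q))) powr q) \<le> B powr q * real n powr (- (\<theta> * q))"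
      by (simp add: powr_mult powr_powr mult.commute)
  qed
  define v where "v = 2 powr (real \<kappa> * q * (s + d - d / q))"
  have v: "v > 0" by (simp add: v_def)
  \<comment> \<open>\<open>Y \<ge> 1\<close> will make the block mass at least 1, so that raising it
    to the power \<open>q > 1\<close> does not decrease it.\<close>
  define Y where "Y = max 1 (T / v)"
  have "T / v \<le> Y" by (simp add: Y_def)
  then have Y: "Y \<ge> 1" "T \<le> Y * v" using v by (simp_all add: pos_divide_le_eq) (simp add: Y_def)
  \<comment> \<open>Chosen so that \<open>Y \<le> 2 powr (l - (l + 1) * \<theta>)\<close>: the block
    has \<open>2 ^ l\<close> members, each with weight at least
    \<open>2 powr (- (l + 1) * \<theta>)\<close>.\<close>
  obtain l0 where l0: "(log 2 Y + \<theta>) / (1 - \<theta>) \<le> real l0" using real_arch_simple by blast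
  define l where "l = max l0 (max N N0)"
  have l': "real l0 \<le> real l" "N \<le> l" "N0 \<le> l" by (auto simp: l_def)
  have l: "real l0 \<le> real l" "N \<le> l" "N0 \<le> 2 ^ l"
    using l' less_exp[of l] by linarith+
  have "log 2 Y + \<theta> \<le> real l * (1 - \<theta>)"
    using order_trans[OF l0 l(1)] \<theta>(2) by (simp add: divide_le_eq)
  then have "2 powr (log 2 Y) \<le> 2 powr (real l - real (Suc l) * \<theta>)"
    by (intro powr_mono) (auto simp: algebra_simps)
  then have "Y \<le> 2 powr (real l - real (Suc l) * \<theta>)" using Y(1) by simp
  also have "\<dots> = real (card {2 ^ l..<(2::nat) ^ Suc l}) * real (2 ^ Suc l) powr (- \<theta>)"
  proof -
    have "real (card {2 ^ l..<(2::nat) ^ Suc l}) = 2 powr real l" by (simp add: powr_realpow)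
    moreover have "real (2 ^ Suc l) = 2 powr real (Suc l)" by (simp only: powr_realpow zero_less_numeral of_nat_power of_nat_numeral)
    ultimately show ?thesis by (simp only: powr_powr powr_add[symmetric]) simp
  qed
  also have "\<dots> = (\<Sum>n\<in>{2 ^ l..<(2::nat) ^ Suc l}. real (2 ^ Suc l) powr (- \<theta>))" by simp
  also have "\<dots> \<le> (\<Sum>n\<in>{2 ^ l..<(2::nat) ^ Suc l}. D n)"
  proof (rule sum_mono)
    fix n assume n: "n \<in> {2 ^ l..<(2::nat) ^ Suc l}"
    then have n0: "n > 0" by (auto intro: less_le_trans[of 0 "2 ^ l"])
    have "real n \<le> real (2 ^ Suc l)" using n by (simp only: of_nat_le_iff) simp
    then have "real (2 ^ Suc l) powr (- \<theta>) \<le> real n powr (- \<theta>)"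
      using n0 \<theta>(1) by (intro powr_mono2') auto
    also have "\<dots> \<le> 2 powr (- s * real n) * real n powr (- \<theta>)"
    proof -
      have "2 powr 0 \<le> 2 powr (- s * real n)" using s by (intro powr_mono) (auto intro: mult_nonpos_nonneg)
      then show ?thesis using mult_right_mono[of 1 "2 powr (- s * real n)" "real n powr (- \<theta>)"] by simp
    qed
    finally show "real (2 ^ Suc l) powr (- \<theta>) \<le> D n" using n l(3) by (simp add: D_def)
  qed
  also have "\<dots> = block_mass D l"
  proof (rule sum.mono_neutral_cong_right)
    show "{n. dyadic_block n = l \<and> D n \<noteq> 0} \<subseteq> {2 ^ l..<2 ^ Suc l}"
    proof
      fix n assume "n \<in> {n. dyadic_block n = l \<and> D n \<noteq> 0}"
      then have n: "dyadic_block n = l" "D n \<noteq> 0" by auto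
      have "D 0 = 0" by (simp add: D_def)
      then have "n > 0" using n(2) by (cases n) auto
      moreover have "\<not> n < 2 ^ l"
      proof
        assume "n < 2 ^ l"
        then obtain i where "l = Suc i" using \<open>n > 0\<close> by (cases l) auto
        then have "dyadic_block n \<le> i" using \<open>n < 2 ^ l\<close> unfolding dyadic_block_def by (intro Least_le) simp
        then show False using n \<open>l = Suc i\<close> by simp
      qed
      ultimately show "n \<in> {2 ^ l..<2 ^ Suc l}" using dyadic_block_less[of n] n by auto
    qed
    show "\<forall>n\<in>{2 ^ l..<2 ^ Suc l} - {n. dyadic_block n = l \<and> D n \<noteq> 0}. D n = 0"
      using dyadic_block_eqI by auto
  qed auto
  finally have E: "Y \<le> block_mass D l" (is "_ \<le> ?E") .
  have "T \<le> ?E * v" using Y(2) E v by (meson less_imp_le mult_right_mono order_trans)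
  also have "?E \<le> ?E powr q" using powr_mono[of 1 q ?E] q Y(1) E by simp
  then have "?E * v \<le> ?E powr q * v" using v by (intro mult_right_mono) auto
  finally have "T \<le> ?E powr q * (\<Sum>k\<in>{\<kappa>..<\<kappa> + 6 - 5}. 2 powr (real k * q * (s + d - d / q)))"
    by (simp add: v_def)
  then show "\<exists>l\<ge>N. block_mass D l > 0 \<and>
         T \<le> block_mass D l powr q *
           (\<Sum>k\<in>{\<kappa>..<\<kappa> + 6 - 5}. 2 powr (real k * q * (s + d - d / q)))"
    using l(2) E Y(1) by (intro exI[of _ l]) auto
qed

lemma dense_weights:
  assumes "1 < q" "0 \<le> d" "s \<le> 0"
  obtains D where "admissible_weights q d s \<mu> \<kappa> D (\<lambda>n. min n (\<kappa> + 6)) (\<lambda>_. \<kappa> + 6)"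
proof -
  \<comment> \<open>The start at \<open>\<mu> + \<kappa> + 6\<close> removes the coefficients up to
    \<mu> and ensures \<open>min n (\<kappa> + 6) = \<kappa> + 6\<close> wherever \<open>D n\<close>
    is nonzero.\<close>
  define D where "D = (\<lambda>n. if \<mu> + \<kappa> + 6 \<le> n then 2 powr (- s * real n) * real n powr (- ((1 + 1 / q) / 2)) else 0)"
  note conditions = dense_weights_conditions[OF assms refl D_def]
  have "admissible_weights q d s \<mu> \<kappa> D (\<lambda>n. min n (\<kappa> + 6)) (\<lambda>_. \<kappa> + 6)"
    unfolding admissible_weights_def
    by (intro conjI allI conditions) (simp_all add: D_def)
  then show ?thesis by (rule that)
qed

theorem theorem2p7:
  fixes \<phi> \<Phi> :: "real^'n \<Rightarrow> complex"
    and q m s :: real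
    and \<mu> :: nat
  assumes "littlewood_paley \<phi> \<Phi>"
    and "0 < q"
    and "1 \<le> \<mu>"
    and "s \<le> tau CARD('n) q"
  shows "\<exists>(a :: (real^'n) \<times> (real^'n) \<Rightarrow> complex) (f :: (real^'n) functional).
    symbol_S11 m a \<and> tempered f \<and>
    (SUP k\<in>{0..\<mu> - 1}. Linf_norm (\<lambda>x. complex_of_real (2 powr (real k * (s + m))) * LP \<phi> \<Phi> k f x))
      + cube_norm (s + m) q \<mu> (\<lambda>k. LP \<phi> \<Phi> k f) < \<infinity> \<and>
    psido_converges \<phi> \<Phi> a f \<and>
    cube_norm s q \<mu> (\<lambda>k. LP \<phi> \<Phi> k (psido \<phi> \<Phi> a f)) = \<infinity>"
proof -
  interpret littlewood_paley_pair \<phi> \<Phi> by unfold_locales (rule assms(1))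
  have "unbounded_on_S11 q \<mu> m s"
  proof (rule counterexample_from_weights[OF assms(2,3)])
    fix \<kappa>
    assume counterexample: "\<And>m s D r L. admissible_weights q (real CARD('n)) s \<mu> \<kappa> D r L \<Longrightarrow> unbounded_on_S11 q \<mu> m s"
    show ?thesis
    \<comment> \<open>\<open>tau\<close> is \<open>d / q - d\<close> for \<open>q \<le> 1\<close>
      and 0 for \<open>q > 1\<close>.\<close>
    proof (cases "q \<le> 1")
      case True
      then have "s \<le> real CARD('n) / q - real CARD('n)" using assms(4) by (simp add: tau_def)
      then obtain D where "admissible_weights q (real CARD('n)) s \<mu> \<kappa> D (\<lambda>n. n) (\<lambda>l. 2 ^ l)"
        using sparse_weights[OF assms(2)] by blast
      then show ?thesis by (rule counterexample)
    next
      case False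
      then have qs: "q > 1" "s \<le> 0" using assms(4) by (simp_all add: tau_def)
      obtain D where "admissible_weights q (real CARD('n)) s \<mu> \<kappa> D (\<lambda>n. min n (\<kappa> + 6)) (\<lambda>_. \<kappa> + 6)"
        using dense_weights[OF qs(1) of_nat_0_le_iff qs(2)] by blast
      then show ?thesis by (rule counterexample)
    qed
  qed
  then show ?thesis unfolding unbounded_on_S11_def .
qed

end
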